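(* If $S$ is a C$^*$-regular left cancellative monoid, then the representation $\rho_{\chi_e}$ of $C^*_r(\mathcal{G}(S))$ defines an isomorphism $C^*_r(\mathcal{G}(S))\cong C^*_r(S)$.
   Context: Monoid. Let $S$ be a left cancellative monoid with identity $e$. $C^*_r(S)\subset B(\ell^2(S))$ is the C$^*$-algebra generated by the operators $\lambda_s$, $\lambda_s\delta_t=\delta_{st}$. The left inverse hull $I_\ell(S)$ is the inverse semigroup of partial bijections of $S$ generated by the left translations $t\mapsto st$ ($s\in S$); $S$ is viewed as a subset of $I_\ell(S)$, and $s^{-1}\in I_\ell(S)$ is the bijection $sS\to S$ inverse to $t\mapsto st$. If the empty map is in $I_\ell(S)$ it is denoted by $0$. $E(S)$ is the semigroup of idempotents of $I_\ell(S)$; each of them is the identity map $p_X$ on a constructible right ideal $X=s_1^{-1}t_1\dots s_n^{-1}t_nS$, and $\mathcal{J}(S)$ is the set of constructible right ideals. $\bar{\mathcal{J}}(S)$ is the collection of subsets of $S$ consisting of $\mathcal{J}(S)$ and all sets $X\setminus\bigcup_{i=1}^mX_i$ with $X,X_1,\dots,X_m\in\mathcal{J}(S)$. Groupoids. $\widehat{E(S)}$ is the compact space (topology of pointwise convergence) of not identically zero semigroup homomorphisms $E(S)\to\{0,1\}$ (semi-characters). For $s\in S$, $\chi_s(p_X)=1$ if $s\in X$ and $0$ otherwise. The Paterson groupoid $\mathcal{G}(I_\ell(S))$ is the set of classes $[g,\chi]$ of pairs $(g,\chi)\in I_\ell(S)\times\widehat{E(S)}$ with $\chi(g^{-1}g)=1$,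 where $(g_1,\chi_1)$, $(g_2,\chi_2)$ are equivalent iff $\chi_1=\chi_2$ and $g_1p=g_2p$ for some $p\in E(S)$ with $\chi_1(p)=1$. Product: $[g,\chi][h,\psi]=[gh,\psi]$ if $\chi=\psi(h^{-1}\cdot h)$; the unit space is identified with $\widehat{E(S)}$ via $\chi\mapsto[p_S,\chi]$; $s([g,\chi])=\chi$, $r([g,\chi])=\chi(g^{-1}\cdot g)$. A basis of the topology is given by the sets $D(g,U)=\{[g,\chi]:\chi\in U\}$, $U$ an open subset of $\{\chi:\chi(g^{-1}g)=1\}$. Let $\Omega(S)$ be the closure of $\{\chi_s: s\in S\}$ in $\widehat{E(S)}$ (an invariant set), and $\mathcal{G}_P(S)=\mathcal{G}(I_\ell(S))_{\Omega(S)}=r^{-1}(\Omega(S))=s^{-1}(\Omega(S))$. Each $\chi\in\Omega(S)$ extends to $\bar{\mathcal{J}}(S)$: for $X,X_i\in\mathcal{J}(S)$, $\chi(p_{X\setminus\bigcup_iX_i})=1$ if $\chi(p_X)=1$ and $\chi(p_{X_i})=0$ for all $i$, and it is $0$ otherwise. Then $\mathcal{G}(S)=\mathcal{G}_P(S)/{\sim}$ is the quotient (étale, possibly non-Hausdorff) groupoid, where $[g,\chi]\sim[h,\chi]$ iff there is $X\in\bar{\mathcal{J}}(S)$ with $\chi(p_X)=1$ and $g|_X=h|_X$. Reduced C$^*$-algebra. For a locally compact étale groupoid $\mathcal{G}$, $C_c(\mathcal{G})$ is the linear span, inside functions on $\mathcal{G}$, of $C_c(V)$ (extended by zero) over open Hausdorff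 $V\subset\mathcal{G}$, with convolution $(f_1*f_2)(g)=\sum_{h\in\mathcal{G}^{r(g)}}f_1(h)f_2(h^{-1}g)$ and $f^*(g)=\overline{f(g^{-1})}$; for $x\in\mathcal{G}^{(0)}$, $\rho_x$ is the representation on $\ell^2(\mathcal{G}_x)$, $\mathcal{G}_x=s^{-1}(x)$, given by $(\rho_x(f)\xi)(g)=\sum_{h\in\mathcal{G}^{r(g)}}f(h)\xi(h^{-1}g)$, and $C^*_r(\mathcal{G})$ is the completion in $\|f\|_r=\sup_x\|\rho_x(f)\|$. For $\mathcal{G}=\mathcal{G}(S)$, the map $s\mapsto[s,\chi_e]$ is a bijection $S\to\mathcal{G}_{\chi_e}$, so $\rho_{\chi_e}$ is viewed as a representation on $\ell^2(S)$; it gives a surjective $*$-homomorphism $C^*_r(\mathcal{G}(S))\to C^*_r(S)$. C$^*$-regularity. $S$ is C$^*$-regular if, given $h_1,\dots,h_n\in I_\ell(S)$ and $X\in\bar{\mathcal{J}}(S)$ satisfying $\emptyset\ne X\subset\bigcup_{k=1}^n\{s\in S:h_ks=s\}$, there are $Y_1,\dots,Y_l\in\bar{\mathcal{J}}(S)$ and indices $1\le k_j\le n$ ($j=1,\dots,l$) such that $X\subset\bigcup_{j=1}^lY_j$ and $h_{k_j}|_{Y_j}=\mathrm{id}$ for all $1\le j\le l$. (Here $h_ks=s$ means that $s$ is in the domain of $h_k$ and is fixed by it.) *)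

theory Defs
  imports "HOL-Analysis.Analysis"
begin

section \<open>The Hilbert space of square-summable functions on a set\<close>

text \<open>
  For a set \<open>A\<close> of elements of a type \<open>'b\<close>, vectors of \<open>l\<^sup>2(A)\<close> are functions on the whole type that
  vanish off \<open>A\<close>, and operators on \<open>l\<^sup>2(A)\<close> are functions that are \<open>0\<close> off \<open>l\<^sup>2(A)\<close>. With these
  conventions equality of vectors and of operators is equality in HOL.
\<close>

type_synonym 'b vec = "'b \<Rightarrow> complex"
type_synonym 'b op = "'b vec \<Rightarrow> 'b vec"

definition ell2 :: "'b set \<Rightarrow> 'b vec set" where
  "ell2 A = {\<xi>. (\<forall>a. a \<notin> A \<longrightarrow> \<xi> a = 0) \<and> (\<lambda>a. (cmod (\<xi> a))\<^sup>2) summable_on A}"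

definition ell2_inner :: "'b set \<Rightarrow> 'b vec \<Rightarrow> 'b vec \<Rightarrow> complex" where
  "ell2_inner A \<xi> \<eta> = (\<Sum>\<^sub>\<infinity>a\<in>A. \<xi> a * cnj (\<eta> a))"

definition ell2_norm :: "'b set \<Rightarrow> 'b vec \<Rightarrow> real" where
  "ell2_norm A \<xi> = sqrt (\<Sum>\<^sub>\<infinity>a\<in>A. (cmod (\<xi> a))\<^sup>2)"

definition delta :: "'b \<Rightarrow> 'b vec" where
  "delta b = (\<lambda>a. if a = b then 1 else 0)"

definition bounded_ops :: "'b set \<Rightarrow> 'b op set" where
  "bounded_ops A = {T.
     (\<forall>\<xi>\<in>ell2 A. T \<xi> \<in> ell2 A) \<and>
     (\<forall>\<xi>. \<xi> \<notin> ell2 A \<longrightarrow> T \<xi> = (\<lambda>a. 0)) \<and>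
     (\<forall>\<xi>\<in>ell2 A. \<forall>\<eta>\<in>ell2 A. T (\<lambda>a. \<xi> a + \<eta> a) = (\<lambda>a. T \<xi> a + T \<eta> a)) \<and>
     (\<forall>c. \<forall>\<xi>\<in>ell2 A. T (\<lambda>a. c * \<xi> a) = (\<lambda>a. c * T \<xi> a)) \<and>
     (\<exists>C. \<forall>\<xi>\<in>ell2 A. ell2_norm A (T \<xi>) \<le> C * ell2_norm A \<xi>)}"

definition op_norm :: "'b set \<Rightarrow> 'b op \<Rightarrow> real" where
  "op_norm A T = (SUP \<xi>\<in>{\<xi>\<in>ell2 A. ell2_norm A \<xi> \<le> 1}. ell2_norm A (T \<xi>))"

definition op_adjoint :: "'b set \<Rightarrow> 'b op \<Rightarrow> 'b op" where
  "op_adjoint A T = (THE T'. T' \<in> bounded_ops A \<and>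
     (\<forall>\<xi>\<in>ell2 A. \<forall>\<eta>\<in>ell2 A. ell2_inner A (T \<xi>) \<eta> = ell2_inner A \<xi> (T' \<eta>)))"


section \<open>Normed star-algebras, completions and isomorphisms\<close>

record 'b star_alg =
  sa_carrier :: "'b set"
  sa_add :: "'b \<Rightarrow> 'b \<Rightarrow> 'b"
  sa_scale :: "complex \<Rightarrow> 'b \<Rightarrow> 'b"
  sa_mult :: "'b \<Rightarrow> 'b \<Rightarrow> 'b"
  sa_star :: "'b \<Rightarrow> 'b"
  sa_norm :: "'b \<Rightarrow> real"

definition sa_dist :: "'b star_alg \<Rightarrow> 'b \<Rightarrow> 'b \<Rightarrow> real" where
  "sa_dist A x y = sa_norm A (sa_add A x (sa_scale A (-1) y))"

definition star_isomorphism :: "'b star_alg \<Rightarrow> 'c star_alg \<Rightarrow> ('b \<Rightarrow> 'c) \<Rightarrow> bool" where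
  "star_isomorphism A B \<phi> \<longleftrightarrow>
     bij_betw \<phi> (sa_carrier A) (sa_carrier B) \<and>
     (\<forall>x\<in>sa_carrier A. \<forall>y\<in>sa_carrier A. \<phi> (sa_add A x y) = sa_add B (\<phi> x) (\<phi> y)) \<and>
     (\<forall>c. \<forall>x\<in>sa_carrier A. \<phi> (sa_scale A c x) = sa_scale B c (\<phi> x)) \<and>
     (\<forall>x\<in>sa_carrier A. \<forall>y\<in>sa_carrier A. \<phi> (sa_mult A x y) = sa_mult B (\<phi> x) (\<phi> y)) \<and>
     (\<forall>x\<in>sa_carrier A. \<phi> (sa_star A x) = sa_star B (\<phi> x))"

definition closed_star_subalgebra :: "'b star_alg \<Rightarrow> 'b set \<Rightarrow> bool" where
  "closed_star_subalgebra B M \<longleftrightarrow>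
     M \<subseteq> sa_carrier B \<and> M \<noteq> {} \<and>
     (\<forall>x\<in>M. \<forall>y\<in>M. sa_add B x y \<in> M) \<and>
     (\<forall>c. \<forall>x\<in>M. sa_scale B c x \<in> M) \<and>
     (\<forall>x\<in>M. \<forall>y\<in>M. sa_mult B x y \<in> M) \<and>
     (\<forall>x\<in>M. sa_star B x \<in> M) \<and>
     (\<forall>x b. (\<forall>n::nat. x n \<in> M) \<and> b \<in> sa_carrier B \<and> (\<lambda>n. sa_dist B (x n) b) \<longlonglongrightarrow> 0 \<longrightarrow> b \<in> M)"

definition generated_cstar_subalgebra :: "'b star_alg \<Rightarrow> 'b set \<Rightarrow> 'b star_alg" where
  "generated_cstar_subalgebra B F = B\<lparr>sa_carrier := closed_star_subalgebra B hull F\<rparr>"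

definition cauchy_seqs :: "'b star_alg \<Rightarrow> (nat \<Rightarrow> 'b) set" where
  "cauchy_seqs A = {x. (\<forall>n. x n \<in> sa_carrier A) \<and>
     (\<forall>e>0. \<exists>N. \<forall>m\<ge>N. \<forall>n\<ge>N. sa_dist A (x m) (x n) < e)}"

definition null_rel :: "'b star_alg \<Rightarrow> ((nat \<Rightarrow> 'b) \<times> (nat \<Rightarrow> 'b)) set" where
  "null_rel A = {(x, y). x \<in> cauchy_seqs A \<and> y \<in> cauchy_seqs A \<and>
     (\<lambda>n. sa_dist A (x n) (y n)) \<longlonglongrightarrow> 0}"

text \<open>The operations on the completion are the term-by-term ones; each is written as the saturation
  of the set of all results obtained from representatives.\<close>

definition completion :: "'b star_alg \<Rightarrow> (nat \<Rightarrow> 'b) set star_alg" where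
  "completion A = \<lparr>
     sa_carrier = cauchy_seqs A // null_rel A,
     sa_add = (\<lambda>X Y. null_rel A `` {\<lambda>n. sa_add A (x n) (y n) | x y. x \<in> X \<and> y \<in> Y}),
     sa_scale = (\<lambda>c X. null_rel A `` {\<lambda>n. sa_scale A c (x n) | x. x \<in> X}),
     sa_mult = (\<lambda>X Y. null_rel A `` {\<lambda>n. sa_mult A (x n) (y n) | x y. x \<in> X \<and> y \<in> Y}),
     sa_star = (\<lambda>X. null_rel A `` {\<lambda>n. sa_star A (x n) | x. x \<in> X}),
     sa_norm = (\<lambda>X. THE r. \<forall>x\<in>X. (\<lambda>n. sa_norm A (x n)) \<longlonglongrightarrow> r)\<rparr>"

text \<open>The extension by continuity to the completion of \<open>A\<close> of a map from \<open>A\<close> to a complete \<open>B\<close>.\<close>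

definition completion_extend ::
    "'b star_alg \<Rightarrow> 'c star_alg \<Rightarrow> ('b \<Rightarrow> 'c) \<Rightarrow> (nat \<Rightarrow> 'b) set \<Rightarrow> 'c" where
  "completion_extend A B \<phi> X = (THE b. b \<in> sa_carrier B \<and>
     (\<forall>x\<in>X. (\<lambda>n. sa_dist B (\<phi> (x n)) b) \<longlonglongrightarrow> 0))"

definition op_alg :: "'b set \<Rightarrow> 'b op star_alg" where
  "op_alg A = \<lparr>
     sa_carrier = bounded_ops A,
     sa_add = (\<lambda>T T' \<xi> a. T \<xi> a + T' \<xi> a),
     sa_scale = (\<lambda>c T \<xi> a. c * T \<xi> a),
     sa_mult = (\<lambda>T T'. T \<circ> T'),
     sa_star = op_adjoint A,
     sa_norm = op_norm A\<rparr>"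


section \<open>Topological groupoids and their reduced C*-algebras\<close>

text \<open>Units are regarded as arrows, so \<open>gsrc\<close> and \<open>grng\<close> take values in arrows. The product
  \<open>gmul G g h\<close> is meaningful for \<open>gsrc G g = grng G h\<close>.\<close>

record 'g top_groupoid =
  gtop :: "'g topology"
  gsrc :: "'g \<Rightarrow> 'g"
  grng :: "'g \<Rightarrow> 'g"
  gmul :: "'g \<Rightarrow> 'g \<Rightarrow> 'g"
  ginv :: "'g \<Rightarrow> 'g"

abbreviation arrows :: "'g top_groupoid \<Rightarrow> 'g set" where
  "arrows G \<equiv> topspace (gtop G)"

definition gunits :: "'g top_groupoid \<Rightarrow> 'g set" where
  "gunits G = gsrc G ` arrows G"

definition src_fibre :: "'g top_groupoid \<Rightarrow> 'g \<Rightarrow> 'g set" where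
  "src_fibre G x = {g \<in> arrows G. gsrc G g = x}"

definition rng_fibre :: "'g top_groupoid \<Rightarrow> 'g \<Rightarrow> 'g set" where
  "rng_fibre G x = {g \<in> arrows G. grng G g = x}"

definition reduction :: "'g top_groupoid \<Rightarrow> 'g set \<Rightarrow> 'g top_groupoid" where
  "reduction G U = G\<lparr>gtop := subtopology (gtop G) {g. gsrc G g \<in> U}\<rparr>"

definition quotient_topology :: "'b topology \<Rightarrow> ('b \<times> 'b) set \<Rightarrow> 'b set topology" where
  "quotient_topology X R = topology (\<lambda>\<U>. \<U> \<subseteq> topspace X // R \<and>
     openin X {x \<in> topspace X. R `` {x} \<in> \<U>})"

lemma openin_quotient_topology:
  "openin (quotient_topology X R) \<U> \<longleftrightarrow>
     \<U> \<subseteq> topspace X // R \<and> openin X {x \<in> topspace X. R `` {x} \<in> \<U>}"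
proof -
  have "istopology (\<lambda>\<U>. \<U> \<subseteq> topspace X // R \<and> openin X {x \<in> topspace X. R `` {x} \<in> \<U>})"
    unfolding istopology_def
  proof (intro conjI allI impI)
    fix \<U> \<V>
    assume "\<U> \<subseteq> topspace X // R \<and> openin X {x \<in> topspace X. R `` {x} \<in> \<U>}"
      and "\<V> \<subseteq> topspace X // R \<and> openin X {x \<in> topspace X. R `` {x} \<in> \<V>}"
    then have "openin X ({x \<in> topspace X. R `` {x} \<in> \<U>} \<inter> {x \<in> topspace X. R `` {x} \<in> \<V>})"
      by blast
    moreover have "{x \<in> topspace X. R `` {x} \<in> \<U>} \<inter> {x \<in> topspace X. R `` {x} \<in> \<V>} =
        {x \<in> topspace X. R `` {x} \<in> \<U> \<inter> \<V>}" by auto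
    ultimately show "openin X {x \<in> topspace X. R `` {x} \<in> \<U> \<inter> \<V>}" by simp
  next
    fix \<K>
    assume K: "\<forall>\<U>\<in>\<K>. \<U> \<subseteq> topspace X // R \<and> openin X {x \<in> topspace X. R `` {x} \<in> \<U>}"
    have "{x \<in> topspace X. R `` {x} \<in> \<Union> \<K>} = (\<Union>\<U>\<in>\<K>. {x \<in> topspace X. R `` {x} \<in> \<U>})"
      by auto
    with K show "openin X {x \<in> topspace X. R `` {x} \<in> \<Union> \<K>}" by auto
  qed auto
  then show ?thesis unfolding quotient_topology_def by (simp add: topology_inverse')
qed

lemma topspace_quotient_topology: "topspace (quotient_topology X R) = topspace X // R"
proof -
  have "openin (quotient_topology X R) (topspace X // R)"
  proof -
    have "{x \<in> topspace X. R `` {x} \<in> topspace X // R} = topspace X"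
      by (auto simp: quotient_def)
    then show ?thesis by (simp add: openin_quotient_topology)
  qed
  then show ?thesis
    by (meson openin_quotient_topology openin_subset openin_topspace subset_antisym)
qed

lemma quotient_map_quotient_topology:
  "quotient_map X (quotient_topology X R) (\<lambda>x. R `` {x})"
  unfolding quotient_map_def topspace_quotient_topology openin_quotient_topology
  by (auto simp: quotient_def)

definition quotient_groupoid ::
    "'g top_groupoid \<Rightarrow> ('g \<times> 'g) set \<Rightarrow> 'g set top_groupoid" where
  "quotient_groupoid G R = \<lparr>
     gtop = quotient_topology (gtop G) R,
     gsrc = (\<lambda>C. R `` (gsrc G ` C)),
     grng = (\<lambda>C. R `` (grng G ` C)),
     gmul = (\<lambda>C D. R `` {gmul G c d | c d. c \<in> C \<and> d \<in> D \<and> gsrc G c = grng G d}),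
     ginv = (\<lambda>C. R `` (ginv G ` C))\<rparr>"

definition Cc_on :: "'g topology \<Rightarrow> 'g set \<Rightarrow> ('g \<Rightarrow> complex) set" where
  "Cc_on X V = {f. continuous_map (subtopology X V) euclidean f \<and>
     compactin (subtopology X V) (subtopology X V closure_of {g \<in> V. f g \<noteq> 0}) \<and>
     (\<forall>g. g \<notin> V \<longrightarrow> f g = 0)}"

inductive_set Cc :: "'g topology \<Rightarrow> ('g \<Rightarrow> complex) set" for X :: "'g topology" where
  base: "openin X V \<Longrightarrow> Hausdorff_space (subtopology X V) \<Longrightarrow> f \<in> Cc_on X V \<Longrightarrow> f \<in> Cc X"
| add: "f \<in> Cc X \<Longrightarrow> f' \<in> Cc X \<Longrightarrow> (\<lambda>g. f g + f' g) \<in> Cc X"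
| scale: "f \<in> Cc X \<Longrightarrow> (\<lambda>g. c * f g) \<in> Cc X"

definition convolution ::
    "'g top_groupoid \<Rightarrow> ('g \<Rightarrow> complex) \<Rightarrow> ('g \<Rightarrow> complex) \<Rightarrow> 'g \<Rightarrow> complex" where
  "convolution G f1 f2 g = (if g \<in> arrows G
     then \<Sum>\<^sub>\<infinity>h\<in>rng_fibre G (grng G g). f1 h * f2 (gmul G (ginv G h) g) else 0)"

definition gstar :: "'g top_groupoid \<Rightarrow> ('g \<Rightarrow> complex) \<Rightarrow> 'g \<Rightarrow> complex" where
  "gstar G f g = (if g \<in> arrows G then cnj (f (ginv G g)) else 0)"

definition regular_rep :: "'g top_groupoid \<Rightarrow> 'g \<Rightarrow> ('g \<Rightarrow> complex) \<Rightarrow> 'g op" where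
  "regular_rep G x f \<xi> g = (if \<xi> \<in> ell2 (src_fibre G x) \<and> g \<in> src_fibre G x
     then \<Sum>\<^sub>\<infinity>h\<in>rng_fibre G (grng G g). f h * \<xi> (gmul G (ginv G h) g) else 0)"

definition reduced_norm :: "'g top_groupoid \<Rightarrow> ('g \<Rightarrow> complex) \<Rightarrow> real" where
  "reduced_norm G f = (SUP x\<in>gunits G. op_norm (src_fibre G x) (regular_rep G x f))"

definition Cc_alg :: "'g top_groupoid \<Rightarrow> ('g \<Rightarrow> complex) star_alg" where
  "Cc_alg G = \<lparr>
     sa_carrier = Cc (gtop G),
     sa_add = (\<lambda>f f' g. f g + f' g),
     sa_scale = (\<lambda>c f g. c * f g),
     sa_mult = convolution G,
     sa_star = gstar G,
     sa_norm = reduced_norm G\<rparr>"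

definition reduced_cstar :: "'g top_groupoid \<Rightarrow> (nat \<Rightarrow> 'g \<Rightarrow> complex) set star_alg" where
  "reduced_cstar G = completion (Cc_alg G)"


section \<open>Left cancellative monoids\<close>

class left_cancellative_monoid = monoid_mult +
  assumes left_cancel: "s * t = s * u \<Longrightarrow> t = u"

text \<open>\<open>\<lambda>\<^sub>s\<close> sends \<open>\<xi> = \<Sum>\<^sub>u \<xi>(u)\<delta>\<^sub>u\<close> to \<open>\<Sum>\<^sub>u \<xi>(u)\<delta>\<^bsub>su\<^esub>\<close>; by left cancellation the sum below has at most
  one term.\<close>

definition lambda_op :: "'a::left_cancellative_monoid \<Rightarrow> 'a op" where
  "lambda_op s \<xi> t = (if \<xi> \<in> ell2 UNIV then \<Sum>u | s * u = t. \<xi> u else 0)"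

lemma delta_in_ell2: "b \<in> A \<Longrightarrow> delta b \<in> ell2 A"
proof -
  assume b: "b \<in> A"
  have "(\<lambda>a. (cmod (delta b a))\<^sup>2) summable_on A
      \<longleftrightarrow> (\<lambda>a. (cmod (delta b a))\<^sup>2) summable_on {b}"
    using b by (intro summable_on_cong_neutral) (auto simp: delta_def)
  then show ?thesis using b by (auto simp: ell2_def delta_def)
qed

lemma lambda_op_delta: "lambda_op s (delta t) = delta (s * t)"
proof
  fix r
  have l2: "delta t \<in> ell2 UNIV" by (simp add: delta_in_ell2)
  show "lambda_op s (delta t) r = delta (s * t) r"
  proof (cases "r = s * t")
    case True
    then have "{u. s * u = r} = {t}" using left_cancel by auto
    with l2 have "lambda_op s (delta t) r = delta t t" by (simp add: lambda_op_def)
    then show ?thesis using True by (simp add: delta_def)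
  next
    case False
    then have "(\<Sum>u | s * u = r. delta t u) = 0"
      by (intro sum.neutral) (auto simp: delta_def)
    with l2 have "lambda_op s (delta t) r = 0" by (simp add: lambda_op_def)
    then show ?thesis using False by (simp add: delta_def)
  qed
qed

definition reduced_monoid_cstar :: "'a::left_cancellative_monoid op star_alg" where
  "reduced_monoid_cstar = generated_cstar_subalgebra (op_alg UNIV) (range lambda_op)"

text \<open>Partial bijections of \<open>S\<close> are injective partial maps \<open>'a \<rightharpoonup> 'a\<close>; the product is \<open>\<circ>\<^sub>m\<close>.\<close>

definition pinverse :: "('a \<rightharpoonup> 'a) \<Rightarrow> ('a \<rightharpoonup> 'a)" where
  "pinverse g = (\<lambda>y. if y \<in> ran g then Some (THE x. g x = Some y) else None)"

definition pid :: "'a set \<Rightarrow> ('a \<rightharpoonup> 'a)" where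
  "pid X = Some |` X"

definition ltrans :: "'a::left_cancellative_monoid \<Rightarrow> ('a \<rightharpoonup> 'a)" where
  "ltrans s = (\<lambda>t. Some (s * t))"

inductive_set left_hull :: "('a::left_cancellative_monoid \<rightharpoonup> 'a) set" where
  ltrans: "ltrans s \<in> left_hull"
| inverse: "g \<in> left_hull \<Longrightarrow> pinverse g \<in> left_hull"
| comp: "g \<in> left_hull \<Longrightarrow> h \<in> left_hull \<Longrightarrow> g \<circ>\<^sub>m h \<in> left_hull"

definition idems :: "('a::left_cancellative_monoid \<rightharpoonup> 'a) set" where
  "idems = {p \<in> left_hull. p \<circ>\<^sub>m p = p}"

text \<open>The set in the second rule is \<open>s\<^sup>-\<^sup>1tX\<close>, so the rules produce exactly the sets
  \<open>s\<^sub>1\<^sup>-\<^sup>1t\<^sub>1\<dots>s\<^sub>n\<^sup>-\<^sup>1t\<^sub>nS\<close>.\<close>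

inductive_set constructible :: "'a::left_cancellative_monoid set set" where
  whole: "UNIV \<in> constructible"
| step: "X \<in> constructible \<Longrightarrow> {u. \<exists>x\<in>X. s * u = t * x} \<in> constructible"

text \<open>The case \<open>F = {}\<close> yields the constructible ideals themselves.\<close>

definition constructible_diffs :: "'a::left_cancellative_monoid set set" where
  "constructible_diffs =
     {X - \<Union>F | X F. X \<in> constructible \<and> finite F \<and> F \<subseteq> constructible}"

text \<open>The (finitely many) indices \<open>k\<close> and \<open>j\<close> in the usual formulation are replaced by finite sets
  of partial bijections and of subsets.\<close>

definition cstar_regular :: "'a::left_cancellative_monoid itself \<Rightarrow> bool" where
  "cstar_regular _ \<longleftrightarrow>
     (\<forall>H \<subseteq> left_hull :: ('a \<rightharpoonup> 'a) set. \<forall>X \<in> constructible_diffs.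
        finite H \<and> X \<noteq> {} \<and> X \<subseteq> (\<Union>h\<in>H. {s. h s = Some s}) \<longrightarrow>
        (\<exists>\<Y>. finite \<Y> \<and> \<Y> \<subseteq> constructible_diffs \<and> X \<subseteq> \<Union>\<Y> \<and>
             (\<forall>Y\<in>\<Y>. \<exists>h\<in>H. \<forall>y\<in>Y. h y = Some y)))"


section \<open>The groupoid of a left cancellative monoid\<close>

text \<open>A semi-character takes values in \<open>{0,1}\<close>, represented by \<open>bool\<close> with conjunction as product
  and the discrete topology, and is extended by \<open>False\<close> off the semigroup of idempotents. The topology
  of pointwise convergence is then the product topology on the function type. Semi-characters are
  called \<open>\<omega>\<close> because the library reserves the letter chi as a binder.\<close>

type_synonym 'a semichar = "('a \<rightharpoonup> 'a) \<Rightarrow> bool"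

definition semichars :: "'a::left_cancellative_monoid semichar set" where
  "semichars = {\<omega>. (\<forall>p. p \<notin> idems \<longrightarrow> \<not> \<omega> p) \<and> (\<exists>p\<in>idems. \<omega> p) \<and>
     (\<forall>p\<in>idems. \<forall>q\<in>idems. \<omega> (p \<circ>\<^sub>m q) = (\<omega> p \<and> \<omega> q))}"

definition semichar_topology :: "'a::left_cancellative_monoid semichar topology" where
  "semichar_topology = subtopology euclidean semichars"

definition point_char :: "'a::left_cancellative_monoid \<Rightarrow> 'a semichar" where
  "point_char s = (\<lambda>p. \<exists>X\<in>constructible. p = pid X \<and> s \<in> X)"

definition Omega :: "'a::left_cancellative_monoid semichar set" where
  "Omega = semichar_topology closure_of range point_char"

definition conj_char ::
    "('a::left_cancellative_monoid \<rightharpoonup> 'a) \<Rightarrow> 'a semichar \<Rightarrow> 'a semichar" where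
  "conj_char g \<omega> = (\<lambda>p. p \<in> idems \<and> \<omega> (pinverse g \<circ>\<^sub>m p \<circ>\<^sub>m g))"

type_synonym 'a germ = "(('a \<rightharpoonup> 'a) \<times> 'a semichar) set"

definition germ_pairs :: "(('a::left_cancellative_monoid \<rightharpoonup> 'a) \<times> 'a semichar) set" where
  "germ_pairs = {(g, \<omega>). g \<in> left_hull \<and> \<omega> \<in> semichars \<and> \<omega> (pinverse g \<circ>\<^sub>m g)}"

definition germ_rel ::
    "((('a::left_cancellative_monoid \<rightharpoonup> 'a) \<times> 'a semichar) \<times> (('a \<rightharpoonup> 'a) \<times> 'a semichar)) set" where
  "germ_rel = {((g1, \<omega>1), (g2, \<omega>2)). (g1, \<omega>1) \<in> germ_pairs \<and> (g2, \<omega>2) \<in> germ_pairs \<and>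
     \<omega>1 = \<omega>2 \<and> (\<exists>p\<in>idems. \<omega>1 p \<and> g1 \<circ>\<^sub>m p = g2 \<circ>\<^sub>m p)}"

definition germ ::
    "('a::left_cancellative_monoid \<rightharpoonup> 'a) \<Rightarrow> 'a semichar \<Rightarrow> 'a germ" where
  "germ g \<omega> = germ_rel `` {(g, \<omega>)}"

definition germ_basic ::
    "('a::left_cancellative_monoid \<rightharpoonup> 'a) \<Rightarrow> 'a semichar set \<Rightarrow> 'a germ set" where
  "germ_basic g U = {germ g \<omega> | \<omega>. \<omega> \<in> U}"

definition Paterson :: "'a::left_cancellative_monoid germ top_groupoid" where
  "Paterson = \<lparr>
     gtop = topology_generated_by {germ_basic g U | g U. g \<in> left_hull \<and>
              openin semichar_topology U \<and> U \<subseteq> {\<omega>. \<omega> (pinverse g \<circ>\<^sub>m g)}},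
     gsrc = (\<lambda>\<gamma>. germ_rel `` {(pid UNIV, \<omega>) | g \<omega>. (g, \<omega>) \<in> \<gamma>}),
     grng = (\<lambda>\<gamma>. germ_rel `` {(pid UNIV, conj_char g \<omega>) | g \<omega>. (g, \<omega>) \<in> \<gamma>}),
     gmul = (\<lambda>\<gamma> \<delta>. germ_rel `` {(g \<circ>\<^sub>m h, \<psi>) | g \<omega> h \<psi>.
              (g, \<omega>) \<in> \<gamma> \<and> (h, \<psi>) \<in> \<delta> \<and> \<omega> = conj_char h \<psi>}),
     ginv = (\<lambda>\<gamma>. germ_rel `` {(pinverse g, conj_char g \<omega>) | g \<omega>. (g, \<omega>) \<in> \<gamma>})\<rparr>"

definition GP :: "'a::left_cancellative_monoid germ top_groupoid" where
  "GP = reduction Paterson (germ (pid UNIV) ` Omega)"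

text \<open>The value at \<open>Y\<close> of the extension of \<open>\<omega>\<close> from the constructible ideals. For \<open>\<omega>\<close> in \<open>Omega\<close> it does
  not depend on the choice of \<open>X\<close> and \<open>F\<close>.\<close>

definition char_ext :: "'a::left_cancellative_monoid semichar \<Rightarrow> 'a set \<Rightarrow> bool" where
  "char_ext \<omega> Y \<longleftrightarrow> (\<exists>X F. X \<in> constructible \<and> finite F \<and> F \<subseteq> constructible \<and>
     Y = X - \<Union>F \<and> \<omega> (pid X) \<and> (\<forall>Z\<in>F. \<not> \<omega> (pid Z)))"

definition GP_rel :: "('a::left_cancellative_monoid germ \<times> 'a germ) set" where
  "GP_rel = {(\<gamma>, \<delta>). \<gamma> \<in> arrows GP \<and> \<delta> \<in> arrows GP \<and>
     (\<exists>g h \<omega>. \<gamma> = germ g \<omega> \<and> \<delta> = germ h \<omega> \<and>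
        (\<exists>X\<in>constructible_diffs. char_ext \<omega> X \<and> g |` X = h |` X))}"

definition GS :: "'a::left_cancellative_monoid germ set top_groupoid" where
  "GS = quotient_groupoid GP GP_rel"

definition GS_class ::
    "('a::left_cancellative_monoid \<rightharpoonup> 'a) \<Rightarrow> 'a semichar \<Rightarrow> 'a germ set" where
  "GS_class g \<omega> = GP_rel `` {germ g \<omega>}"

definition chi_e_unit :: "'a::left_cancellative_monoid germ set" where
  "chi_e_unit = GS_class (pid UNIV) (point_char 1)"

text \<open>The representation \<open>\<rho>\<close> at \<open>\<chi>\<^sub>e\<close>, carried from the source fibre at \<open>\<chi>\<^sub>e\<close> over to \<open>S\<close> along the
  bijection \<open>s \<mapsto> [s, \<chi>\<^sub>e]\<close>.\<close>

definition fibre_map :: "'a::left_cancellative_monoid \<Rightarrow> 'a germ set" where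
  "fibre_map s = GS_class (ltrans s) (point_char 1)"

definition rho_chi_e ::
    "('a::left_cancellative_monoid germ set \<Rightarrow> complex) \<Rightarrow> 'a op" where
  "rho_chi_e f \<xi> s = regular_rep GS chi_e_unit f
     (\<lambda>\<gamma>. if \<gamma> \<in> src_fibre GS chi_e_unit then \<xi> (the_inv fibre_map \<gamma>) else 0) (fibre_map s)"

definition rho_chi_e_ext ::
    "(nat \<Rightarrow> 'a::left_cancellative_monoid germ set \<Rightarrow> complex) set \<Rightarrow> 'a op" where
  "rho_chi_e_ext = completion_extend (Cc_alg GS) (op_alg UNIV) rho_chi_e"

end

theory Submission
  imports Defs
begin

text \<open>
  Every \<open>f \<in> C\<^sub>c(\<G>(S))\<close> is a finite sum of functions \<open>[g, \<chi>] \<mapsto> \<phi>(\<chi>)\<close> carried by a single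
  \<open>g \<in> I\<^sub>l(S)\<close>, so on each source fibre it acts by a matrix with boundedly many non-zero entries per row and
  column. Let \<open>[k\<^sub>1, \<chi>], ..., [k\<^sub>m, \<chi>]\<close> be distinct arrows in the fibre of \<open>\<chi> \<in> \<Omega>(S)\<close>. C*-regularity yields
  points \<open>s \<in> S\<close> with \<open>\<chi>\<^sub>s\<close> arbitrarily close to \<open>\<chi>\<close> which are not fixed by any of the finitely many elements
  \<open>k\<^sub>i\<^sup>-\<^sup>1 k\<^sub>j\<close> and \<open>k\<^sub>i\<^sup>-\<^sup>1 g k\<^sub>j\<close>, with \<open>g\<close> occurring in \<open>f\<close>, that have non-trivial class at \<open>\<chi>\<close>. For such \<open>s\<close> the
  \<open>k\<^sub>i(s)\<close> are distinct and the finite submatrix of \<open>\<rho>\<^sub>\<chi>(f)\<close> at these arrows is close to the submatrix of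
  \<open>\<rho>(f)\<close> at the points \<open>k\<^sub>i(s)\<close>, where \<open>\<rho>\<close> is the representation at \<open>\<chi>\<^sub>e\<close>. Hence
  \<open>\<parallel>\<rho>\<^sub>\<chi>(f)\<parallel> \<le> \<parallel>\<rho>(f)\<parallel>\<close>, so \<open>\<rho>\<close> is isometric on \<open>C\<^sub>c(\<G>(S))\<close>. Its image contains the \<open>\<lambda>\<^sub>s\<close>, and
  it lies in the algebra they generate because a continuous \<open>\<phi>\<close> is a uniform limit of linear combinations of
  products of the characteristic functions of the sets \<open>{\<chi>. \<chi>(p\<^sub>X) = 1}\<close>.
\<close>

section \<open>Square-summable functions and bounded operators\<close>

text \<open>The obstacle is that \<G>(S) need not be Hausdorff. Elements of its convolution algebra
  need not be continuous, and a matrix coefficient that vanishes at \<open>\<omega>\<close> can be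
  non-zero at characters of points s as close to \<open>\<omega>\<close> as one likes: this happens
  when some k_i^{-1} g k_j fixes such s without being trivial at \<open>\<omega>\<close>. Density of
  the point characters in \<open>Omega\<close> therefore gives no comparison of norms by itself. If
  every s near \<open>\<omega>\<close> were fixed by one of finitely many such elements, their fixed
  point sets would cover a set of the filter at \<open>\<omega>\<close>. Fixed point sets need not
  belong to the family on which characters are defined, so \<open>\<omega>\<close> cannot select one
  of them. C*-regularity refines the cover to sets among which it can, and the element so selected
  would be trivial at \<open>\<omega>\<close>, a contradiction. One fibre suffices as target of all
  comparisons, since right multiplication by [s, \<chi>_e] carries the fibre at the character of s
  into the fibre at \<chi>_e, sending k to k(s). No structure theory of C*-algebras enters: once
  \<rho> is isometric, the completion is identified with the set of limits of the image.\<close>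

lemma ell2_off: "\<xi> \<in> ell2 A \<Longrightarrow> a \<notin> A \<Longrightarrow> \<xi> a = 0"
  by (simp add: ell2_def)

lemma ell2_summable: "\<xi> \<in> ell2 A \<Longrightarrow> (\<lambda>a. (cmod (\<xi> a))\<^sup>2) summable_on A"
  by (simp add: ell2_def)

lemma ell2_norm_nonneg [simp]: "0 \<le> ell2_norm A \<xi>"
  by (simp add: ell2_norm_def infsum_nonneg)

lemma L2_set_le_ell2_norm:
  assumes "\<xi> \<in> ell2 A" "finite F" "F \<subseteq> A"
  shows "L2_set (\<lambda>a. cmod (\<xi> a)) F \<le> ell2_norm A \<xi>"
  unfolding L2_set_def ell2_norm_def real_sqrt_le_iff
  by (rule finite_sum_le_infsum[OF ell2_summable]) (use assms in auto)

lemma ell2I: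
  assumes "\<And>a. a \<notin> A \<Longrightarrow> \<xi> a = 0"
    and "\<And>F. finite F \<Longrightarrow> F \<subseteq> A \<Longrightarrow> L2_set (\<lambda>a. cmod (\<xi> a)) F \<le> c"
  shows "\<xi> \<in> ell2 A" "ell2_norm A \<xi> \<le> c"
proof -
  have c0: "0 \<le> c" using assms(2)[of "{}"] by simp
  have le: "(\<Sum>a\<in>F. (cmod (\<xi> a))\<^sup>2) \<le> c\<^sup>2" if "finite F" "F \<subseteq> A" for F
    using assms(2)[OF that] c0 unfolding L2_set_def
    by (metis real_sqrt_le_iff real_sqrt_unique)
  have s: "(\<lambda>a. (cmod (\<xi> a))\<^sup>2) summable_on A"
    by (rule nonneg_bdd_above_summable_on) (auto intro!: bdd_aboveI[where M = "c\<^sup>2"] le)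
  then show "\<xi> \<in> ell2 A" using assms(1) by (simp add: ell2_def)
  have "(\<Sum>\<^sub>\<infinity>a\<in>A. (cmod (\<xi> a))\<^sup>2) \<le> c\<^sup>2" by (rule infsum_le_finite_sums[OF s le])
  then show "ell2_norm A \<xi> \<le> c" unfolding ell2_norm_def using c0 real_le_lsqrt by (simp add: real_le_lsqrt)
qed

lemma ell2_norm_point: "\<xi> \<in> ell2 A \<Longrightarrow> cmod (\<xi> a) \<le> ell2_norm A \<xi>"
  using L2_set_le_ell2_norm[of \<xi> A "{a}"] ell2_off[of \<xi> A a] by (cases "a \<in> A") (auto simp: L2_set_def)

lemma ell2_norm_eq_0: "\<xi> \<in> ell2 A \<Longrightarrow> ell2_norm A \<xi> = 0 \<Longrightarrow> \<xi> = (\<lambda>a. 0)"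
  using ell2_norm_point[of \<xi> A] by fastforce

lemma ell2_zero [simp]: "(\<lambda>a. 0) \<in> ell2 A"
  and ell2_norm_zero [simp]: "ell2_norm A (\<lambda>a. 0) = 0"
  by (auto simp: ell2_def ell2_norm_def)

lemma ell2_add:
  assumes "\<xi> \<in> ell2 A" "\<eta> \<in> ell2 A"
  shows "(\<lambda>a. \<xi> a + \<eta> a) \<in> ell2 A"
    and "ell2_norm A (\<lambda>a. \<xi> a + \<eta> a) \<le> ell2_norm A \<xi> + ell2_norm A \<eta>"
proof -
  have *: "L2_set (\<lambda>a. cmod (\<xi> a + \<eta> a)) F \<le> ell2_norm A \<xi> + ell2_norm A \<eta>"
    if "finite F" "F \<subseteq> A" for F
  proof -
    have "L2_set (\<lambda>a. cmod (\<xi> a + \<eta> a)) F \<le> L2_set (\<lambda>a. cmod (\<xi> a) + cmod (\<eta> a)) F"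
      by (rule L2_set_mono) (auto intro: norm_triangle_ineq)
    also have "\<dots> \<le> L2_set (\<lambda>a. cmod (\<xi> a)) F + L2_set (\<lambda>a. cmod (\<eta> a)) F"
      by (rule L2_set_triangle_ineq)
    also have "\<dots> \<le> ell2_norm A \<xi> + ell2_norm A \<eta>"
      by (intro add_mono L2_set_le_ell2_norm assms that)
    finally show ?thesis .
  qed
  show "(\<lambda>a. \<xi> a + \<eta> a) \<in> ell2 A"
    by (rule ell2I(1)[OF _ *]) (use assms in \<open>auto simp: ell2_off\<close>)
  show "ell2_norm A (\<lambda>a. \<xi> a + \<eta> a) \<le> ell2_norm A \<xi> + ell2_norm A \<eta>"
    by (rule ell2I(2)[OF _ *]) (use assms in \<open>auto simp: ell2_off\<close>)
qed

lemma ell2_scale: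
  assumes "\<xi> \<in> ell2 A"
  shows "(\<lambda>a. c * \<xi> a) \<in> ell2 A"
    and "ell2_norm A (\<lambda>a. c * \<xi> a) = cmod c * ell2_norm A \<xi>"
proof -
  show "(\<lambda>a. c * \<xi> a) \<in> ell2 A"
    using assms by (auto simp: ell2_def norm_mult power_mult_distrib intro: summable_on_cmult_right)
  show "ell2_norm A (\<lambda>a. c * \<xi> a) = cmod c * ell2_norm A \<xi>"
    by (simp add: ell2_norm_def norm_mult power_mult_distrib infsum_cmult_right' real_sqrt_mult)
qed

section \<open>Bounded operators and the operator norm\<close>

lemma bounded_opsD:
  assumes "T \<in> bounded_ops A"
  shows "\<xi> \<in> ell2 A \<Longrightarrow> T \<xi> \<in> ell2 A"
    and "\<xi> \<notin> ell2 A \<Longrightarrow> T \<xi> = (\<lambda>a. 0)"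
    and "\<xi> \<in> ell2 A \<Longrightarrow> \<eta> \<in> ell2 A \<Longrightarrow> T (\<lambda>a. \<xi> a + \<eta> a) = (\<lambda>a. T \<xi> a + T \<eta> a)"
    and "\<xi> \<in> ell2 A \<Longrightarrow> T (\<lambda>a. c * \<xi> a) = (\<lambda>a. c * T \<xi> a)"
  using assms by (auto simp: bounded_ops_def)

lemma bounded_ops_in: "T \<in> bounded_ops A \<Longrightarrow> T \<xi> \<in> ell2 A"
  by (cases "\<xi> \<in> ell2 A") (auto simp: bounded_opsD)

lemma bounded_op_zero_vec: "T \<in> bounded_ops A \<Longrightarrow> T (\<lambda>a. 0) = (\<lambda>a. 0)"
  using bounded_opsD(4)[of T A "\<lambda>a. 0" 0] by simp

lemma bounded_ops_bdd:
  assumes "T \<in> bounded_ops A"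
  shows "bdd_above ((\<lambda>\<xi>. ell2_norm A (T \<xi>)) ` {\<xi>\<in>ell2 A. ell2_norm A \<xi> \<le> 1})"
proof -
  obtain C where C: "\<And>\<xi>. \<xi> \<in> ell2 A \<Longrightarrow> ell2_norm A (T \<xi>) \<le> C * ell2_norm A \<xi>"
    using assms unfolding bounded_ops_def by blast
  have "ell2_norm A (T \<xi>) \<le> \<bar>C\<bar>" if "\<xi> \<in> ell2 A" "ell2_norm A \<xi> \<le> 1" for \<xi>
  proof -
    have "C * ell2_norm A \<xi> \<le> \<bar>C\<bar> * 1" by (rule mult_mono) (use that in auto)
    with C[OF that(1)] show ?thesis by simp
  qed
  then show ?thesis by (auto intro!: bdd_aboveI[where M = "\<bar>C\<bar>"])
qed

lemma op_norm_nonneg: "T \<in> bounded_ops A \<Longrightarrow> 0 \<le> op_norm A T"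
  unfolding op_norm_def
  by (rule cSUP_upper2[where x = "\<lambda>a. 0"]) (auto intro: bounded_ops_bdd)

lemma op_norm_bound:
  assumes T: "T \<in> bounded_ops A" and "\<xi> \<in> ell2 A"
  shows "ell2_norm A (T \<xi>) \<le> op_norm A T * ell2_norm A \<xi>"
proof (cases "ell2_norm A \<xi> = 0")
  case True
  then have "\<xi> = (\<lambda>a. 0)" using assms ell2_norm_eq_0 by blast
  then show ?thesis using T bounded_op_zero_vec by fastforce
next
  case False
  define r where "r = ell2_norm A \<xi>"
  have r: "r > 0" using False by (simp add: r_def order_less_le)
  let ?\<eta> = "\<lambda>a. complex_of_real (1/r) * \<xi> a"
  have \<eta>: "?\<eta> \<in> ell2 A" "ell2_norm A ?\<eta> \<le> 1"
    using ell2_scale[OF assms(2), of "complex_of_real (1/r)"] r by (auto simp: r_def norm_divide)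
  have "ell2_norm A (T ?\<eta>) \<le> op_norm A T"
    unfolding op_norm_def by (rule cSUP_upper[OF _ bounded_ops_bdd[OF T]]) (use \<eta> in auto)
  moreover have "ell2_norm A (T ?\<eta>) = (1/r) * ell2_norm A (T \<xi>)"
    using ell2_scale(2)[of "T \<xi>" A "complex_of_real (1/r)"] bounded_opsD(4)[OF T assms(2)]
      bounded_ops_in[OF T] r by (simp del: of_real_divide add: norm_divide)
  ultimately have "(1/r) * ell2_norm A (T \<xi>) \<le> op_norm A T" by simp
  then show ?thesis using r by (simp add: field_simps flip: r_def)
qed

lemma op_norm_le:
  assumes "0 \<le> C" "\<And>\<xi>. \<xi> \<in> ell2 A \<Longrightarrow> ell2_norm A (T \<xi>) \<le> C * ell2_norm A \<xi>"
  shows "op_norm A T \<le> C"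
  unfolding op_norm_def
proof (rule cSUP_least)
  fix \<xi> assume \<xi>: "\<xi> \<in> {\<xi> \<in> ell2 A. ell2_norm A \<xi> \<le> 1}"
  then have "C * ell2_norm A \<xi> \<le> C * 1" using assms(1) by (intro mult_left_mono) auto
  with \<xi> assms(2)[of \<xi>] show "ell2_norm A (T \<xi>) \<le> C" by simp
qed (auto intro!: exI[of _ "\<lambda>a. 0"])

lemma bounded_ops_add:
  assumes T: "T \<in> bounded_ops A" and U: "U \<in> bounded_ops A"
  shows "(\<lambda>\<xi> a. T \<xi> a + U \<xi> a) \<in> bounded_ops A"
    and "op_norm A (\<lambda>\<xi> a. T \<xi> a + U \<xi> a) \<le> op_norm A T + op_norm A U"
proof -
  have b: "ell2_norm A (\<lambda>a. T \<xi> a + U \<xi> a) \<le> (op_norm A T + op_norm A U) * ell2_norm A \<xi>"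
    if "\<xi> \<in> ell2 A" for \<xi>
    using ell2_add(2)[OF bounded_ops_in[OF T] bounded_ops_in[OF U], of \<xi> \<xi>]
      op_norm_bound[OF T that] op_norm_bound[OF U that] by (simp add: algebra_simps)
  then show "op_norm A (\<lambda>\<xi> a. T \<xi> a + U \<xi> a) \<le> op_norm A T + op_norm A U"
    by (intro op_norm_le) (auto simp: op_norm_nonneg T U)
  show "(\<lambda>\<xi> a. T \<xi> a + U \<xi> a) \<in> bounded_ops A"
    unfolding bounded_ops_def
  proof (intro CollectI conjI ballI allI impI)
    show "\<exists>C. \<forall>\<xi>\<in>ell2 A. ell2_norm A (\<lambda>a. T \<xi> a + U \<xi> a) \<le> C * ell2_norm A \<xi>" using b by blast
  qed (auto simp: ell2_add bounded_ops_in[OF T] bounded_ops_in[OF U] bounded_opsD[OF T]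
      bounded_opsD[OF U] algebra_simps)
qed

lemma bounded_ops_scale:
  assumes T: "T \<in> bounded_ops A"
  shows "(\<lambda>\<xi> a. c * T \<xi> a) \<in> bounded_ops A"
    and "op_norm A (\<lambda>\<xi> a. c * T \<xi> a) \<le> cmod c * op_norm A T"
proof -
  have b: "ell2_norm A (\<lambda>a. c * T \<xi> a) \<le> (cmod c * op_norm A T) * ell2_norm A \<xi>"
    if "\<xi> \<in> ell2 A" for \<xi>
    using ell2_scale(2)[OF bounded_ops_in[OF T], of c \<xi>] op_norm_bound[OF T that]
    by (simp add: mult_left_mono mult.assoc)
  then show "op_norm A (\<lambda>\<xi> a. c * T \<xi> a) \<le> cmod c * op_norm A T"
    by (intro op_norm_le) (auto simp: op_norm_nonneg T)
  show "(\<lambda>\<xi> a. c * T \<xi> a) \<in> bounded_ops A"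
    unfolding bounded_ops_def
  proof (intro CollectI conjI ballI allI impI)
    show "\<exists>C. \<forall>\<xi>\<in>ell2 A. ell2_norm A (\<lambda>a. c * T \<xi> a) \<le> C * ell2_norm A \<xi>" using b by blast
  qed (auto simp: ell2_scale bounded_ops_in[OF T] bounded_opsD[OF T] algebra_simps)
qed

lemma bounded_ops_comp:
  assumes T: "T \<in> bounded_ops A" and U: "U \<in> bounded_ops A"
  shows "T \<circ> U \<in> bounded_ops A"
    and "op_norm A (T \<circ> U) \<le> op_norm A T * op_norm A U"
proof -
  have b: "ell2_norm A ((T \<circ> U) \<xi>) \<le> (op_norm A T * op_norm A U) * ell2_norm A \<xi>"
    if "\<xi> \<in> ell2 A" for \<xi>
  proof -
    have "ell2_norm A (T (U \<xi>)) \<le> op_norm A T * ell2_norm A (U \<xi>)"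
      by (rule op_norm_bound[OF T bounded_ops_in[OF U]])
    also have "\<dots> \<le> op_norm A T * (op_norm A U * ell2_norm A \<xi>)"
      by (rule mult_left_mono[OF op_norm_bound[OF U that] op_norm_nonneg[OF T]])
    finally show ?thesis by simp
  qed
  then show "op_norm A (T \<circ> U) \<le> op_norm A T * op_norm A U"
    by (intro op_norm_le) (auto simp: op_norm_nonneg T U)
  show "T \<circ> U \<in> bounded_ops A"
    unfolding bounded_ops_def
  proof (intro CollectI conjI ballI allI impI)
    show "\<exists>C. \<forall>\<xi>\<in>ell2 A. ell2_norm A ((T \<circ> U) \<xi>) \<le> C * ell2_norm A \<xi>" using b by blast
  qed (auto simp: bounded_ops_in[OF T] bounded_ops_in[OF U] bounded_opsD(2-4)[OF T]
      bounded_opsD(2-4)[OF U] bounded_op_zero_vec[OF T])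
qed

subsection \<open>The operator metric\<close>

abbreviation op_dist :: "'b set \<Rightarrow> 'b op \<Rightarrow> 'b op \<Rightarrow> real" where
  "op_dist A \<equiv> sa_dist (op_alg A)"

lemma op_dist_eq: "op_dist A T U = op_norm A (\<lambda>\<xi> a. T \<xi> a + (-1) * U \<xi> a)"
  by (simp add: sa_dist_def op_alg_def)

lemma bounded_ops_diff:
  assumes "T \<in> bounded_ops A" "U \<in> bounded_ops A"
  shows "(\<lambda>\<xi> a. T \<xi> a + (-1) * U \<xi> a) \<in> bounded_ops A"
  using bounded_ops_add(1)[OF assms(1) bounded_ops_scale(1)[OF assms(2), of "-1"]] by simp

lemma op_dist_nonneg: "T \<in> bounded_ops A \<Longrightarrow> U \<in> bounded_ops A \<Longrightarrow> 0 \<le> op_dist A T U"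
  unfolding op_dist_eq by (intro op_norm_nonneg bounded_ops_diff)

lemma op_dist_bound:
  assumes "T \<in> bounded_ops A" "U \<in> bounded_ops A" "\<xi> \<in> ell2 A"
  shows "ell2_norm A (\<lambda>a. T \<xi> a + (-1) * U \<xi> a) \<le> op_dist A T U * ell2_norm A \<xi>"
  unfolding op_dist_eq using op_norm_bound[OF bounded_ops_diff[OF assms(1,2)] assms(3)] .

lemma op_dist_eq_0:
  assumes T: "T \<in> bounded_ops A" and U: "U \<in> bounded_ops A" and "op_dist A T U \<le> 0"
  shows "T = U"
proof
  fix \<xi>
  show "T \<xi> = U \<xi>"
  proof (cases "\<xi> \<in> ell2 A")
    case True
    have "(\<lambda>a. T \<xi> a + (-1) * U \<xi> a) \<in> ell2 A" by (rule bounded_ops_in[OF bounded_ops_diff[OF T U]])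
    moreover have "ell2_norm A (\<lambda>a. T \<xi> a + (-1) * U \<xi> a) = 0"
      using op_dist_bound[OF T U True] assms(3) mult_right_mono[OF assms(3), of "ell2_norm A \<xi>"]
      by (simp add: order_antisym)
    ultimately have "(\<lambda>a. T \<xi> a + (-1) * U \<xi> a) = (\<lambda>a. 0)" by (rule ell2_norm_eq_0)
    then show ?thesis by (auto simp: fun_eq_iff)
  qed (simp add: bounded_opsD(2)[OF T] bounded_opsD(2)[OF U])
qed

lemma op_dist_commute:
  assumes "T \<in> bounded_ops A" "U \<in> bounded_ops A"
  shows "op_dist A T U = op_dist A U T"
proof -
  have *: "op_dist A T U \<le> op_dist A U T" if "T \<in> bounded_ops A" "U \<in> bounded_ops A" for T U
    using bounded_ops_scale(2)[OF bounded_ops_diff[OF that(2,1)], of "-1"]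
    by (simp add: op_dist_eq algebra_simps)
  show ?thesis using *[OF assms] *[OF assms(2,1)] by simp
qed

lemma op_dist_triangle:
  assumes "T \<in> bounded_ops A" "U \<in> bounded_ops A" "W \<in> bounded_ops A"
  shows "op_dist A T W \<le> op_dist A T U + op_dist A U W"
  using bounded_ops_add(2)[OF bounded_ops_diff[OF assms(1,2)] bounded_ops_diff[OF assms(2,3)]]
  by (simp add: op_dist_eq)

lemma op_dist_add:
  assumes "T \<in> bounded_ops A" "U \<in> bounded_ops A" "T' \<in> bounded_ops A" "U' \<in> bounded_ops A"
  shows "op_dist A (\<lambda>\<xi> a. T \<xi> a + U \<xi> a) (\<lambda>\<xi> a. T' \<xi> a + U' \<xi> a) \<le> op_dist A T T' + op_dist A U U'"
proof -
  have "(\<lambda>\<xi> a. (T \<xi> a + (-1) * T' \<xi> a) + (U \<xi> a + (-1) * U' \<xi> a)) =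
        (\<lambda>\<xi> a. T \<xi> a + U \<xi> a + (-1) * (T' \<xi> a + U' \<xi> a))"
    by (simp add: fun_eq_iff)
  then show ?thesis
    using bounded_ops_add(2)[OF bounded_ops_diff[OF assms(1,3)] bounded_ops_diff[OF assms(2,4)]]
    by (simp add: op_dist_eq)
qed

lemma op_dist_scale:
  assumes "T \<in> bounded_ops A" "T' \<in> bounded_ops A"
  shows "op_dist A (\<lambda>\<xi> a. c * T \<xi> a) (\<lambda>\<xi> a. c * T' \<xi> a) \<le> cmod c * op_dist A T T'"
proof -
  have "(\<lambda>\<xi> a. c * (T \<xi> a + (-1) * T' \<xi> a)) = (\<lambda>\<xi> a. c * T \<xi> a + (-1) * (c * T' \<xi> a))"
    by (simp add: fun_eq_iff algebra_simps)
  then show ?thesis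
    using bounded_ops_scale(2)[OF bounded_ops_diff[OF assms], of c] by (simp add: op_dist_eq)
qed

text \<open>The reason is TU - T'U' = T(U - U') + (T - T')U'. For a convergent sequence in the place
  of \<open>T\<close>, the varying factor \<open>op_norm A T\<close> is controlled by
  \<open>op_norm_le_dist\<close>.\<close>

lemma op_dist_comp:
  assumes "T \<in> bounded_ops A" "U \<in> bounded_ops A" "T' \<in> bounded_ops A" "U' \<in> bounded_ops A"
  shows "op_dist A (T \<circ> U) (T' \<circ> U') \<le> op_norm A T * op_dist A U U' + op_dist A T T' * op_norm A U'"
proof -
  let ?D = "\<lambda>\<xi> a. U \<xi> a + (-1) * U' \<xi> a" and ?E = "\<lambda>\<xi> a. T \<xi> a + (-1) * T' \<xi> a"
  have D: "?D \<in> bounded_ops A" and E: "?E \<in> bounded_ops A"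
    by (intro bounded_ops_diff assms)+
  have "T (?D \<xi>) = (\<lambda>a. T (U \<xi>) a + (-1) * T (U' \<xi>) a)" for \<xi>
    using bounded_opsD(3)[OF assms(1) bounded_ops_in[OF assms(2)] ell2_scale(1)[OF bounded_ops_in[OF assms(4)], of "-1"]]
      bounded_opsD(4)[OF assms(1) bounded_ops_in[OF assms(4)], of "-1"] by simp
  then have "(\<lambda>\<xi> a. (T \<circ> ?D) \<xi> a + (?E \<circ> U') \<xi> a) = (\<lambda>\<xi> a. (T \<circ> U) \<xi> a + (-1) * (T' \<circ> U') \<xi> a)"
    by (simp add: fun_eq_iff)
  then have "op_dist A (T \<circ> U) (T' \<circ> U') \<le> op_norm A (T \<circ> ?D) + op_norm A (?E \<circ> U')"
    using bounded_ops_add(2)[OF bounded_ops_comp(1)[OF assms(1) D] bounded_ops_comp(1)[OF E assms(4)]]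
    by (simp add: op_dist_eq)
  then show ?thesis
    using bounded_ops_comp(2)[OF assms(1) D] bounded_ops_comp(2)[OF E assms(4)]
    by (simp add: op_dist_eq)
qed

lemma op_norm_le_dist:
  assumes "T \<in> bounded_ops A" "U \<in> bounded_ops A"
  shows "op_norm A T \<le> op_norm A U + op_dist A T U"
  using bounded_ops_add(2)[OF assms(2) bounded_ops_diff[OF assms]] by (simp add: op_dist_eq)

text \<open>\<open>op_norm\<close> is a supremum that means something only for bounded operators, so
  boundedness of the terms and of the limit is made part of convergence.\<close>

definition op_lim :: "'b set \<Rightarrow> (nat \<Rightarrow> 'b op) \<Rightarrow> 'b op \<Rightarrow> bool" where
  "op_lim A T L \<longleftrightarrow> (\<forall>n. T n \<in> bounded_ops A) \<and> L \<in> bounded_ops A \<and> (\<lambda>n. op_dist A (T n) L) \<longlonglongrightarrow> 0"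

lemma op_limD:
  assumes "op_lim A T L"
  shows "T n \<in> bounded_ops A" "L \<in> bounded_ops A" "(\<lambda>n. op_dist A (T n) L) \<longlonglongrightarrow> 0"
  using assms by (auto simp: op_lim_def)

lemma op_limI:
  assumes "\<And>n. T n \<in> bounded_ops A" "L \<in> bounded_ops A" "\<And>n. op_dist A (T n) L \<le> r n" "r \<longlonglongrightarrow> 0"
  shows "op_lim A T L"
  unfolding op_lim_def
proof (intro conjI allI assms(1,2))
  show "(\<lambda>n. op_dist A (T n) L) \<longlonglongrightarrow> 0"
    by (rule tendsto_sandwich[OF _ _ tendsto_const assms(4)]) (auto simp: assms op_dist_nonneg)
qed

lemma op_lim_unique:
  assumes "op_lim A T L" "op_lim A T L'"
  shows "L = L'"
proof (rule op_dist_eq_0[OF op_limD(2)[OF assms(1)] op_limD(2)[OF assms(2)]])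
  have "op_dist A L L' \<le> op_dist A (T n) L + op_dist A (T n) L'" for n
    using op_dist_triangle[OF op_limD(2)[OF assms(1)] op_limD(1)[OF assms(1), of n] op_limD(2)[OF assms(2)]]
      op_dist_commute[OF op_limD(1)[OF assms(1), of n] op_limD(2)[OF assms(1)]] by simp
  moreover have "(\<lambda>n. op_dist A (T n) L + op_dist A (T n) L') \<longlonglongrightarrow> 0 + 0"
    by (intro tendsto_add op_limD(3) assms)
  ultimately show "op_dist A L L' \<le> 0" using LIMSEQ_le_const by fastforce
qed

lemma op_lim_add:
  assumes "op_lim A T L" "op_lim A U M"
  shows "op_lim A (\<lambda>n \<xi> a. T n \<xi> a + U n \<xi> a) (\<lambda>\<xi> a. L \<xi> a + M \<xi> a)"
proof (rule op_limI)
  show "(\<lambda>n. op_dist A (T n) L + op_dist A (U n) M) \<longlonglongrightarrow> 0"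
    using tendsto_add[OF op_limD(3)[OF assms(1)] op_limD(3)[OF assms(2)]] by simp
qed (use assms in \<open>auto intro!: bounded_ops_add op_dist_add simp: op_limD\<close>)

lemma op_lim_scale:
  assumes "op_lim A T L"
  shows "op_lim A (\<lambda>n \<xi> a. c * T n \<xi> a) (\<lambda>\<xi> a. c * L \<xi> a)"
proof (rule op_limI)
  show "(\<lambda>n. cmod c * op_dist A (T n) L) \<longlonglongrightarrow> 0"
    using tendsto_mult_left[OF op_limD(3)[OF assms(1)], of "cmod c"] by simp
qed (use assms in \<open>auto intro!: bounded_ops_scale op_dist_scale simp: op_limD\<close>)

lemma op_lim_comp:
  assumes "op_lim A T L" "op_lim A U M"
  shows "op_lim A (\<lambda>n. T n \<circ> U n) (L \<circ> M)"
proof (rule op_limI)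
  let ?t = "\<lambda>n. op_dist A (T n) L" and ?u = "\<lambda>n. op_dist A (U n) M"
  show "(\<lambda>n. (op_norm A L + ?t n) * ?u n + ?t n * op_norm A M) \<longlonglongrightarrow> 0"
    by (auto intro!: tendsto_eq_intros op_limD(3)[OF assms(1)] op_limD(3)[OF assms(2)])
  fix n
  have "op_dist A (T n \<circ> U n) (L \<circ> M) \<le> op_norm A (T n) * ?u n + ?t n * op_norm A M"
    by (intro op_dist_comp op_limD[OF assms(1)] op_limD[OF assms(2)])
  moreover have "op_norm A (T n) * ?u n \<le> (op_norm A L + ?t n) * ?u n"
    by (intro mult_right_mono op_norm_le_dist op_dist_nonneg op_limD[OF assms(1)] op_limD[OF assms(2)])
  ultimately show "op_dist A (T n \<circ> U n) (L \<circ> M) \<le> (op_norm A L + ?t n) * ?u n + ?t n * op_norm A M"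
    by simp
qed (use assms in \<open>auto intro!: bounded_ops_comp simp: op_limD\<close>)

lemma op_lim_const: "T \<in> bounded_ops A \<Longrightarrow> op_lim A (\<lambda>n. T) T"
  by (rule op_limI[where r = "\<lambda>n. 0"]) (auto simp: op_dist_eq intro!: op_norm_le)

text \<open>The limit is taken coordinate by coordinate in \<complex>. Linearity passes to it
  directly; the norm estimate passes to it because an L2 sum over a finite set involves finitely
  many coordinates only.\<close>

theorem op_complete:
  assumes T: "\<And>n. T n \<in> bounded_ops A"
    and cauchy: "\<And>e. e > 0 \<Longrightarrow> \<exists>N. \<forall>m\<ge>N. \<forall>n\<ge>N. op_dist A (T m) (T n) < e"
  shows "\<exists>L. op_lim A T L"
proof -
  have pt: "cmod (T m \<xi> a - T n \<xi> a) \<le> op_dist A (T m) (T n) * ell2_norm A \<xi>" if "\<xi> \<in> ell2 A" for m n \<xi> a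
    using ell2_norm_point[OF bounded_ops_in[OF bounded_ops_diff[OF T[of m] T[of n]]], of \<xi> a]
      op_dist_bound[OF T T that, of m n] by simp
  have "convergent (\<lambda>n. T n \<xi> a)" for \<xi> a
  proof (cases "\<xi> \<in> ell2 A")
    case True
    have "Cauchy (\<lambda>n. T n \<xi> a)"
    proof (rule metric_CauchyI)
      fix e :: real assume "e > 0"
      let ?k = "ell2_norm A \<xi> + 1"
      have k: "?k > 0" by (simp add: add_nonneg_pos)
      then obtain N where N: "\<forall>m\<ge>N. \<forall>n\<ge>N. op_dist A (T m) (T n) < e / ?k"
        using cauchy[of "e / ?k"] \<open>e > 0\<close> by auto
      show "\<exists>N. \<forall>m\<ge>N. \<forall>n\<ge>N. dist (T m \<xi> a) (T n \<xi> a) < e"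
      proof (intro exI[of _ N] allI impI)
        fix m n assume "m \<ge> N" "n \<ge> N"
        then have "op_dist A (T m) (T n) < e / ?k" using N by blast
        then have "op_dist A (T m) (T n) * ?k < e" using k by (simp add: pos_less_divide_eq)
        moreover have "op_dist A (T m) (T n) * ell2_norm A \<xi> \<le> op_dist A (T m) (T n) * ?k"
          by (intro mult_left_mono op_dist_nonneg T) simp
        ultimately show "dist (T m \<xi> a) (T n \<xi> a) < e" using pt[OF True, of m a n] by (simp add: dist_norm)
      qed
    qed
    then show ?thesis by (simp add: Cauchy_convergent_iff)
  qed (simp add: bounded_opsD(2)[OF T] convergent_const)
  then obtain L where L: "\<And>\<xi> a. (\<lambda>n. T n \<xi> a) \<longlonglongrightarrow> L \<xi> a"
    unfolding convergent_def by metis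
  \<comment> \<open>Lower semicontinuity of the norm: the bound on \<open>T m - T n\<close> survives
    the limit in \<open>n\<close>, first on finite sets and then on \<open>A\<close>. Both the
    boundedness of \<open>L\<close> and the convergence to it are read off from this.\<close>
  have near: "(\<lambda>a. T m \<xi> a + (-1) * L \<xi> a) \<in> ell2 A \<and>
      ell2_norm A (\<lambda>a. T m \<xi> a + (-1) * L \<xi> a) \<le> e * ell2_norm A \<xi>"
    if \<xi>: "\<xi> \<in> ell2 A" and N: "\<forall>n\<ge>N. op_dist A (T m) (T n) \<le> e" for \<xi> m N e
  proof -
    have "L2_set (\<lambda>a. cmod (T m \<xi> a + (-1) * L \<xi> a)) F \<le> e * ell2_norm A \<xi>" if "finite F" "F \<subseteq> A" for F
    proof (rule LIMSEQ_le_const2)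
      show "(\<lambda>n. L2_set (\<lambda>a. cmod (T m \<xi> a + (-1) * T n \<xi> a)) F) \<longlonglongrightarrow> L2_set (\<lambda>a. cmod (T m \<xi> a + (-1) * L \<xi> a)) F"
        unfolding L2_set_def by (intro tendsto_intros L)
      show "\<exists>N. \<forall>n\<ge>N. L2_set (\<lambda>a. cmod (T m \<xi> a + (-1) * T n \<xi> a)) F \<le> e * ell2_norm A \<xi>"
      proof (intro exI[of _ N] allI impI)
        fix n assume "n \<ge> N"
        then have "op_dist A (T m) (T n) * ell2_norm A \<xi> \<le> e * ell2_norm A \<xi>"
          using N by (intro mult_right_mono) auto
        then show "L2_set (\<lambda>a. cmod (T m \<xi> a + (-1) * T n \<xi> a)) F \<le> e * ell2_norm A \<xi>"
          using L2_set_le_ell2_norm[OF bounded_ops_in[OF bounded_ops_diff[OF T[of m] T[of n]]] that, of \<xi>]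
            op_dist_bound[OF T T \<xi>, of m n] by linarith
      qed
    qed
    moreover have "T m \<xi> a + (-1) * L \<xi> a = 0" if "a \<notin> A" for a
    proof -
      have "(\<lambda>n. T n \<xi> a) = (\<lambda>n. 0)" using ell2_off[OF bounded_ops_in[OF T] that] by auto
      then have "L \<xi> a = 0" using L[of \<xi> a] LIMSEQ_unique tendsto_const by metis
      then show ?thesis using ell2_off[OF bounded_ops_in[OF T] that] by simp
    qed
    ultimately show ?thesis using ell2I[of A "\<lambda>a. T m \<xi> a + (-1) * L \<xi> a"] by blast
  qed
  have unif: "\<exists>N. \<forall>m\<ge>N. \<forall>n\<ge>N. op_dist A (T m) (T n) \<le> e" if "e > 0" for e
    using cauchy[OF that] by (meson less_imp_le)
  \<comment> \<open>With the tolerance 1, \<open>L\<close> differs from the bounded operator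
    \<open>T N1\<close> by an operator of norm at most 1, which gives the bound for
    \<open>L\<close>.\<close>
  obtain N1 where N1: "\<forall>m\<ge>N1. \<forall>n\<ge>N1. op_dist A (T m) (T n) \<le> 1" using unif[of 1] by auto
  have Lb: "L \<in> bounded_ops A"
    unfolding bounded_ops_def
  proof (intro CollectI conjI ballI allI impI)
    have nb: "L \<xi> \<in> ell2 A \<and> ell2_norm A (L \<xi>) \<le> (op_norm A (T N1) + 1) * ell2_norm A \<xi>" if "\<xi> \<in> ell2 A" for \<xi>
    proof -
      have n: "(\<lambda>a. T N1 \<xi> a + (-1) * L \<xi> a) \<in> ell2 A"
          "ell2_norm A (\<lambda>a. T N1 \<xi> a + (-1) * L \<xi> a) \<le> 1 * ell2_norm A \<xi>"
        using near[OF that, of N1 N1 1] N1 by auto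
      have e: "L \<xi> = (\<lambda>a. T N1 \<xi> a + (-1) * (T N1 \<xi> a + (-1) * L \<xi> a))" by auto
      have m: "(\<lambda>a. (-1) * (T N1 \<xi> a + (-1) * L \<xi> a)) \<in> ell2 A"
          "ell2_norm A (\<lambda>a. (-1) * (T N1 \<xi> a + (-1) * L \<xi> a)) \<le> ell2_norm A \<xi>"
        using ell2_scale[OF n(1), of "-1"] n(2) by auto
      show ?thesis
        using ell2_add[OF bounded_ops_in[OF T] m(1), of N1 \<xi>] e m(2) op_norm_bound[OF T that, of N1]
        by (auto simp: algebra_simps)
    qed
    show "\<exists>C. \<forall>\<xi>\<in>ell2 A. ell2_norm A (L \<xi>) \<le> C * ell2_norm A \<xi>" using nb by blast
    show "L \<xi> \<in> ell2 A" if "\<xi> \<in> ell2 A" for \<xi> using nb[OF that] by simp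
    show "L \<xi> = (\<lambda>a. 0)" if "\<xi> \<notin> ell2 A" for \<xi>
    proof
      fix a
      have "(\<lambda>n. T n \<xi> a) = (\<lambda>n. 0)" using bounded_opsD(2)[OF T that] by auto
      then show "L \<xi> a = 0" using L[of \<xi> a] LIMSEQ_unique tendsto_const by metis
    qed
    show "L (\<lambda>a. \<xi> a + \<eta> a) = (\<lambda>a. L \<xi> a + L \<eta> a)" if "\<xi> \<in> ell2 A" "\<eta> \<in> ell2 A" for \<xi> \<eta>
    proof
      fix a
      have "(\<lambda>n. T n (\<lambda>a. \<xi> a + \<eta> a) a) = (\<lambda>n. T n \<xi> a + T n \<eta> a)"
        using bounded_opsD(3)[OF T that] by auto
      moreover have "(\<lambda>n. T n \<xi> a + T n \<eta> a) \<longlonglongrightarrow> L \<xi> a + L \<eta> a" by (intro tendsto_add L)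
      ultimately show "L (\<lambda>a. \<xi> a + \<eta> a) a = L \<xi> a + L \<eta> a"
        using L[of "\<lambda>a. \<xi> a + \<eta> a" a] LIMSEQ_unique by metis
    qed
    show "L (\<lambda>a. c * \<xi> a) = (\<lambda>a. c * L \<xi> a)" if "\<xi> \<in> ell2 A" for \<xi> c
    proof
      fix a
      have "(\<lambda>n. T n (\<lambda>a. c * \<xi> a) a) = (\<lambda>n. c * T n \<xi> a)"
        using bounded_opsD(4)[OF T that] by auto
      moreover have "(\<lambda>n. c * T n \<xi> a) \<longlonglongrightarrow> c * L \<xi> a" by (intro tendsto_mult_left L)
      ultimately show "L (\<lambda>a. c * \<xi> a) a = c * L \<xi> a"
        using L[of "\<lambda>a. c * \<xi> a" a] LIMSEQ_unique by metis
    qed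
  qed
  have "(\<lambda>n. op_dist A (T n) L) \<longlonglongrightarrow> 0"
  proof (rule LIMSEQ_I)
    fix e :: real assume "e > 0"
    then obtain N where N: "\<forall>m\<ge>N. \<forall>n\<ge>N. op_dist A (T m) (T n) \<le> e/2" using unif[of "e/2"] by auto
    show "\<exists>N. \<forall>n\<ge>N. norm (op_dist A (T n) L - 0) < e"
    proof (intro exI[of _ N] allI impI)
      fix n assume "n \<ge> N"
      then have "\<forall>k\<ge>N. op_dist A (T n) (T k) \<le> e/2" using N by blast
      then have "op_dist A (T n) L \<le> e/2"
        unfolding op_dist_eq[of A "T n" L] using \<open>e > 0\<close> by (intro op_norm_le conjunct2[OF near]) auto
      then show "norm (op_dist A (T n) L - 0) < e" using op_dist_nonneg[OF T Lb, of n] \<open>e > 0\<close> by auto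
    qed
  qed
  with T Lb show ?thesis unfolding op_lim_def by blast
qed

subsection \<open>Adjoints\<close>

lemma ell2_inner_summable:
  assumes "\<xi> \<in> ell2 A" "\<eta> \<in> ell2 A"
  shows "(\<lambda>a. norm (\<xi> a * cnj (\<eta> a))) summable_on A"
    and "cmod (ell2_inner A \<xi> \<eta>) \<le> ell2_norm A \<xi> * ell2_norm A \<eta>"
proof -
  have le: "(\<Sum>a\<in>F. norm (\<xi> a * cnj (\<eta> a))) \<le> ell2_norm A \<xi> * ell2_norm A \<eta>"
    if "finite F" "F \<subseteq> A" for F
  proof -
    have "(\<Sum>a\<in>F. norm (\<xi> a * cnj (\<eta> a))) = (\<Sum>a\<in>F. \<bar>cmod (\<xi> a)\<bar> * \<bar>cmod (\<eta> a)\<bar>)"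
      by (simp add: norm_mult)
    also have "\<dots> \<le> L2_set (\<lambda>a. cmod (\<xi> a)) F * L2_set (\<lambda>a. cmod (\<eta> a)) F"
      by (rule L2_set_mult_ineq)
    also have "\<dots> \<le> ell2_norm A \<xi> * ell2_norm A \<eta>"
      by (intro mult_mono L2_set_le_ell2_norm assms that) auto
    finally show ?thesis .
  qed
  show s: "(\<lambda>a. norm (\<xi> a * cnj (\<eta> a))) summable_on A"
    by (rule nonneg_bdd_above_summable_on)
      (auto intro!: bdd_aboveI[where M = "ell2_norm A \<xi> * ell2_norm A \<eta>"] le)
  show "cmod (ell2_inner A \<xi> \<eta>) \<le> ell2_norm A \<xi> * ell2_norm A \<eta>"
    unfolding ell2_inner_def
    by (rule order_trans[OF norm_infsum_bound[OF s]]) (rule infsum_le_finite_sums[OF s le])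
qed

lemma ell2_inner_self: "\<xi> \<in> ell2 A \<Longrightarrow> ell2_inner A \<xi> \<xi> = complex_of_real ((ell2_norm A \<xi>)\<^sup>2)"
proof -
  assume "\<xi> \<in> ell2 A"
  have "ell2_inner A \<xi> \<xi> = (\<Sum>\<^sub>\<infinity>a\<in>A. complex_of_real ((cmod (\<xi> a))\<^sup>2))"
    unfolding ell2_inner_def by (simp add: complex_norm_square del: of_real_power)
  also have "\<dots> = complex_of_real (\<Sum>\<^sub>\<infinity>a\<in>A. (cmod (\<xi> a))\<^sup>2)"
    by (rule infsumI[OF has_sum_bounded_linear[OF bounded_linear_of_real has_sum_infsum[OF ell2_summable]]]) fact
  finally show ?thesis by (simp add: ell2_norm_def infsum_nonneg)
qed

lemma ell2_inner_diff:
  assumes "\<xi> \<in> ell2 A" "\<xi>' \<in> ell2 A" "\<eta> \<in> ell2 A"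
  shows "ell2_inner A (\<lambda>a. \<xi> a + (-1) * \<xi>' a) \<eta> = ell2_inner A \<xi> \<eta> - ell2_inner A \<xi>' \<eta>"
    and "ell2_inner A \<eta> (\<lambda>a. \<xi> a + (-1) * \<xi>' a) = ell2_inner A \<eta> \<xi> - ell2_inner A \<eta> \<xi>'"
proof -
  note s = abs_summable_summable[OF ell2_inner_summable(1)]
  have diff: "infsum (\<lambda>a. f a - g a) A = infsum f A - infsum g A"
    if "f summable_on A" "g summable_on A" for f g :: "'a \<Rightarrow> complex"
    using infsum_add[of f A "\<lambda>a. - g a"] that by (simp add: infsum_uminus summable_on_uminus)
  show "ell2_inner A (\<lambda>a. \<xi> a + (-1) * \<xi>' a) \<eta> = ell2_inner A \<xi> \<eta> - ell2_inner A \<xi>' \<eta>"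
    unfolding ell2_inner_def
    by (subst diff[symmetric]) (auto intro!: s assms simp: algebra_simps)
  show "ell2_inner A \<eta> (\<lambda>a. \<xi> a + (-1) * \<xi>' a) = ell2_inner A \<eta> \<xi> - ell2_inner A \<eta> \<xi>'"
    unfolding ell2_inner_def
    by (subst diff[symmetric]) (auto intro!: s assms simp: algebra_simps)
qed

text \<open>Adjoints are handled as a relation. Their existence is established for matrix operators,
  where they are explicit, and for limits of these; \<open>op_adjoint\<close>, a definite
  description, is only ever evaluated from a known pair.\<close>

definition adjoint_pair :: "'b set \<Rightarrow> 'b op \<Rightarrow> 'b op \<Rightarrow> bool" where
  "adjoint_pair A T U \<longleftrightarrow> T \<in> bounded_ops A \<and> U \<in> bounded_ops A \<and>
     (\<forall>\<xi>\<in>ell2 A. \<forall>\<eta>\<in>ell2 A. ell2_inner A (T \<xi>) \<eta> = ell2_inner A \<xi> (U \<eta>))"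

lemma adjoint_pair_unique:
  assumes "adjoint_pair A T U" "adjoint_pair A T U'"
  shows "U = U'"
proof
  fix \<eta>
  have b: "U \<in> bounded_ops A" "U' \<in> bounded_ops A" using assms by (auto simp: adjoint_pair_def)
  show "U \<eta> = U' \<eta>"
  proof (cases "\<eta> \<in> ell2 A")
    case True
    let ?d = "\<lambda>a. U \<eta> a + (-1) * U' \<eta> a"
    have d: "?d \<in> ell2 A" using bounded_ops_in[OF bounded_ops_diff[OF b]] .
    have "ell2_inner A ?d ?d = ell2_inner A ?d (U \<eta>) - ell2_inner A ?d (U' \<eta>)"
      by (intro ell2_inner_diff(2) bounded_ops_in[OF b(1)] bounded_ops_in[OF b(2)] d)
    also have "ell2_inner A ?d (U \<eta>) = ell2_inner A (T ?d) \<eta>"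
      using assms(1) d True unfolding adjoint_pair_def by simp
    also have "ell2_inner A ?d (U' \<eta>) = ell2_inner A (T ?d) \<eta>"
      using assms(2) d True unfolding adjoint_pair_def by simp
    finally have "ell2_norm A ?d = 0" using ell2_inner_self[OF d] by (simp del: of_real_power)
    then have "?d = (\<lambda>a. 0)" by (rule ell2_norm_eq_0[OF d])
    then show ?thesis by (auto simp: fun_eq_iff)
  qed (use b in \<open>simp add: bounded_opsD\<close>)
qed

lemma op_adjoint_eq:
  assumes "adjoint_pair A T U"
  shows "op_adjoint A T = U"
  unfolding op_adjoint_def
proof (rule the_equality)
  show "U \<in> bounded_ops A \<and> (\<forall>\<xi>\<in>ell2 A. \<forall>\<eta>\<in>ell2 A. ell2_inner A (T \<xi>) \<eta> = ell2_inner A \<xi> (U \<eta>))"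
    using assms by (simp add: adjoint_pair_def)
next
  fix T'
  assume "T' \<in> bounded_ops A \<and> (\<forall>\<xi>\<in>ell2 A. \<forall>\<eta>\<in>ell2 A. ell2_inner A (T \<xi>) \<eta> = ell2_inner A \<xi> (T' \<eta>))"
  then have "adjoint_pair A T T'" using assms by (simp add: adjoint_pair_def)
  then show "T' = U" using assms by (rule adjoint_pair_unique)
qed

text \<open>The square of the norm of \<open>U \<eta>\<close> is the inner product of
  \<open>T (U \<eta>)\<close> and \<open>\<eta>\<close>; Cauchy-Schwarz bounds it, and one factor
  \<open>ell2_norm A (U \<eta>)\<close> cancels.\<close>

lemma adjoint_pair_norm:
  assumes "adjoint_pair A T U"
  shows "op_norm A U \<le> op_norm A T"
proof -
  have T: "T \<in> bounded_ops A" and U: "U \<in> bounded_ops A"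
    and eq: "\<And>\<xi> \<eta>. \<xi> \<in> ell2 A \<Longrightarrow> \<eta> \<in> ell2 A \<Longrightarrow> ell2_inner A (T \<xi>) \<eta> = ell2_inner A \<xi> (U \<eta>)"
    using assms by (auto simp: adjoint_pair_def)
  show ?thesis
  proof (rule op_norm_le[OF op_norm_nonneg[OF T]])
    fix \<eta> assume \<eta>: "\<eta> \<in> ell2 A"
    let ?n = "ell2_norm A (U \<eta>)"
    have "complex_of_real (?n\<^sup>2) = ell2_inner A (T (U \<eta>)) \<eta>"
      using ell2_inner_self[OF bounded_ops_in[OF U], of \<eta>] eq[OF bounded_ops_in[OF U] \<eta>] by simp
    then have "?n\<^sup>2 = cmod (ell2_inner A (T (U \<eta>)) \<eta>)"
      by (metis norm_of_real abs_of_nonneg zero_le_power2)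
    also have "\<dots> \<le> ell2_norm A (T (U \<eta>)) * ell2_norm A \<eta>"
      by (intro ell2_inner_summable(2) bounded_ops_in[OF T] \<eta>)
    also have "\<dots> \<le> (op_norm A T * ?n) * ell2_norm A \<eta>"
      by (intro mult_right_mono op_norm_bound T bounded_ops_in[OF U]) simp
    finally have "?n * ?n \<le> (op_norm A T * ell2_norm A \<eta>) * ?n" by (simp add: power2_eq_square mult_ac)
    then show "?n \<le> op_norm A T * ell2_norm A \<eta>"
      using op_norm_nonneg[OF T] by (cases "?n = 0") (auto simp: mult_le_cancel_right order_less_le)
  qed
qed

lemma adjoint_pair_diff:
  assumes "adjoint_pair A T U" "adjoint_pair A T' U'"
  shows "adjoint_pair A (\<lambda>\<xi> a. T \<xi> a + (-1) * T' \<xi> a) (\<lambda>\<xi> a. U \<xi> a + (-1) * U' \<xi> a)"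
proof -
  have b: "T \<in> bounded_ops A" "U \<in> bounded_ops A" "T' \<in> bounded_ops A" "U' \<in> bounded_ops A"
    using assms by (auto simp: adjoint_pair_def)
  show ?thesis
    unfolding adjoint_pair_def
  proof (intro conjI ballI bounded_ops_diff b)
    fix \<xi> \<eta> assume "\<xi> \<in> ell2 A" "\<eta> \<in> ell2 A"
    then show "ell2_inner A (\<lambda>a. T \<xi> a + (-1) * T' \<xi> a) \<eta> = ell2_inner A \<xi> (\<lambda>a. U \<eta> a + (-1) * U' \<eta> a)"
      using assms
      by (simp only: adjoint_pair_def ell2_inner_diff b bounded_ops_in)
  qed
qed

lemma op_dist_adjoint:
  assumes "adjoint_pair A T U" "adjoint_pair A T' U'"
  shows "op_dist A U U' \<le> op_dist A T T'"
  using adjoint_pair_norm[OF adjoint_pair_diff[OF assms]] by (simp add: op_dist_eq)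

lemma op_lim_cauchy:
  assumes "op_lim A T L" "e > 0"
  shows "\<exists>N. \<forall>m\<ge>N. \<forall>n\<ge>N. op_dist A (T m) (T n) < e"
proof -
  obtain N where N: "\<And>n. n \<ge> N \<Longrightarrow> op_dist A (T n) L < e/2"
    using LIMSEQ_D[OF op_limD(3)[OF assms(1)], of "e/2"] assms(2) by (force simp: abs_less_iff)
  have "op_dist A (T m) (T n) < e" if "m \<ge> N" "n \<ge> N" for m n
    using op_dist_triangle[OF op_limD(1)[OF assms(1), of m] op_limD(2)[OF assms(1)] op_limD(1)[OF assms(1), of n]]
      op_dist_commute[OF op_limD(2)[OF assms(1)] op_limD(1)[OF assms(1), of n]] N[OF that(1)] N[OF that(2)] by linarith
  then show ?thesis by blast
qed

lemma op_lim_inner: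
  assumes "op_lim A T L" "\<xi> \<in> ell2 A" "\<eta> \<in> ell2 A"
  shows "(\<lambda>n. ell2_inner A (T n \<xi>) \<eta>) \<longlonglongrightarrow> ell2_inner A (L \<xi>) \<eta>"
    and "(\<lambda>n. ell2_inner A \<eta> (T n \<xi>)) \<longlonglongrightarrow> ell2_inner A \<eta> (L \<xi>)"
proof -
  let ?d = "\<lambda>n a. T n \<xi> a + (-1) * L \<xi> a"
  have d: "?d n \<in> ell2 A" for n
    by (rule bounded_ops_in[OF bounded_ops_diff[OF op_limD(1,2)[OF assms(1)]]])
  have dn: "ell2_norm A (?d n) \<le> op_dist A (T n) L * ell2_norm A \<xi>" for n
    by (rule op_dist_bound[OF op_limD(1,2)[OF assms(1)] assms(2)])
  have in2: "T n \<xi> \<in> ell2 A" "L \<xi> \<in> ell2 A" for n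
    using op_limD(1,2)[OF assms(1)] by (auto intro: bounded_ops_in)
  have z: "(\<lambda>n. op_dist A (T n) L * ell2_norm A \<xi> * ell2_norm A \<eta>) \<longlonglongrightarrow> 0"
    by (auto intro!: tendsto_eq_intros op_limD(3)[OF assms(1)])
  have le1: "cmod (ell2_inner A (T n \<xi>) \<eta> - ell2_inner A (L \<xi>) \<eta>) \<le> op_dist A (T n) L * ell2_norm A \<xi> * ell2_norm A \<eta>" for n
    using ell2_inner_summable(2)[OF d[of n] assms(3)] ell2_inner_diff(1)[OF in2(1)[of n] in2(2) assms(3)]
      mult_right_mono[OF dn[of n], of "ell2_norm A \<eta>"] by simp
  have le2: "cmod (ell2_inner A \<eta> (T n \<xi>) - ell2_inner A \<eta> (L \<xi>)) \<le> op_dist A (T n) L * ell2_norm A \<xi> * ell2_norm A \<eta>" for n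
    using ell2_inner_summable(2)[OF assms(3) d[of n]] ell2_inner_diff(2)[OF in2(1)[of n] in2(2) assms(3)]
      mult_right_mono[OF dn[of n], of "ell2_norm A \<eta>"] by (simp add: mult.commute)
  show "(\<lambda>n. ell2_inner A (T n \<xi>) \<eta>) \<longlonglongrightarrow> ell2_inner A (L \<xi>) \<eta>"
    by (rule LIM_zero_cancel, rule Lim_null_comparison[OF _ z]) (use le1 in auto)
  show "(\<lambda>n. ell2_inner A \<eta> (T n \<xi>)) \<longlonglongrightarrow> ell2_inner A \<eta> (L \<xi>)"
    by (rule LIM_zero_cancel, rule Lim_null_comparison[OF _ z]) (use le2 in auto)
qed

text \<open>Adjunction is contractive, so the adjoints of a convergent sequence form a Cauchy
  sequence; completeness supplies its limit, and the adjoint identity is closed under limits of both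
  sides.\<close>

lemma op_lim_adjoint:
  assumes "op_lim A T L" "\<And>n. adjoint_pair A (T n) (U n)"
  shows "\<exists>M. op_lim A U M \<and> adjoint_pair A L M"
proof -
  have "\<exists>M. op_lim A U M"
  proof (rule op_complete)
    show "U n \<in> bounded_ops A" for n using assms(2) by (simp add: adjoint_pair_def)
    show "\<exists>N. \<forall>m\<ge>N. \<forall>n\<ge>N. op_dist A (U m) (U n) < e" if "e > 0" for e
      using op_lim_cauchy[OF assms(1) that] op_dist_adjoint[OF assms(2) assms(2)]
      by (meson le_less_trans)
  qed
  then obtain M where M: "op_lim A U M" by blast
  have "ell2_inner A (L \<xi>) \<eta> = ell2_inner A \<xi> (M \<eta>)" if "\<xi> \<in> ell2 A" "\<eta> \<in> ell2 A" for \<xi> \<eta>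
  proof (rule LIMSEQ_unique)
    show "(\<lambda>n. ell2_inner A (T n \<xi>) \<eta>) \<longlonglongrightarrow> ell2_inner A (L \<xi>) \<eta>"
      by (rule op_lim_inner(1)[OF assms(1) that])
    show "(\<lambda>n. ell2_inner A (T n \<xi>) \<eta>) \<longlonglongrightarrow> ell2_inner A \<xi> (M \<eta>)"
      using op_lim_inner(2)[OF M that(2,1)] assms(2) that by (simp add: adjoint_pair_def)
  qed
  with M op_limD(2)[OF assms(1)] op_limD(2)[OF M] show ?thesis by (auto simp: adjoint_pair_def)
qed

section \<open>Isometric representations of completions\<close>

text \<open>What the final argument needs, freed of groupoids. Isometry is an equation between
  distances and injectivity of \<open>\<phi>\<close> is not demanded: elements at distance 0 are
  identified by the completion anyway.\<close>

locale isometric_rep =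
  fixes A :: "'b star_alg" and S :: "'c set" and \<phi> :: "'b \<Rightarrow> 'c op"
  assumes nonempty: "sa_carrier A \<noteq> {}"
    and closed: "\<And>x y. x \<in> sa_carrier A \<Longrightarrow> y \<in> sa_carrier A \<Longrightarrow> sa_add A x y \<in> sa_carrier A"
      "\<And>c x. x \<in> sa_carrier A \<Longrightarrow> sa_scale A c x \<in> sa_carrier A"
      "\<And>x y. x \<in> sa_carrier A \<Longrightarrow> y \<in> sa_carrier A \<Longrightarrow> sa_mult A x y \<in> sa_carrier A"
      "\<And>x. x \<in> sa_carrier A \<Longrightarrow> sa_star A x \<in> sa_carrier A"
    and hom: "\<And>x y. x \<in> sa_carrier A \<Longrightarrow> y \<in> sa_carrier A \<Longrightarrow> \<phi> (sa_add A x y) = (\<lambda>\<xi> a. \<phi> x \<xi> a + \<phi> y \<xi> a)"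
      "\<And>c x. x \<in> sa_carrier A \<Longrightarrow> \<phi> (sa_scale A c x) = (\<lambda>\<xi> a. c * \<phi> x \<xi> a)"
      "\<And>x y. x \<in> sa_carrier A \<Longrightarrow> y \<in> sa_carrier A \<Longrightarrow> \<phi> (sa_mult A x y) = \<phi> x \<circ> \<phi> y"
    and adj: "\<And>x. x \<in> sa_carrier A \<Longrightarrow> adjoint_pair S (\<phi> x) (\<phi> (sa_star A x))"
    and isometric: "\<And>x y. x \<in> sa_carrier A \<Longrightarrow> y \<in> sa_carrier A \<Longrightarrow> sa_dist A x y = op_dist S (\<phi> x) (\<phi> y)"
begin

lemma bounded: "x \<in> sa_carrier A \<Longrightarrow> \<phi> x \<in> bounded_ops S"
  using adj by (simp add: adjoint_pair_def)

text \<open>For \<open>b\<close> in \<open>closure_image\<close> this set of sequences is one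
  element of the completion, and all elements arise in this way (\<open>carrier_completion\<close>);
  so \<open>seqs_to\<close> is the inverse of the extension of \<open>\<phi>\<close>.\<close>

definition seqs_to :: "'c op \<Rightarrow> (nat \<Rightarrow> 'b) set" where
  "seqs_to b = {x. (\<forall>n. x n \<in> sa_carrier A) \<and> op_lim S (\<lambda>n. \<phi> (x n)) b}"

definition closure_image :: "'c op set" where
  "closure_image = {b. seqs_to b \<noteq> {}}"

lemma cauchy_iff: "x \<in> cauchy_seqs A \<longleftrightarrow> (\<exists>b. x \<in> seqs_to b)"
proof
  assume x: "x \<in> cauchy_seqs A"
  then have c: "\<And>n. x n \<in> sa_carrier A" by (simp add: cauchy_seqs_def)
  have "\<exists>L. op_lim S (\<lambda>n. \<phi> (x n)) L"
    using x by (intro op_complete bounded c) (simp add: cauchy_seqs_def isometric c)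
  then show "\<exists>b. x \<in> seqs_to b" using c by (auto simp: seqs_to_def)
next
  assume "\<exists>b. x \<in> seqs_to b"
  then obtain b where "\<And>n. x n \<in> sa_carrier A" "op_lim S (\<lambda>n. \<phi> (x n)) b" by (auto simp: seqs_to_def)
  then show "x \<in> cauchy_seqs A"
    using op_lim_cauchy by (auto simp: cauchy_seqs_def isometric)
qed

lemma null_rel_iff:
  assumes "x \<in> seqs_to b"
  shows "(x, y) \<in> null_rel A \<longleftrightarrow> y \<in> seqs_to b"
proof
  have x: "\<And>n. x n \<in> sa_carrier A" "op_lim S (\<lambda>n. \<phi> (x n)) b" using assms by (auto simp: seqs_to_def)
  {
    assume "(x, y) \<in> null_rel A"
    then obtain c where y: "\<And>n. y n \<in> sa_carrier A" "op_lim S (\<lambda>n. \<phi> (y n)) c"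
      and d: "(\<lambda>n. op_dist S (\<phi> (x n)) (\<phi> (y n))) \<longlonglongrightarrow> 0"
      by (auto simp: null_rel_def cauchy_iff seqs_to_def isometric x)
    have "op_lim S (\<lambda>n. \<phi> (x n)) c"
    proof (rule op_limI)
      show "op_dist S (\<phi> (x n)) c \<le> op_dist S (\<phi> (x n)) (\<phi> (y n)) + op_dist S (\<phi> (y n)) c" for n
        by (intro op_dist_triangle bounded x y op_limD[OF y(2)])
      show "(\<lambda>n. op_dist S (\<phi> (x n)) (\<phi> (y n)) + op_dist S (\<phi> (y n)) c) \<longlonglongrightarrow> 0"
        using tendsto_add[OF d op_limD(3)[OF y(2)]] by simp
    qed (auto intro: bounded x op_limD[OF y(2)])
    with x(2) have "c = b" by (rule op_lim_unique[rotated])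
    with y show "y \<in> seqs_to b" by (simp add: seqs_to_def)
  }
  {
    assume y: "y \<in> seqs_to b"
    then have y': "\<And>n. y n \<in> sa_carrier A" "op_lim S (\<lambda>n. \<phi> (y n)) b" by (auto simp: seqs_to_def)
    have "(\<lambda>n. op_dist S (\<phi> (x n)) (\<phi> (y n))) \<longlonglongrightarrow> 0"
    proof (rule tendsto_sandwich[OF _ _ tendsto_const])
      show "(\<lambda>n. op_dist S (\<phi> (x n)) b + op_dist S (\<phi> (y n)) b) \<longlonglongrightarrow> 0"
        using tendsto_add[OF op_limD(3)[OF x(2)] op_limD(3)[OF y'(2)]] by simp
      show "\<forall>\<^sub>F n in sequentially. op_dist S (\<phi> (x n)) (\<phi> (y n)) \<le> op_dist S (\<phi> (x n)) b + op_dist S (\<phi> (y n)) b"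
        using op_dist_triangle[OF bounded[OF x(1)] op_limD(2)[OF x(2)] bounded[OF y'(1)]]
          op_dist_commute[OF op_limD(2)[OF x(2)] bounded[OF y'(1)]] by simp
    qed (auto intro!: always_eventually op_dist_nonneg bounded x y')
    then show "(x, y) \<in> null_rel A"
      using assms y by (auto simp: null_rel_def cauchy_iff isometric x y')
  }
qed

text \<open>The operations of \<open>completion\<close> saturate a set of results computed from
  representatives. It is enough that all of these results converge to the same operator: this
  settles well-definedness and the value at once.\<close>

lemma null_rel_Image:
  assumes "Z \<subseteq> seqs_to b" "Z \<noteq> {}"
  shows "null_rel A `` Z = seqs_to b"
  using assms null_rel_iff by blast

lemma carrier_completion: "sa_carrier (completion A) = seqs_to ` closure_image"
proof -
  have "null_rel A `` {x} = seqs_to b" if "x \<in> seqs_to b" for x b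
    using null_rel_Image[of "{x}" b] that by simp
  then show ?thesis
    by (fastforce simp: completion_def quotient_def cauchy_iff closure_image_def)
qed

lemma closure_image_bounded: "b \<in> closure_image \<Longrightarrow> b \<in> bounded_ops S"
  by (auto simp: closure_image_def seqs_to_def op_lim_def)

lemma extend_seqs_to:
  assumes "b \<in> closure_image"
  shows "completion_extend A (op_alg S) \<phi> (seqs_to b) = b"
  unfolding completion_extend_def
proof (rule the_equality)
  show "b \<in> sa_carrier (op_alg S) \<and> (\<forall>x\<in>seqs_to b. (\<lambda>n. op_dist S (\<phi> (x n)) b) \<longlonglongrightarrow> 0)"
    using closure_image_bounded[OF assms] by (auto simp: op_alg_def seqs_to_def op_lim_def)
  fix c assume c: "c \<in> sa_carrier (op_alg S) \<and> (\<forall>x\<in>seqs_to b. (\<lambda>n. op_dist S (\<phi> (x n)) c) \<longlonglongrightarrow> 0)"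
  obtain x where x: "x \<in> seqs_to b" using assms by (auto simp: closure_image_def)
  then have "op_lim S (\<lambda>n. \<phi> (x n)) c" "op_lim S (\<lambda>n. \<phi> (x n)) b"
    using c by (auto simp: seqs_to_def op_lim_def op_alg_def)
  then show "c = b" by (rule op_lim_unique)
qed

lemma seqs_toD:
  assumes "x \<in> seqs_to b"
  shows "x n \<in> sa_carrier A" "op_lim S (\<lambda>n. \<phi> (x n)) b"
  using assms by (auto simp: seqs_to_def)

lemma seqs_to_add:
  assumes x: "x \<in> seqs_to b" and y: "y \<in> seqs_to c"
  shows "(\<lambda>n. sa_add A (x n) (y n)) \<in> seqs_to (\<lambda>\<xi> a. b \<xi> a + c \<xi> a)"
proof -
  have "(\<lambda>n. \<phi> (sa_add A (x n) (y n))) = (\<lambda>n \<xi> a. \<phi> (x n) \<xi> a + \<phi> (y n) \<xi> a)"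
    using hom(1)[OF seqs_toD(1)[OF x] seqs_toD(1)[OF y]] by (intro ext) metis
  with op_lim_add[OF seqs_toD(2)[OF x] seqs_toD(2)[OF y]] show ?thesis
    unfolding seqs_to_def using closed(1)[OF seqs_toD(1)[OF x] seqs_toD(1)[OF y]] by simp
qed

lemma seqs_to_scale:
  assumes x: "x \<in> seqs_to b"
  shows "(\<lambda>n. sa_scale A k (x n)) \<in> seqs_to (\<lambda>\<xi> a. k * b \<xi> a)"
proof -
  have "(\<lambda>n. \<phi> (sa_scale A k (x n))) = (\<lambda>n \<xi> a. k * \<phi> (x n) \<xi> a)"
    using hom(2)[OF seqs_toD(1)[OF x]] by (intro ext) metis
  with op_lim_scale[OF seqs_toD(2)[OF x], of k] show ?thesis
    unfolding seqs_to_def using closed(2)[OF seqs_toD(1)[OF x]] by simp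
qed

lemma seqs_to_mult:
  assumes x: "x \<in> seqs_to b" and y: "y \<in> seqs_to c"
  shows "(\<lambda>n. sa_mult A (x n) (y n)) \<in> seqs_to (b \<circ> c)"
proof -
  have "(\<lambda>n. \<phi> (sa_mult A (x n) (y n))) = (\<lambda>n. \<phi> (x n) \<circ> \<phi> (y n))"
    using hom(3)[OF seqs_toD(1)[OF x] seqs_toD(1)[OF y]] by (intro ext) metis
  with op_lim_comp[OF seqs_toD(2)[OF x] seqs_toD(2)[OF y]] show ?thesis
    unfolding seqs_to_def using closed(3)[OF seqs_toD(1)[OF x] seqs_toD(1)[OF y]] by simp
qed

lemma seqs_to_star:
  assumes x: "x \<in> seqs_to b"
  shows "(\<lambda>n. sa_star A (x n)) \<in> seqs_to (op_adjoint S b)"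
proof -
  obtain M where "op_lim S (\<lambda>n. \<phi> (sa_star A (x n))) M" "adjoint_pair S b M"
    using op_lim_adjoint[OF seqs_toD(2)[OF x] adj[OF seqs_toD(1)[OF x]]] by blast
  then show ?thesis
    unfolding seqs_to_def using closed(4)[OF seqs_toD(1)[OF x]] op_adjoint_eq by fastforce
qed

lemma closure_image_I:
  assumes "b \<in> bounded_ops S" "\<And>e. e > 0 \<Longrightarrow> \<exists>x\<in>sa_carrier A. op_dist S (\<phi> x) b \<le> e"
  shows "b \<in> closure_image"
proof -
  have "\<exists>x. \<forall>n. x n \<in> sa_carrier A \<and> op_dist S (\<phi> (x n)) b \<le> inverse (real (Suc n))"
    by (rule choice, rule allI) (use assms(2)[of "inverse (real (Suc _))"] in auto)
  then obtain x where x: "\<And>n. x n \<in> sa_carrier A" "\<And>n. op_dist S (\<phi> (x n)) b \<le> inverse (real (Suc n))" by blast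
  have "op_lim S (\<lambda>n. \<phi> (x n)) b"
    by (rule op_limI[OF _ assms(1) x(2) LIMSEQ_inverse_real_of_nat]) (rule bounded[OF x(1)])
  with x(1) show ?thesis by (auto simp: closure_image_def seqs_to_def)
qed

lemma closure_image_near:
  assumes "b \<in> closure_image" "e > 0"
  shows "\<exists>x\<in>sa_carrier A. op_dist S (\<phi> x) b \<le> e"
proof -
  obtain x where x: "\<And>n. x n \<in> sa_carrier A" "op_lim S (\<lambda>n. \<phi> (x n)) b"
    using assms(1) by (auto simp: closure_image_def seqs_to_def)
  obtain N where "\<forall>n\<ge>N. op_dist S (\<phi> (x n)) b < e"
    using LIMSEQ_D[OF op_limD(3)[OF x(2)] assms(2)] by (force simp: abs_less_iff)
  then show ?thesis using x(1) less_imp_le by blast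
qed

lemma image_in_closure: "x \<in> sa_carrier A \<Longrightarrow> \<phi> x \<in> closure_image"
  using op_lim_const[OF bounded] by (auto simp: closure_image_def seqs_to_def intro!: exI[of _ "\<lambda>n. x"])

lemma closed_star_subalgebra_closure_image: "closed_star_subalgebra (op_alg S) closure_image"
  unfolding closed_star_subalgebra_def
proof (intro conjI ballI allI impI; (elim conjE)?)
  show "closure_image \<subseteq> sa_carrier (op_alg S)" using closure_image_bounded by (auto simp: op_alg_def)
  show "closure_image \<noteq> {}" using nonempty image_in_closure by blast
  show "sa_add (op_alg S) x y \<in> closure_image" if "x \<in> closure_image" "y \<in> closure_image" for x y
    using that seqs_to_add by (fastforce simp: closure_image_def op_alg_def)
  show "sa_scale (op_alg S) c x \<in> closure_image" if "x \<in> closure_image" for c x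
    using that seqs_to_scale by (fastforce simp: closure_image_def op_alg_def)
  show "sa_mult (op_alg S) x y \<in> closure_image" if "x \<in> closure_image" "y \<in> closure_image" for x y
    using that seqs_to_mult by (fastforce simp: closure_image_def op_alg_def)
  show "sa_star (op_alg S) x \<in> closure_image" if "x \<in> closure_image" for x
    using that seqs_to_star by (fastforce simp: closure_image_def op_alg_def)
  fix x b assume x: "\<forall>n::nat. x n \<in> closure_image" and b: "b \<in> sa_carrier (op_alg S)"
    and l: "(\<lambda>n. op_dist S (x n) b) \<longlonglongrightarrow> 0"
  have bb: "b \<in> bounded_ops S" using b by (simp add: op_alg_def)
  show "b \<in> closure_image"
  proof (rule closure_image_I[OF bb])
    fix e :: real assume e: "e > 0"
    then obtain n where "norm (op_dist S (x n) b - 0) < e/2"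
      using LIMSEQ_D[OF l, of "e/2"] by auto
    then have n: "op_dist S (x n) b < e/2" by simp
    obtain y where y: "y \<in> sa_carrier A" "op_dist S (\<phi> y) (x n) \<le> e/2"
      using closure_image_near[of "x n" "e/2"] x e by auto
    have "op_dist S (\<phi> y) b \<le> e"
      using op_dist_triangle[OF bounded[OF y(1)] closure_image_bounded bb, of "x n"] x n y(2) by auto
    with y(1) show "\<exists>x\<in>sa_carrier A. op_dist S (\<phi> x) b \<le> e" by blast
  qed
qed

text \<open>The set of limits of the image is a closed star-subalgebra, and any other one that
  contains \<open>G\<close> contains the image by the second assumption, hence its limits.\<close>

lemma generated_eq_closure_image:
  assumes "G \<subseteq> \<phi> ` sa_carrier A"
    and "\<And>M. closed_star_subalgebra (op_alg S) M \<Longrightarrow> G \<subseteq> M \<Longrightarrow> \<phi> ` sa_carrier A \<subseteq> M"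
  shows "closed_star_subalgebra (op_alg S) hull G = closure_image"
proof (rule hull_unique)
  show "G \<subseteq> closure_image" using assms(1) image_in_closure by blast
  fix M assume M: "G \<subseteq> M" "closed_star_subalgebra (op_alg S) M"
  then have im: "\<phi> ` sa_carrier A \<subseteq> M" using assms(2) by blast
  show "closure_image \<subseteq> M"
  proof
    fix b assume "b \<in> closure_image"
    then obtain x where x: "\<forall>n. x n \<in> sa_carrier A" "op_lim S (\<lambda>n. \<phi> (x n)) b"
      by (auto simp: closure_image_def seqs_to_def)
    then show "b \<in> M"
      using M(2) im unfolding closed_star_subalgebra_def op_lim_def
      by (elim conjE allE[of _ "\<lambda>n. \<phi> (x n)"] allE[of _ b] impE) (auto simp: op_alg_def)
  qed
qed (rule closed_star_subalgebra_closure_image)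

text \<open>Bijectivity is immediate, since completion and generated algebra are both indexed by
  \<open>closure_image\<close>; the operations match because they pass to limits of
  operators.\<close>

theorem star_isomorphism_completion:
  assumes "G \<subseteq> \<phi> ` sa_carrier A"
    and "\<And>M. closed_star_subalgebra (op_alg S) M \<Longrightarrow> G \<subseteq> M \<Longrightarrow> \<phi> ` sa_carrier A \<subseteq> M"
  shows "star_isomorphism (completion A) (generated_cstar_subalgebra (op_alg S) G)
    (completion_extend A (op_alg S) \<phi>)"
proof -
  let ?\<Phi> = "completion_extend A (op_alg S) \<phi>"
  have ops: "sa_add (completion A) (seqs_to b) (seqs_to c) = seqs_to (\<lambda>\<xi> a. b \<xi> a + c \<xi> a)"
      "sa_mult (completion A) (seqs_to b) (seqs_to c) = seqs_to (b \<circ> c)"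
      "sa_scale (completion A) k (seqs_to b) = seqs_to (\<lambda>\<xi> a. k * b \<xi> a)"
      "sa_star (completion A) (seqs_to b) = seqs_to (op_adjoint S b)"
    if "b \<in> closure_image" "c \<in> closure_image" for b c k
    using that seqs_to_add seqs_to_mult seqs_to_scale seqs_to_star
    by (auto simp: completion_def closure_image_def intro!: null_rel_Image)
  have cl: "(\<lambda>\<xi> a. b \<xi> a + c \<xi> a) \<in> closure_image" "b \<circ> c \<in> closure_image"
      "(\<lambda>\<xi> a. k * b \<xi> a) \<in> closure_image" "op_adjoint S b \<in> closure_image"
    if "b \<in> closure_image" "c \<in> closure_image" for b c k
    using closed_star_subalgebra_closure_image that unfolding closed_star_subalgebra_def
    by (auto simp: op_alg_def)
  have bij: "bij_betw ?\<Phi> (seqs_to ` closure_image) closure_image"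
    by (rule bij_betwI[where g = seqs_to]) (auto simp: extend_seqs_to)
  show ?thesis
    unfolding star_isomorphism_def carrier_completion generated_cstar_subalgebra_def

    using bij generated_eq_closure_image[OF assms]
    by (auto simp: ops cl extend_seqs_to) (simp_all add: op_alg_def)
qed

end

section \<open>Operators given by matrices with sparse rows and columns\<close>

definition mat_op :: "'b set \<Rightarrow> ('b \<Rightarrow> 'b \<Rightarrow> complex) \<Rightarrow> 'b op" where
  "mat_op A m \<xi> a = (if \<xi> \<in> ell2 A \<and> a \<in> A then \<Sum>\<^sub>\<infinity>b\<in>A. m a b * \<xi> b else 0)"

text \<open>A common bound on the number of entries in rows and columns holds for sums of weighted
  partial permutations and yields bounded operators by counting alone, without positivity or
  spectral arguments.\<close>

definition sparse :: "'b set \<Rightarrow> nat \<Rightarrow> real \<Rightarrow> ('b \<Rightarrow> 'b \<Rightarrow> complex) \<Rightarrow> bool" where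
  "sparse A N C m \<longleftrightarrow>
     (\<forall>a\<in>A. finite {b\<in>A. m a b \<noteq> 0} \<and> card {b\<in>A. m a b \<noteq> 0} \<le> N) \<and>
     (\<forall>b\<in>A. finite {a\<in>A. m a b \<noteq> 0} \<and> card {a\<in>A. m a b \<noteq> 0} \<le> N) \<and>
     (\<forall>a\<in>A. \<forall>b\<in>A. cmod (m a b) \<le> C)"

text \<open>Only finite square submatrices are tested. For matrices with finite rows and
  \<open>0 \<le> C\<close> this expresses that the operator has norm at most \<open>C\<close>, and
  in this form the bound can be moved along an injection of a finite index set.\<close>

definition mat_norm_le :: "'b set \<Rightarrow> ('b \<Rightarrow> 'b \<Rightarrow> complex) \<Rightarrow> real \<Rightarrow> bool" where
  "mat_norm_le A m C \<longleftrightarrow> (\<forall>F \<xi>. finite F \<and> F \<subseteq> A \<longrightarrow>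
     L2_set (\<lambda>a. cmod (\<Sum>b\<in>F. m a b * \<xi> b)) F \<le> C * L2_set (\<lambda>b. cmod (\<xi> b)) F)"

lemma infsum_finite_support:
  fixes f :: "'b \<Rightarrow> complex"
  assumes "finite F" "F \<subseteq> A" "\<And>a. a \<in> A - F \<Longrightarrow> f a = 0"
  shows "infsum f A = sum f F"
proof -
  have "infsum f A = infsum f F"
    by (rule infsum_cong_neutral) (use assms in auto)
  then show ?thesis using assms(1) by simp
qed

lemma mat_op_finite:
  assumes "\<xi> \<in> ell2 A" "a \<in> A" "finite F" "F \<subseteq> A" "\<And>b. b \<in> A \<Longrightarrow> m a b \<noteq> 0 \<Longrightarrow> b \<in> F"
  shows "mat_op A m \<xi> a = (\<Sum>b\<in>F. m a b * \<xi> b)"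
  using assms infsum_finite_support[OF assms(3,4), of "\<lambda>b. m a b * \<xi> b"] by (auto simp: mat_op_def)

lemma sparse_row: "sparse A N C m \<Longrightarrow> a \<in> A \<Longrightarrow> finite {b\<in>A. m a b \<noteq> 0}"
  by (simp add: sparse_def)

lemma sparse_entry: "sparse A N C m \<Longrightarrow> a \<in> A \<Longrightarrow> b \<in> A \<Longrightarrow> cmod (m a b) \<le> C"
  by (simp add: sparse_def)

text \<open>A Schur test. Cauchy-Schwarz in a row with at most \<open>N\<close> entries costs one
  factor \<open>N\<close>; after exchanging the summations, a column with at most \<open>N\<close>
  entries costs the other. The root of the product of \<open>N\<close> squared and \<open>C\<close>
  squared is the constant.\<close>

lemma sparse_mat_norm_le:
  assumes m: "sparse A N C m" and C: "0 \<le> C"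
  shows "mat_norm_le A m (N * C)"
  unfolding mat_norm_le_def
proof (intro allI impI; elim conjE)
  fix F and \<xi> :: "'a \<Rightarrow> complex" assume F: "finite F" "F \<subseteq> A"
  define R where "R = (\<lambda>a. {b\<in>F. m a b \<noteq> 0})"
  have cardR: "card (R a) \<le> N" if "a \<in> F" for a
  proof -
    have "R a \<subseteq> {b\<in>A. m a b \<noteq> 0}" using F by (auto simp: R_def)
    then have "card (R a) \<le> card {b\<in>A. m a b \<noteq> 0}" using m F that by (intro card_mono) (auto simp: sparse_def)
    also have "\<dots> \<le> N" using m F that by (auto simp: sparse_def)
    finally show ?thesis .
  qed
  have cardC: "card {a\<in>F. m a b \<noteq> 0} \<le> N" if "b \<in> F" for b
  proof -
    have "card {a\<in>F. m a b \<noteq> 0} \<le> card {a\<in>A. m a b \<noteq> 0}" using m F that by (intro card_mono) (auto simp: sparse_def)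
    also have "\<dots> \<le> N" using m F that by (auto simp: sparse_def)
    finally show ?thesis .
  qed
  have row: "(cmod (\<Sum>b\<in>F. m a b * \<xi> b))\<^sup>2 \<le> N * C\<^sup>2 * (\<Sum>b\<in>R a. (cmod (\<xi> b))\<^sup>2)" if a: "a \<in> F" for a
  proof -
    have "(\<Sum>b\<in>F. m a b * \<xi> b) = (\<Sum>b\<in>R a. m a b * \<xi> b)"
      using F by (intro sum.mono_neutral_right) (auto simp: R_def)
    then have "cmod (\<Sum>b\<in>F. m a b * \<xi> b) \<le> (\<Sum>b\<in>R a. cmod (m a b * \<xi> b))" by (simp add: norm_sum)
    also have "\<dots> \<le> (\<Sum>b\<in>R a. C * cmod (\<xi> b))"
      using m F a by (intro sum_mono) (auto simp: norm_mult R_def intro!: mult_right_mono sparse_entry[OF m])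
    finally have "(cmod (\<Sum>b\<in>F. m a b * \<xi> b))\<^sup>2 \<le> (\<Sum>b\<in>R a. C * cmod (\<xi> b))\<^sup>2"
      by (intro power_mono) auto
    also have "\<dots> \<le> (\<Sum>b\<in>R a. (C * cmod (\<xi> b))\<^sup>2) * card (R a)"
      by (rule sum_squared_le_sum_of_squares)
    also have "\<dots> \<le> (\<Sum>b\<in>R a. (C * cmod (\<xi> b))\<^sup>2) * N"
      using cardR[OF a] by (intro mult_left_mono) (auto intro: sum_nonneg)
    finally show ?thesis by (simp add: power_mult_distrib sum_distrib_left mult_ac)
  qed
  have "(\<Sum>a\<in>F. (cmod (\<Sum>b\<in>F. m a b * \<xi> b))\<^sup>2) \<le> (\<Sum>a\<in>F. N * C\<^sup>2 * (\<Sum>b\<in>R a. (cmod (\<xi> b))\<^sup>2))"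
    by (intro sum_mono row)
  also have "\<dots> = N * C\<^sup>2 * (\<Sum>a\<in>F. \<Sum>b | b \<in> F \<and> m a b \<noteq> 0. (cmod (\<xi> b))\<^sup>2)"
    by (simp add: sum_distrib_left R_def)
  also have "(\<Sum>a\<in>F. \<Sum>b | b \<in> F \<and> m a b \<noteq> 0. (cmod (\<xi> b))\<^sup>2) =
      (\<Sum>b\<in>F. \<Sum>a | a \<in> F \<and> m a b \<noteq> 0. (cmod (\<xi> b))\<^sup>2)"
    by (rule sum.swap_restrict) (use F in auto)
  also have "\<dots> \<le> (\<Sum>b\<in>F. N * (cmod (\<xi> b))\<^sup>2)"
    using cardC by (intro sum_mono) (auto intro!: mult_right_mono)
  finally have "(\<Sum>a\<in>F. (cmod (\<Sum>b\<in>F. m a b * \<xi> b))\<^sup>2) \<le> N * C\<^sup>2 * (\<Sum>b\<in>F. N * (cmod (\<xi> b))\<^sup>2)"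
    by (simp add: mult_left_mono)
  also have "\<dots> = (N * C)\<^sup>2 * (\<Sum>b\<in>F. (cmod (\<xi> b))\<^sup>2)"
    by (simp add: power_mult_distrib sum_distrib_left power2_eq_square mult_ac)
  finally show "L2_set (\<lambda>a. cmod (\<Sum>b\<in>F. m a b * \<xi> b)) F \<le> N * C * L2_set (\<lambda>b. cmod (\<xi> b)) F"
    using C unfolding L2_set_def by (metis (no_types, lifting) abs_of_nonneg mult_nonneg_nonneg of_nat_0_le_iff real_sqrt_abs real_sqrt_le_mono real_sqrt_mult)
qed

lemma mat_op_bounded:
  assumes rows: "\<And>a. a \<in> A \<Longrightarrow> finite {b\<in>A. m a b \<noteq> 0}" and le: "mat_norm_le A m C" and C: "0 \<le> C"
  shows "mat_op A m \<in> bounded_ops A" "op_norm A (mat_op A m) \<le> C"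
proof -
  have bd: "L2_set (\<lambda>a. cmod (mat_op A m \<xi> a)) F \<le> C * ell2_norm A \<xi>"
    if \<xi>: "\<xi> \<in> ell2 A" and F: "finite F" "F \<subseteq> A" for \<xi> F
  proof -
    \<comment> \<open>\<open>F\<close> is enlarged by the supports of its rows, so that the square
      submatrix on \<open>G\<close> computes the values of the operator on \<open>F\<close>
      exactly.\<close>
    define G where "G = F \<union> (\<Union>a\<in>F. {b\<in>A. m a b \<noteq> 0})"
    have G: "finite G" "F \<subseteq> G" "G \<subseteq> A" using F rows by (auto simp: G_def)
    have "L2_set (\<lambda>a. cmod (mat_op A m \<xi> a)) F = L2_set (\<lambda>a. cmod (\<Sum>b\<in>G. m a b * \<xi> b)) F"
    proof (rule L2_set_cong[OF refl])
      fix a assume "a \<in> F"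
      then show "cmod (mat_op A m \<xi> a) = cmod (\<Sum>b\<in>G. m a b * \<xi> b)"
        using F by (subst mat_op_finite[OF \<xi> _ G(1,3)]) (auto simp: G_def)
    qed
    also have "\<dots> \<le> L2_set (\<lambda>a. cmod (\<Sum>b\<in>G. m a b * \<xi> b)) G"
      unfolding L2_set_def using G by (intro real_sqrt_le_mono sum_mono2) auto
    also have "\<dots> \<le> C * L2_set (\<lambda>b. cmod (\<xi> b)) G"
      using le G unfolding mat_norm_le_def by blast
    also have "\<dots> \<le> C * ell2_norm A \<xi>"
      by (intro mult_left_mono C L2_set_le_ell2_norm \<xi> G)
    finally show ?thesis .
  qed
  have off: "mat_op A m \<xi> a = 0" if "a \<notin> A" for \<xi> a using that by (simp add: mat_op_def)
  have in2: "mat_op A m \<xi> \<in> ell2 A" "ell2_norm A (mat_op A m \<xi>) \<le> C * ell2_norm A \<xi>" if "\<xi> \<in> ell2 A" for \<xi>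
    using ell2I[OF off bd[OF that]] by auto
  show "op_norm A (mat_op A m) \<le> C" by (rule op_norm_le[OF C in2(2)])
  have fin: "mat_op A m \<xi> a = (\<Sum>b | b \<in> A \<and> m a b \<noteq> 0. m a b * \<xi> b)" if "\<xi> \<in> ell2 A" "a \<in> A" for \<xi> a
    by (rule mat_op_finite[OF that rows]) (use that in auto)
  show "mat_op A m \<in> bounded_ops A"
    unfolding bounded_ops_def
  proof (intro CollectI conjI ballI allI impI)
    show "mat_op A m \<xi> \<in> ell2 A" if "\<xi> \<in> ell2 A" for \<xi> by (rule in2[OF that])
    show "mat_op A m \<xi> = (\<lambda>a. 0)" if "\<xi> \<notin> ell2 A" for \<xi> using that by (auto simp: mat_op_def)
    show "\<exists>C. \<forall>\<xi>\<in>ell2 A. ell2_norm A (mat_op A m \<xi>) \<le> C * ell2_norm A \<xi>" using in2(2) by blast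
    show "mat_op A m (\<lambda>a. \<xi> a + \<eta> a) = (\<lambda>a. mat_op A m \<xi> a + mat_op A m \<eta> a)"
      if "\<xi> \<in> ell2 A" "\<eta> \<in> ell2 A" for \<xi> \<eta>
    proof
      fix a show "mat_op A m (\<lambda>a. \<xi> a + \<eta> a) a = mat_op A m \<xi> a + mat_op A m \<eta> a"
        using fin[OF ell2_add(1)[OF that], of a] fin[OF that(1), of a] fin[OF that(2), of a] off
        by (cases "a \<in> A") (auto simp: sum.distrib algebra_simps)
    qed
    show "mat_op A m (\<lambda>a. c * \<xi> a) = (\<lambda>a. c * mat_op A m \<xi> a)" if "\<xi> \<in> ell2 A" for c \<xi>
    proof
      fix a show "mat_op A m (\<lambda>a. c * \<xi> a) a = c * mat_op A m \<xi> a"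
        using fin[OF ell2_scale(1)[OF that], of a] fin[OF that(1), of a] off
        by (cases "a \<in> A") (auto simp: sum_distrib_left algebra_simps)
    qed
  qed
qed

lemma sparse_bounded:
  assumes "sparse A N C m" "0 \<le> C"
  shows "mat_op A m \<in> bounded_ops A" "op_norm A (mat_op A m) \<le> N * C"
  using mat_op_bounded[OF sparse_row[OF assms(1)] sparse_mat_norm_le[OF assms]] assms(2) by auto

lemma mat_norm_le_op_norm:
  assumes rows: "\<And>a. a \<in> A \<Longrightarrow> finite {b\<in>A. m a b \<noteq> 0}" and b: "mat_op A m \<in> bounded_ops A"
  shows "mat_norm_le A m (op_norm A (mat_op A m))"
  unfolding mat_norm_le_def
proof (intro allI impI; elim conjE)
  fix F and \<xi> :: "'a \<Rightarrow> complex" assume F: "finite F" "F \<subseteq> A"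
  \<comment> \<open>\<open>\<xi>\<close> is arbitrary outside \<open>F\<close>; cutting it off gives
    a vector in \<open>ell2 A\<close>, and the submatrix is a compression of the operator.\<close>
  define \<eta> where "\<eta> = (\<lambda>a. if a \<in> F then \<xi> a else 0)"
  have L: "L2_set (\<lambda>a. cmod (\<eta> a)) G \<le> L2_set (\<lambda>b. cmod (\<xi> b)) F" if "finite G" for G
  proof -
    have "(\<Sum>a\<in>G. (cmod (\<eta> a))\<^sup>2) = (\<Sum>a\<in>G \<inter> F. (cmod (\<xi> a))\<^sup>2)"
      using that by (auto simp: \<eta>_def sum.inter_restrict intro!: sum.cong)
    also have "\<dots> \<le> (\<Sum>a\<in>F. (cmod (\<xi> a))\<^sup>2)" using F by (intro sum_mono2) auto
    finally show ?thesis by (simp add: L2_set_def)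
  qed
  have \<eta>: "\<eta> \<in> ell2 A" "ell2_norm A \<eta> \<le> L2_set (\<lambda>b. cmod (\<xi> b)) F"
    using F(2) by (auto intro!: ell2I[where \<xi> = \<eta>, OF _ L]) (auto simp: \<eta>_def)
  have "mat_op A m \<eta> a = (\<Sum>b\<in>F. m a b * \<xi> b)" if "a \<in> F" for a
  proof -
    have "a \<in> A" using that F by auto
    have "mat_op A m \<eta> a = (\<Sum>\<^sub>\<infinity>b\<in>A. m a b * \<eta> b)" using \<eta>(1) \<open>a \<in> A\<close> by (simp add: mat_op_def)
    also have "\<dots> = (\<Sum>b\<in>F. m a b * \<eta> b)"
      by (rule infsum_finite_support) (use F in \<open>auto simp: \<eta>_def\<close>)
    finally show ?thesis by (simp add: \<eta>_def)
  qed
  then have "L2_set (\<lambda>a. cmod (\<Sum>b\<in>F. m a b * \<xi> b)) F = L2_set (\<lambda>a. cmod (mat_op A m \<eta> a)) F"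
    by (intro L2_set_cong) auto
  also have "\<dots> \<le> ell2_norm A (mat_op A m \<eta>)"
    by (intro L2_set_le_ell2_norm bounded_ops_in[OF b] F)
  also have "\<dots> \<le> op_norm A (mat_op A m) * ell2_norm A \<eta>" by (rule op_norm_bound[OF b \<eta>(1)])
  also have "\<dots> \<le> op_norm A (mat_op A m) * L2_set (\<lambda>b. cmod (\<xi> b)) F"
    by (intro mult_left_mono \<eta> op_norm_nonneg b)
  finally show "L2_set (\<lambda>a. cmod (\<Sum>b\<in>F. m a b * \<xi> b)) F \<le> op_norm A (mat_op A m) * L2_set (\<lambda>b. cmod (\<xi> b)) F" .
qed



text \<open>The transfer principle for norms: if each finite submatrix of \<open>m\<close> is, up to
  small errors in the entries, a submatrix of \<open>m'\<close> on an injective copy of its index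
  set, then any bound for \<open>m'\<close> holds for \<open>m\<close>. Injectivity preserves the
  norms of vectors under the relabelling.\<close>

lemma mat_norm_le_approx:
  assumes le: "mat_norm_le B m' C"
    and approx: "\<And>F e. finite F \<Longrightarrow> F \<subseteq> A \<Longrightarrow> e > 0 \<Longrightarrow>
      \<exists>\<tau>. inj_on \<tau> F \<and> \<tau> ` F \<subseteq> B \<and> (\<forall>a\<in>F. \<forall>b\<in>F. cmod (m a b - m' (\<tau> a) (\<tau> b)) \<le> e)"
  shows "mat_norm_le A m C"
  unfolding mat_norm_le_def
proof (intro allI impI; elim conjE)
  fix F and \<xi> :: "'b \<Rightarrow> complex" assume F: "finite F" "F \<subseteq> A"
  \<comment> \<open>An error of at most \<open>d\<close> in each entry changes every coordinate of
    the result by at most \<open>d\<close> times the sum of \<open>cmod (\<xi> b)\<close>, hence its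
    L2 norm by at most \<open>d * K\<close>. Dividing by \<open>K + 1\<close> below allows
    \<open>K = 0\<close>.\<close>
  define K where "K = sqrt (card F) * (\<Sum>b\<in>F. cmod (\<xi> b))"
  have K: "K \<ge> 0" by (simp add: K_def sum_nonneg)
  show "L2_set (\<lambda>a. cmod (\<Sum>b\<in>F. m a b * \<xi> b)) F \<le> C * L2_set (\<lambda>b. cmod (\<xi> b)) F"
  proof (rule field_le_epsilon)
    fix e :: real assume e: "e > 0"
    define d where "d = e / (K + 1)"
    have d: "d > 0" "d * K \<le> e" using e K by (auto simp: d_def field_simps)
    obtain \<tau> where \<tau>: "inj_on \<tau> F" "\<tau> ` F \<subseteq> B" "\<And>a b. a \<in> F \<Longrightarrow> b \<in> F \<Longrightarrow> cmod (m a b - m' (\<tau> a) (\<tau> b)) \<le> d"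
      using approx[OF F d(1)] by blast
    define \<eta> where "\<eta> = (\<lambda>t. \<xi> (the_inv_into F \<tau> t))"
    have \<eta>: "\<eta> (\<tau> b) = \<xi> b" if "b \<in> F" for b using that \<tau>(1) by (simp add: \<eta>_def the_inv_into_f_f)
    have 1: "(\<Sum>b\<in>F. m' (\<tau> a) (\<tau> b) * \<xi> b) = (\<Sum>t\<in>\<tau> ` F. m' (\<tau> a) t * \<eta> t)" for a
      by (simp add: sum.reindex[OF \<tau>(1)] \<eta>)
    have "cmod (\<Sum>b\<in>F. m a b * \<xi> b) \<le> cmod (\<Sum>t\<in>\<tau> ` F. m' (\<tau> a) t * \<eta> t) + d * (\<Sum>b\<in>F. cmod (\<xi> b))"
      if a: "a \<in> F" for a
    proof -
      have "(\<Sum>b\<in>F. m a b * \<xi> b) = (\<Sum>b\<in>F. m' (\<tau> a) (\<tau> b) * \<xi> b) + (\<Sum>b\<in>F. (m a b - m' (\<tau> a) (\<tau> b)) * \<xi> b)"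
        by (simp add: sum.distrib[symmetric] algebra_simps)
      then have "cmod (\<Sum>b\<in>F. m a b * \<xi> b) \<le> cmod (\<Sum>b\<in>F. m' (\<tau> a) (\<tau> b) * \<xi> b)
          + cmod (\<Sum>b\<in>F. (m a b - m' (\<tau> a) (\<tau> b)) * \<xi> b)"
        by (simp add: norm_triangle_ineq)
      moreover have "cmod (\<Sum>b\<in>F. (m a b - m' (\<tau> a) (\<tau> b)) * \<xi> b) \<le> (\<Sum>b\<in>F. d * cmod (\<xi> b))"
        by (intro sum_norm_le) (auto simp: norm_mult intro!: mult_right_mono \<tau>(3) a)
      ultimately show ?thesis unfolding 1 by (simp add: sum_distrib_left)
    qed
    then have "L2_set (\<lambda>a. cmod (\<Sum>b\<in>F. m a b * \<xi> b)) F \<le>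
        L2_set (\<lambda>a. cmod (\<Sum>t\<in>\<tau> ` F. m' (\<tau> a) t * \<eta> t) + d * (\<Sum>b\<in>F. cmod (\<xi> b))) F"
      by (intro L2_set_mono) auto
    also have "\<dots> \<le> L2_set (\<lambda>a. cmod (\<Sum>t\<in>\<tau> ` F. m' (\<tau> a) t * \<eta> t)) F + L2_set (\<lambda>a. d * (\<Sum>b\<in>F. cmod (\<xi> b))) F"
      by (rule L2_set_triangle_ineq)
    also have "L2_set (\<lambda>a. d * (\<Sum>b\<in>F. cmod (\<xi> b))) F = d * K"
      using d(1) by (simp add: L2_set_constant K_def sum_nonneg abs_mult)
    also have "L2_set (\<lambda>a. cmod (\<Sum>t\<in>\<tau> ` F. m' (\<tau> a) t * \<eta> t)) F = L2_set (\<lambda>s. cmod (\<Sum>t\<in>\<tau> ` F. m' s t * \<eta> t)) (\<tau> ` F)"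
      by (simp add: L2_set_def sum.reindex[OF \<tau>(1)])
    also have "\<dots> \<le> C * L2_set (\<lambda>t. cmod (\<eta> t)) (\<tau> ` F)"
      using le F \<tau>(2) unfolding mat_norm_le_def by blast
    also have "L2_set (\<lambda>t. cmod (\<eta> t)) (\<tau> ` F) = L2_set (\<lambda>b. cmod (\<xi> b)) F"
      by (simp add: L2_set_def sum.reindex[OF \<tau>(1)] \<eta>)
    finally show "L2_set (\<lambda>a. cmod (\<Sum>b\<in>F. m a b * \<xi> b)) F \<le> C * L2_set (\<lambda>b. cmod (\<xi> b)) F + e"
      using d(2) by simp
  qed
qed

lemma mat_op_add:
  assumes "sparse A N C m" "sparse A N' C' m'"
  shows "mat_op A (\<lambda>a b. m a b + m' a b) = (\<lambda>\<xi> a. mat_op A m \<xi> a + mat_op A m' \<xi> a)"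
proof (intro ext)
  fix \<xi> a
  show "mat_op A (\<lambda>a b. m a b + m' a b) \<xi> a = mat_op A m \<xi> a + mat_op A m' \<xi> a"
  proof (cases "\<xi> \<in> ell2 A \<and> a \<in> A")
    case True
    let ?F = "{b\<in>A. m a b \<noteq> 0} \<union> {b\<in>A. m' a b \<noteq> 0}"
    have F: "finite ?F" "?F \<subseteq> A" using assms True by (auto simp: sparse_row)
    have "mat_op A m'' \<xi> a = (\<Sum>b\<in>?F. m'' a b * \<xi> b)"
      if "\<And>b. b \<in> A \<Longrightarrow> m'' a b \<noteq> 0 \<Longrightarrow> b \<in> ?F" for m''
      using mat_op_finite[OF conjunct1[OF True] conjunct2[OF True] F] that by blast
    from this[of m] this[of m'] this[of "\<lambda>a b. m a b + m' a b"] show ?thesis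
      by (force simp: sum.distrib algebra_simps)
  qed (auto simp: mat_op_def)
qed

lemma mat_op_scale: "mat_op A (\<lambda>a b. c * m a b) = (\<lambda>\<xi> a. c * mat_op A m \<xi> a)"
  by (auto simp: mat_op_def fun_eq_iff mult.assoc infsum_cmult_right')

lemma mat_op_comp:
  assumes m: "sparse A N C m" and m': "sparse A N' C' m'" and C': "0 \<le> C'"
    and eq: "\<And>a c. a \<in> A \<Longrightarrow> c \<in> A \<Longrightarrow> m'' a c = (\<Sum>\<^sub>\<infinity>b\<in>A. m a b * m' b c)"
  shows "mat_op A m \<circ> mat_op A m' = mat_op A m''"
proof (intro ext)
  fix \<xi> a
  show "(mat_op A m \<circ> mat_op A m') \<xi> a = mat_op A m'' \<xi> a"
  proof (cases "\<xi> \<in> ell2 A \<and> a \<in> A")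
    case True
    then have \<xi>: "\<xi> \<in> ell2 A" and a: "a \<in> A" by auto
    \<comment> \<open>\<open>R\<close> is the support of row \<open>a\<close> of \<open>m\<close>,
      and \<open>Q\<close> contains the supports of all rows of \<open>m'\<close> indexed by
      \<open>R\<close>; all sums reduce to these finite sets, and the product row vanishes off
      \<open>Q\<close>.\<close>
    define R where "R = {b\<in>A. m a b \<noteq> 0}"
    define Q where "Q = (\<Union>b\<in>R. {c\<in>A. m' b c \<noteq> 0})"
    have R: "finite R" "R \<subseteq> A" using sparse_row[OF m a] by (auto simp: R_def)
    have Q: "finite Q" "Q \<subseteq> A" using R sparse_row[OF m'] by (auto simp: Q_def)
    have mm: "m'' a c = (\<Sum>b\<in>R. m a b * m' b c)" if "c \<in> A" for c
      unfolding eq[OF a that] by (rule infsum_finite_support[OF R]) (auto simp: R_def)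
    have "(mat_op A m \<circ> mat_op A m') \<xi> a = (\<Sum>b\<in>R. m a b * mat_op A m' \<xi> b)"
      unfolding o_def by (rule mat_op_finite[OF _ a R])
        (auto simp: R_def intro: bounded_ops_in[OF sparse_bounded(1)[OF m' C']])
    also have "\<dots> = (\<Sum>b\<in>R. m a b * (\<Sum>c\<in>Q. m' b c * \<xi> c))"
      using R by (intro sum.cong refl arg_cong2[of _ _ _ _ "(*)"] mat_op_finite[OF \<xi> _ Q]) (auto simp: Q_def)
    also have "\<dots> = (\<Sum>c\<in>Q. \<Sum>b\<in>R. m a b * m' b c * \<xi> c)"
      by (subst sum.swap) (simp add: sum_distrib_left mult.assoc)
    also have "\<dots> = (\<Sum>c\<in>Q. m'' a c * \<xi> c)"
      using Q by (intro sum.cong refl) (auto simp: mm sum_distrib_right)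
    also have "\<dots> = mat_op A m'' \<xi> a"
    proof (rule mat_op_finite[OF \<xi> a Q, symmetric])
      fix c assume "c \<in> A" "m'' a c \<noteq> 0"
      then have "(\<Sum>b\<in>R. m a b * m' b c) \<noteq> 0" by (simp add: mm)
      then obtain b where "b \<in> R" "m a b * m' b c \<noteq> 0" by (meson sum.neutral)
      then show "c \<in> Q" using \<open>c \<in> A\<close> by (auto simp: Q_def)
    qed
    finally show ?thesis .
  next
    case False
    then consider "a \<notin> A" | "\<xi> \<notin> ell2 A" by blast
    then show ?thesis
    proof cases
      case 2
      then have "mat_op A m' \<xi> = (\<lambda>a. 0)" by (auto simp: mat_op_def)
      then show ?thesis using 2 by (simp add: mat_op_def)
    qed (simp add: mat_op_def)
  qed
qed

text \<open>The identity is an exchange of two infinite sums. It requires absolute summability over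
  \<open>A \<times> A\<close>, which holds because each column and each row has at most
  \<open>N\<close> entries.\<close>

lemma adjoint_pair_mat_op:
  assumes m: "sparse A N C m" and C: "0 \<le> C"
  shows "adjoint_pair A (mat_op A m) (mat_op A (\<lambda>a b. cnj (m b a)))"
  unfolding adjoint_pair_def
proof (intro conjI ballI)
  have m': "sparse A N C (\<lambda>a b. cnj (m b a))" using m by (auto simp: sparse_def)
  show "mat_op A m \<in> bounded_ops A" by (rule sparse_bounded[OF m C])
  show "mat_op A (\<lambda>a b. cnj (m b a)) \<in> bounded_ops A" by (rule sparse_bounded[OF m' C])
  fix \<xi> \<eta> assume \<xi>: "\<xi> \<in> ell2 A" and \<eta>: "\<eta> \<in> ell2 A"
  let ?f = "\<lambda>(a, b). m a b * \<xi> b * cnj (\<eta> a)"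
  have *: "(\<Sum>b\<in>F2. \<Sum>a\<in>F1. C * (cmod (z b))\<^sup>2 * (if m'' a b \<noteq> 0 then 1 else 0)) \<le> C * N * (ell2_norm A z)\<^sup>2"
    if "z \<in> ell2 A" "finite F1" "finite F2" "F1 \<subseteq> A" "F2 \<subseteq> A" "sparse A N C m''" for F1 F2 z and m'' :: "'a \<Rightarrow> 'a \<Rightarrow> complex"
  proof -
    have "(\<Sum>b\<in>F2. \<Sum>a\<in>F1. C * (cmod (z b))\<^sup>2 * (if m'' a b \<noteq> 0 then 1 else 0)) = (\<Sum>b\<in>F2. C * (cmod (z b))\<^sup>2 * card {a\<in>F1. m'' a b \<noteq> 0})"
      using that by (simp add: sum_distrib_left[symmetric] sum.If_cases Int_def)
    also have "\<dots> \<le> (\<Sum>b\<in>F2. C * (cmod (z b))\<^sup>2 * N)"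
    proof (intro sum_mono mult_left_mono)
      fix b assume "b \<in> F2"
      then have "card {a\<in>F1. m'' a b \<noteq> 0} \<le> card {a\<in>A. m'' a b \<noteq> 0}" "card {a\<in>A. m'' a b \<noteq> 0} \<le> N"
        using that by (auto simp: sparse_def intro!: card_mono)
      then show "real (card {a\<in>F1. m'' a b \<noteq> 0}) \<le> real N" by linarith
    qed (use C in auto)
    also have "\<dots> = C * N * (\<Sum>b\<in>F2. (cmod (z b))\<^sup>2)" by (simp add: sum_distrib_left mult_ac)
    also have "\<dots> \<le> C * N * (ell2_norm A z)\<^sup>2"
    proof (rule mult_left_mono)
      have "sqrt (\<Sum>b\<in>F2. (cmod (z b))\<^sup>2) \<le> ell2_norm A z"
        using L2_set_le_ell2_norm[OF that(1,3,5)] by (simp add: L2_set_def)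
      then show "(\<Sum>b\<in>F2. (cmod (z b))\<^sup>2) \<le> (ell2_norm A z)\<^sup>2" by (rule sqrt_le_D)
    qed (use C in auto)
    finally show ?thesis .
  qed
  let ?M = "C * N * (ell2_norm A \<xi>)\<^sup>2 + C * N * (ell2_norm A \<eta>)\<^sup>2"
  have "(\<lambda>p. norm (?f p)) summable_on A \<times> A"
  proof (rule nonneg_bdd_above_summable_on)
    show "bdd_above (sum (\<lambda>p. norm (?f p)) ` {F. F \<subseteq> A \<times> A \<and> finite F})"
    proof (rule bdd_aboveI2[where M = ?M])
      fix F assume "F \<in> {F. F \<subseteq> A \<times> A \<and> finite F}"
      then have F: "F \<subseteq> A \<times> A" "finite F" by auto
      define F1 F2 where "F1 = fst ` F" and "F2 = snd ` F"
      have F12: "finite F1" "finite F2" "F1 \<subseteq> A" "F2 \<subseteq> A" "F \<subseteq> F1 \<times> F2"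
        using F by (auto simp: F1_def F2_def intro: rev_image_eqI)
      have "(\<Sum>p\<in>F. norm (?f p)) \<le> (\<Sum>p\<in>F1 \<times> F2. norm (?f p))"
        using F12 by (intro sum_mono2) auto
      also have "\<dots> = (\<Sum>a\<in>F1. \<Sum>b\<in>F2. norm (?f (a, b)))"
        by (simp add: sum.cartesian_product case_prod_unfold)
      also have "\<dots> \<le> (\<Sum>a\<in>F1. \<Sum>b\<in>F2. C * (cmod (\<xi> b))\<^sup>2 * (if m a b \<noteq> 0 then 1 else 0)
          + C * (cmod (\<eta> a))\<^sup>2 * (if cnj (m a b) \<noteq> 0 then 1 else 0))"
      proof (intro sum_mono)
        fix a b assume ab: "a \<in> F1" "b \<in> F2"
        \<comment> \<open>The product is dominated by a sum of squares in order to separate the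
          variables: the square in \<open>b\<close> is then counted along columns, that in
          \<open>a\<close> along rows.\<close>
        have "2 * (cmod (\<xi> b) * cmod (\<eta> a)) \<le> (cmod (\<xi> b))\<^sup>2 + (cmod (\<eta> a))\<^sup>2"
          using sum_squares_bound[of "cmod (\<xi> b)" "cmod (\<eta> a)"] by (simp add: mult.assoc)
        moreover have "0 \<le> cmod (\<xi> b) * cmod (\<eta> a)" by simp
        ultimately have x: "cmod (\<xi> b) * cmod (\<eta> a) \<le> (cmod (\<xi> b))\<^sup>2 + (cmod (\<eta> a))\<^sup>2" by linarith
        have "cmod (m a b) \<le> C" using m ab F12 by (auto intro: sparse_entry[OF m])
        then have "cmod (m a b) * (cmod (\<xi> b) * cmod (\<eta> a)) \<le> C * ((cmod (\<xi> b))\<^sup>2 + (cmod (\<eta> a))\<^sup>2)"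
          using x C by (intro mult_mono) auto
        then show "norm (?f (a, b)) \<le> C * (cmod (\<xi> b))\<^sup>2 * (if m a b \<noteq> 0 then 1 else 0)
          + C * (cmod (\<eta> a))\<^sup>2 * (if cnj (m a b) \<noteq> 0 then 1 else 0)"
          by (auto simp: norm_mult algebra_simps)
      qed
      also have "\<dots> = (\<Sum>b\<in>F2. \<Sum>a\<in>F1. C * (cmod (\<xi> b))\<^sup>2 * (if m a b \<noteq> 0 then 1 else 0))
          + (\<Sum>a\<in>F1. \<Sum>b\<in>F2. C * (cmod (\<eta> a))\<^sup>2 * (if cnj (m a b) \<noteq> 0 then 1 else 0))"
        unfolding sum.distrib by (subst sum.swap) simp
      also have "\<dots> \<le> ?M"
        using *[OF \<xi> F12(1,2,3,4) m] *[OF \<eta> F12(2,1,4,3) m'] by (intro add_mono) auto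
      finally show "(\<Sum>p\<in>F. norm (?f p)) \<le> ?M" .
    qed
  qed auto
  then have s: "?f summable_on A \<times> A" by (rule abs_summable_summable)
  have "ell2_inner A (mat_op A m \<xi>) \<eta> = (\<Sum>\<^sub>\<infinity>a\<in>A. \<Sum>\<^sub>\<infinity>b\<in>A. m a b * \<xi> b * cnj (\<eta> a))"
    unfolding ell2_inner_def using \<xi> by (intro infsum_cong) (simp add: mat_op_def infsum_cmult_left')
  also have "\<dots> = (\<Sum>\<^sub>\<infinity>b\<in>A. \<Sum>\<^sub>\<infinity>a\<in>A. m a b * \<xi> b * cnj (\<eta> a))"
    by (rule infsum_swap_banach) (use s in simp)
  also have "\<dots> = ell2_inner A \<xi> (mat_op A (\<lambda>a b. cnj (m b a)) \<eta>)"
    unfolding ell2_inner_def using \<eta>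
    by (intro infsum_cong) (simp add: mat_op_def infsum_cmult_right'[symmetric] mult_ac flip: infsum_cnj)
  finally show "ell2_inner A (mat_op A m \<xi>) \<eta> = ell2_inner A \<xi> (mat_op A (\<lambda>a b. cnj (m b a)) \<eta>)" .
qed

section \<open>The left inverse hull\<close>

lemma left_hull_inj:
  "g \<in> left_hull \<Longrightarrow> g x = Some z \<Longrightarrow> g y = Some z \<Longrightarrow> x = y"
proof (induction arbitrary: x y z rule: left_hull.induct)
  case (inverse g)
  \<comment> \<open>The description inside \<open>pinverse\<close> denotes a preimage only because
    preimages are unique, which is the induction hypothesis.\<close>
  have "g w = Some v" if "pinverse g v = Some w" for v w
  proof -
    from that have v: "v \<in> ran g" and w: "w = (THE x. g x = Some v)"
      by (auto simp: pinverse_def split: if_splits)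
    from v obtain u where u: "g u = Some v" by (auto simp: ran_def)
    then have "(THE x. g x = Some v) = u" using inverse.IH by blast
    with u w show ?thesis by simp
  qed
  from this[OF inverse.prems(1)] this[OF inverse.prems(2)] show ?case by simp
next
  case (ltrans s)
  then have "s * x = s * y" by (simp add: ltrans_def)
  then show ?case by (rule left_cancel)
next
  case (comp g h)
  then show ?case by (auto simp: map_comp_def split: option.splits)
qed

lemma pinverse_iff:
  assumes "g \<in> left_hull"
  shows "pinverse g y = Some x \<longleftrightarrow> g x = Some y"
proof -
  have *: "(THE x. g x = Some y) = u" if "g u = Some y" for u
    using left_hull_inj[OF assms] that by blast
  show ?thesis
  proof (cases "y \<in> ran g")
    case True
    then obtain u where "g u = Some y" by (auto simp: ran_def)
    with *[OF this] True left_hull_inj[OF assms] show ?thesis by (auto simp: pinverse_def)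
  next
    case False
    then show ?thesis by (auto simp: pinverse_def ran_def)
  qed
qed

lemma map_eqI: "(\<And>x y. f x = Some y \<longleftrightarrow> g x = Some y) \<Longrightarrow> f = g"
  by (rule ext) (metis option.exhaust)

lemma map_comp_iff: "(g \<circ>\<^sub>m h) x = Some z \<longleftrightarrow> (\<exists>y. h x = Some y \<and> g y = Some z)"
  by (auto simp: map_comp_def split: option.splits)

lemma pid_iff: "pid X x = Some y \<longleftrightarrow> x \<in> X \<and> y = x"
  by (auto simp: pid_def restrict_map_def)

lemma dom_pid [simp]: "dom (pid X) = X"
  by (auto simp: pid_def restrict_map_def split: if_splits)

lemma pid_inj [simp]: "pid X = pid Y \<longleftrightarrow> X = Y"
  by (metis dom_pid)

lemma pid_comp_pid: "pid X \<circ>\<^sub>m pid Y = pid (X \<inter> Y)"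
  by (rule map_eqI) (auto simp: map_comp_iff pid_iff)

lemma pid_UNIV_comp [simp]: "pid UNIV \<circ>\<^sub>m g = g" "g \<circ>\<^sub>m pid UNIV = g"
  by (rule map_eqI; simp add: map_comp_iff pid_iff)+

lemma map_comp_assoc: "(f \<circ>\<^sub>m g) \<circ>\<^sub>m h = f \<circ>\<^sub>m (g \<circ>\<^sub>m h)"
  by (rule map_eqI) (auto simp: map_comp_iff)

lemma pinverse_comp_self: "g \<in> left_hull \<Longrightarrow> pinverse g \<circ>\<^sub>m g = pid (dom g)"
  by (rule map_eqI) (simp add: map_comp_iff pid_iff pinverse_iff dom_def, metis left_hull_inj)

lemma pinverse_comp:
  "g \<in> left_hull \<Longrightarrow> h \<in> left_hull \<Longrightarrow> pinverse (g \<circ>\<^sub>m h) = pinverse h \<circ>\<^sub>m pinverse g"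
  by (rule map_eqI) (auto simp: map_comp_iff pinverse_iff left_hull.comp)

lemma pinverse_pinverse: "g \<in> left_hull \<Longrightarrow> pinverse (pinverse g) = g"
  by (rule map_eqI) (auto simp: pinverse_iff left_hull.inverse)

lemma pid_UNIV_eq: "pid UNIV = ltrans 1"
  by (rule map_eqI) (auto simp: pid_iff ltrans_def)

lemma pid_UNIV_left_hull [simp]: "pid UNIV \<in> left_hull"
  by (simp add: pid_UNIV_eq left_hull.ltrans)

lemma pinverse_pid_UNIV [simp]:
  "pinverse (pid UNIV) = (pid UNIV :: 'a::left_cancellative_monoid \<rightharpoonup> 'a)"
  using pinverse_comp_self[OF pid_UNIV_left_hull] by simp

text \<open>Left translations commute with right multiplication, and this survives inverses and
  products. Consequently an element of the hull is determined on a principal right ideal by its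
  value at the generator.\<close>

lemma left_hull_mult: "g \<in> left_hull \<Longrightarrow> g x = Some y \<Longrightarrow> g (x * u) = Some (y * u)"
  by (induction arbitrary: x y rule: left_hull.induct)
    (auto simp: ltrans_def mult.assoc pinverse_iff map_comp_iff)

section \<open>Constructible ideals as preimages and as domains of idempotents\<close>

definition preimg :: "('a \<rightharpoonup> 'a) \<Rightarrow> 'a set \<Rightarrow> 'a set" where
  "preimg g X = {x. \<exists>y\<in>X. g x = Some y}"

lemma preimg_comp: "preimg (g \<circ>\<^sub>m h) X = preimg h (preimg g X)"
  by (auto simp: preimg_def map_comp_iff)

text \<open>\<open>g\<close> and its inverse are treated together because the inversion rule swaps
  them. For a translation the rule \<open>constructible.step\<close> with one of its two factors
  equal to 1 gives preimage and image.\<close>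

lemma preimg_constructible_both:
  assumes "g \<in> left_hull"
  shows "X \<in> constructible \<Longrightarrow> preimg g X \<in> constructible \<and> preimg (pinverse g) X \<in> constructible"
  using assms
proof (induction arbitrary: X rule: left_hull.induct)
  case (ltrans s)
  have "preimg (ltrans s) X = {u. \<exists>x\<in>X. s * u = 1 * x}" by (auto simp: preimg_def ltrans_def)
  moreover have "preimg (pinverse (ltrans s)) X = {u. \<exists>x\<in>X. 1 * u = s * x}"
    by (auto simp: preimg_def pinverse_iff[OF left_hull.ltrans]) (auto simp: ltrans_def)
  ultimately show ?case
    using constructible.step[OF ltrans, of s 1] constructible.step[OF ltrans, of 1 s] by (simp only:)
next
  case (inverse g)
  then show ?case by (simp add: pinverse_pinverse)
next
  case (comp g h)
  then show ?case by (simp add: preimg_comp pinverse_comp)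
qed

lemma preimg_constructible [intro]: "g \<in> left_hull \<Longrightarrow> X \<in> constructible \<Longrightarrow> preimg g X \<in> constructible"
  using preimg_constructible_both by blast

lemma dom_eq_preimg: "dom g = preimg g UNIV"
  by (auto simp: preimg_def)

lemma dom_constructible [intro]: "g \<in> left_hull \<Longrightarrow> dom g \<in> constructible"
  unfolding dom_eq_preimg by (intro preimg_constructible constructible.whole)

lemma pid_left_hull: "X \<in> constructible \<Longrightarrow> pid X \<in> left_hull"
proof (induction rule: constructible.induct)
  case (step X s t)
  \<comment> \<open>This is s^{-1} t p_X, whose range is s^{-1}tX; the product with its inverse is
    the identity on the range.\<close>
  let ?g = "pinverse (ltrans s) \<circ>\<^sub>m (ltrans t \<circ>\<^sub>m pid X)"
  have g: "?g \<in> left_hull" using step by (intro left_hull.intros)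
  have "?g \<circ>\<^sub>m pinverse ?g = pid {u. \<exists>x\<in>X. s * u = t * x}"
  proof (rule map_eqI)
    fix x y
    show "(?g \<circ>\<^sub>m pinverse ?g) x = Some y \<longleftrightarrow> pid {u. \<exists>x\<in>X. s * u = t * x} x = Some y"
      unfolding map_comp_iff pinverse_iff[OF g] pid_iff pinverse_iff[OF left_hull.ltrans]
      by (auto simp: ltrans_def) (metis left_cancel)
  qed
  then show ?case using g left_hull.intros(2,3) by metis
qed simp

text \<open>The rules for \<open>constructible\<close> do not form intersections. The intersection
  appears as the domain of the product of two idempotents, and domains of hull elements are
  constructible.\<close>

lemma constructible_Int:
  assumes "X \<in> constructible" "Y \<in> constructible"
  shows "X \<inter> Y \<in> constructible"
  using dom_constructible[OF left_hull.comp[OF pid_left_hull[OF assms(1)] pid_left_hull[OF assms(2)]]]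
  by (simp add: pid_comp_pid)

lemma idems_eq: "idems = pid ` constructible"
proof (intro equalityI subsetI)
  fix p :: "'a \<rightharpoonup> 'a" assume "p \<in> idems"
  then have p: "p \<in> left_hull" "p \<circ>\<^sub>m p = p" by (auto simp: idems_def)
  \<comment> \<open>If p x = z, idempotence gives p z = z, and injectivity then forces z =
    x.\<close>
  have "p = pid (dom p)"
  proof (rule map_eqI)
    fix x y
    have "z = x" if z: "p x = Some z" for z
    proof -
      have "(p \<circ>\<^sub>m p) x = Some z" using p(2) z by simp
      then have "p z = Some z" using z by (auto simp: map_comp_iff)
      then show ?thesis using left_hull_inj[OF p(1) z] by simp
    qed
    then show "p x = Some y \<longleftrightarrow> pid (dom p) x = Some y" by (auto simp: pid_iff)
  qed
  then show "p \<in> pid ` constructible" using dom_constructible[OF p(1)] by blast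
qed (auto simp: idems_def pid_left_hull pid_comp_pid)

lemma pid_idem: "X \<in> constructible \<Longrightarrow> pid X \<in> idems"
  by (simp add: idems_eq)

lemma conj_pid: "g \<in> left_hull \<Longrightarrow> pinverse g \<circ>\<^sub>m pid X \<circ>\<^sub>m g = pid (preimg g X)"
  by (rule map_eqI) (simp add: map_comp_iff pid_iff pinverse_iff preimg_def, metis left_hull_inj)

section \<open>Semi-characters\<close>

lemma semichars_pid_Int:
  assumes "\<omega> \<in> semichars" "X \<in> constructible" "Y \<in> constructible"
  shows "\<omega> (pid (X \<inter> Y)) \<longleftrightarrow> \<omega> (pid X) \<and> \<omega> (pid Y)"
proof -
  have "\<forall>p\<in>idems. \<forall>q\<in>idems. \<omega> (p \<circ>\<^sub>m q) = (\<omega> p \<and> \<omega> q)" using assms(1) by (simp add: semichars_def)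
  then show ?thesis using pid_idem[OF assms(2)] pid_idem[OF assms(3)] by (metis pid_comp_pid)
qed

text \<open>If a multiplicative map is 1 at some \<open>p\<close>, it is 1 at the unit, because
  \<open>p\<close> is \<open>p\<close> times the unit. This replaces an existential statement by a
  condition on one coordinate, which is closed.\<close>

lemma semichars_eq:
  "semichars = {\<omega>. (\<forall>p. p \<notin> idems \<longrightarrow> \<not> \<omega> p) \<and> \<omega> (pid UNIV) \<and>
     (\<forall>p\<in>idems. \<forall>q\<in>idems. \<omega> (p \<circ>\<^sub>m q) = (\<omega> p \<and> \<omega> q))}"
proof -
  have U: "pid UNIV \<in> idems" by (simp add: idems_eq constructible.whole)
  have "\<omega> (pid UNIV)" if "\<forall>p\<in>idems. \<forall>q\<in>idems. \<omega> (p \<circ>\<^sub>m q) = (\<omega> p \<and> \<omega> q)" "p \<in> idems" "\<omega> p" for p \<omega>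
    using that U by (metis pid_UNIV_comp(1))
  then show ?thesis using U unfolding semichars_def by blast
qed

lemma point_char_pid: "X \<in> constructible \<Longrightarrow> point_char s (pid X) \<longleftrightarrow> s \<in> X"
  by (auto simp: point_char_def)

lemma point_char_semichars: "point_char (s::'a::left_cancellative_monoid) \<in> semichars"
proof -
  have "\<not> point_char s p" if "p \<notin> idems" for p :: "'a \<rightharpoonup> 'a"
    using that by (auto simp: point_char_def idems_eq)
  moreover have "point_char s (p \<circ>\<^sub>m q) = (point_char s p \<and> point_char s q)"
    if pq: "p \<in> idems" "q \<in> idems" for p q :: "'a \<rightharpoonup> 'a"
  proof -
    obtain X Y where "X \<in> constructible" "Y \<in> constructible" "p = pid X" "q = pid Y"
      using pq unfolding idems_eq by blast
    then show ?thesis by (simp add: pid_comp_pid constructible_Int point_char_pid)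
  qed
  moreover have "point_char s (pid UNIV)" by (simp add: point_char_pid constructible.whole)
  ultimately show ?thesis by (simp add: semichars_eq)
qed

lemma open_eval: "open {\<omega> :: 'b \<Rightarrow> bool. \<omega> p}" "open {\<omega> :: 'b \<Rightarrow> bool. \<not> \<omega> p}"
proof -
  have c: "continuous_on UNIV (\<lambda>\<omega> :: 'b \<Rightarrow> bool. \<omega> p)" by simp
  show "open {\<omega> :: 'b \<Rightarrow> bool. \<omega> p}"
    using open_vimage[OF _ c, of "{True}"] by (simp add: vimage_def open_discrete)
  show "open {\<omega> :: 'b \<Rightarrow> bool. \<not> \<omega> p}"
    using open_vimage[OF _ c, of "{False}"] by (simp add: vimage_def open_discrete)
qed

lemma closed_eval: "closed {\<omega> :: 'b \<Rightarrow> bool. \<omega> p}" "closed {\<omega> :: 'b \<Rightarrow> bool. \<not> \<omega> p}"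
  using open_eval[of p] by (auto simp: closed_def Compl_eq)

lemma closed_semichars: "closed semichars"
proof -
  have "{\<omega> :: 'a semichar. \<omega> p = (\<omega> q \<and> \<omega> r)} =
      ({\<omega>. \<omega> p} \<inter> {\<omega>. \<omega> q} \<inter> {\<omega>. \<omega> r}) \<union> ({\<omega>. \<not> \<omega> p} \<inter> ({\<omega>. \<not> \<omega> q} \<union> {\<omega>. \<not> \<omega> r}))" for p q r
    by auto
  then have c: "closed {\<omega> :: 'a semichar. \<omega> p = (\<omega> q \<and> \<omega> r)}" for p q r
    by (auto intro!: closed_eval)
  have "semichars = (\<Inter>p\<in>-idems. {\<omega> :: 'a semichar. \<not> \<omega> p}) \<inter> {\<omega>. \<omega> (pid UNIV)} \<inter>
      (\<Inter>p\<in>idems. \<Inter>q\<in>idems. {\<omega>. \<omega> (p \<circ>\<^sub>m q) = (\<omega> p \<and> \<omega> q)})"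
    by (auto simp: semichars_eq)
  also have "closed \<dots>" by (intro closed_Int closed_INT ballI closed_eval c)
  finally show ?thesis .
qed

section \<open>The compact space of characters approximated by points\<close>

lemma euclidean_closure_of: "euclidean closure_of S = closure S"
proof (rule equalityI)
  show "euclidean closure_of S \<subseteq> closure S"
    by (rule closure_of_minimal[OF closure_subset]) (simp flip: closed_closedin)
  have "closed (euclidean closure_of S)" unfolding closed_closedin by (rule closedin_closure_of)
  then show "closure S \<subseteq> euclidean closure_of S"
    by (intro closure_minimal closure_of_subset) auto
qed

text \<open>Since \<open>semichars\<close> is closed in the full function space, the closure
  relative to it is the absolute closure; Tychonoff's theorem then makes \<open>Omega\<close>
  compact.\<close>

lemma Omega_eq: "Omega = closure (range point_char)"
proof -
  have "range point_char \<subseteq> (semichars :: 'a semichar set)" using point_char_semichars by auto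
  then have "semichars \<inter> range point_char = range (point_char :: 'a \<Rightarrow> _)"
    and "semichars \<inter> closure (range point_char) = closure (range (point_char :: 'a \<Rightarrow> _))"
    by (simp_all add: inf.absorb2 closure_minimal closed_semichars)
  then show ?thesis
    unfolding Omega_def semichar_topology_def closure_of_subtopology[of euclidean]
    by (metis euclidean_closure_of)
qed

lemma Omega_subset: "Omega \<subseteq> semichars"
  unfolding Omega_eq by (intro closure_minimal closed_semichars image_subsetI point_char_semichars)

lemma point_char_Omega [simp]: "point_char s \<in> Omega"
  unfolding Omega_eq by (rule subsetD[OF closure_subset]) simp

lemma compact_Omega: "compact Omega"
proof -
  have "compact_space (euclidean :: bool topology)"
    by (simp add: compact_space_def finite_imp_compact)
  then have "compact_space (product_topology (\<lambda>i::'a \<rightharpoonup> 'a. euclidean :: bool topology) UNIV)"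
    by (simp add: compact_space_product_topology)
  then have "compact (UNIV :: 'a semichar set)"
    by (simp add: compact_space_def euclidean_product_topology)
  from compact_Int_closed[OF this closed_closure[of "range point_char"]] show ?thesis by (simp only: Omega_eq Int_UNIV_left)
qed

lemma Omega_pid_Int:
  assumes "\<omega> \<in> Omega" "X \<in> constructible" "Y \<in> constructible"
  shows "\<omega> (pid (X \<inter> Y)) \<longleftrightarrow> \<omega> (pid X) \<and> \<omega> (pid Y)"
  by (rule semichars_pid_Int[OF subsetD[OF Omega_subset assms(1)] assms(2,3)])

lemma Omega_UNIV [simp]: "\<omega> \<in> Omega \<Longrightarrow> \<omega> (pid UNIV)"
  using subsetD[OF Omega_subset, of \<omega>] by (simp add: semichars_eq)

lemma Omega_idem: "\<omega> \<in> Omega \<Longrightarrow> \<omega> p \<Longrightarrow> \<exists>X\<in>constructible. p = pid X"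
proof -
  assume "\<omega> \<in> Omega" "\<omega> p"
  then have "p \<in> idems" using Omega_subset unfolding semichars_def by blast
  then show ?thesis by (auto simp: idems_eq)
qed

text \<open>All information at \<open>\<omega>\<close> is read off from the following filter on \<open>S\<close>: \<open>\<omega>(p\<^sub>X) = 1\<close> means that
  eventually \<open>s \<in> X\<close>, and two partial bijections have the same class in \<open>\<G>(S)\<close> at \<open>\<omega>\<close> if and only if
  they agree eventually.\<close>

definition near :: "'a::left_cancellative_monoid semichar \<Rightarrow> 'a filter" where
  "near \<omega> = filtercomap point_char (nhds \<omega>)"

lemma near_open: "open U \<Longrightarrow> \<omega> \<in> U \<Longrightarrow> \<forall>\<^sub>F s in near \<omega>. point_char s \<in> U"
  by (auto simp: near_def eventually_filtercomap eventually_nhds)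

text \<open>Properness of the filter is the density of the point characters in
  \<open>Omega\<close>.\<close>

lemma near_neq_bot: "\<omega> \<in> Omega \<Longrightarrow> near \<omega> \<noteq> bot"
  unfolding near_def
proof (rule filtercomap_neq_bot)
  fix P assume "\<omega> \<in> Omega" "eventually P (nhds \<omega>)"
  then obtain U where "open U" "\<omega> \<in> U" "\<forall>x\<in>U. P x" by (auto simp: eventually_nhds)
  moreover from this \<open>\<omega> \<in> Omega\<close> have "U \<inter> range point_char \<noteq> {}"
    unfolding Omega_eq using open_Int_closure_eq_empty[of U "range point_char"] by blast
  ultimately show "\<exists>x. P (point_char x)" by blast
qed

lemma fun_basis:
  fixes U :: "('b \<Rightarrow> bool) set"
  assumes "open U" "\<omega> \<in> U"
  shows "\<exists>I. finite I \<and> (\<forall>\<omega>'. (\<forall>i\<in>I. \<omega>' i = \<omega> i) \<longrightarrow> \<omega>' \<in> U)"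
proof -
  have "openin (product_topology (\<lambda>i. euclidean) UNIV) U"
    using assms(1) by (simp add: euclidean_product_topology)
  then obtain X where X: "\<omega> \<in> (\<Pi>\<^sub>E i\<in>UNIV. X i)" "finite {i. X i \<noteq> topspace (euclidean :: bool topology)}"
      "(\<Pi>\<^sub>E i\<in>UNIV. X i) \<subseteq> U"
    using product_topology_open_contains_basis[OF _ assms(2)] by blast
  show ?thesis
  proof (intro exI conjI allI impI)
    fix \<omega>' assume a: "\<forall>i\<in>{i. X i \<noteq> topspace (euclidean :: bool topology)}. \<omega>' i = \<omega> i"
    have "\<omega>' i \<in> X i" for i
    proof (cases "X i = UNIV")
      case False
      then have "\<omega>' i = \<omega> i" using a by auto
      then show ?thesis using X(1) by (auto simp: PiE_iff)
    qed auto
    then show "\<omega>' \<in> U" using X(3) by auto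
  qed (rule X(2))
qed

text \<open>A basic neighbourhood of \<open>\<omega>\<close> prescribes finitely many coordinates.
  Ideals with value 1 can be intersected to the single ideal \<open>X\<close>, those with value 0
  are collected in \<open>F\<close>, and coordinates that are not idempotents are constant on
  \<open>Omega\<close>.\<close>

lemma eventually_near_iff:
  assumes \<omega>: "\<omega> \<in> Omega"
  shows "eventually P (near \<omega>) \<longleftrightarrow> (\<exists>X F. X \<in> constructible \<and> finite F \<and> F \<subseteq> constructible \<and>
    \<omega> (pid X) \<and> (\<forall>Z\<in>F. \<not> \<omega> (pid Z)) \<and> (\<forall>s\<in>X - \<Union>F. P s))" (is "_ = ?R")
proof
  assume "eventually P (near \<omega>)"
  then obtain U where U: "open U" "\<omega> \<in> U" "\<And>s. point_char s \<in> U \<Longrightarrow> P s"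
    by (auto simp: near_def eventually_filtercomap eventually_nhds)
  obtain I where I: "finite I" "\<And>\<omega>'. (\<forall>i\<in>I. \<omega>' i = \<omega> i) \<Longrightarrow> \<omega>' \<in> U" using fun_basis[OF U(1,2)] by blast
  define K where "K = {Z \<in> constructible. pid Z \<in> I}"
  have finK: "finite K" by (rule finite_imageD[of pid]) (auto simp: K_def inj_on_def intro: finite_subset[OF _ I(1)])
  define X where "X = \<Inter>{Z\<in>K. \<omega> (pid Z)}"
  have "\<Inter>Q \<in> constructible \<and> \<omega> (pid (\<Inter>Q))" if "finite Q" "Q \<subseteq> {Z\<in>K. \<omega> (pid Z)}" for Q
    using that
  proof (induction rule: finite_induct)
    case empty
    show ?case using \<omega> by (simp add: constructible.whole)
  next
    case (insert Z Q)
    then show ?case using Omega_pid_Int[OF \<omega>] by (auto simp: K_def constructible_Int)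
  qed
  then have X: "X \<in> constructible" "\<omega> (pid X)" using finK by (auto simp: X_def)
  have "P s" if s: "s \<in> X - \<Union>{Z\<in>K. \<not> \<omega> (pid Z)}" for s
  proof (rule U(3), rule I(2), rule ballI)
    fix i assume i: "i \<in> I"
    show "point_char s i = \<omega> i"
    proof (cases "i \<in> idems")
      case True
      then obtain Z where "Z \<in> constructible" "i = pid Z" by (auto simp: idems_eq)
      with i s show ?thesis by (auto simp: X_def K_def point_char_pid)
    next
      case False
      then show ?thesis using Omega_idem[OF \<omega>] Omega_idem[OF point_char_Omega] by (metis pid_idem)
    qed
  qed
  moreover have "finite {Z\<in>K. \<not> \<omega> (pid Z)}" "{Z\<in>K. \<not> \<omega> (pid Z)} \<subseteq> constructible"
    by (auto simp: K_def intro: finite_subset[OF _ finK[unfolded K_def]])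
  ultimately show ?R using X by blast
next
  assume ?R
  then obtain X F where XF: "X \<in> constructible" "finite F" "F \<subseteq> constructible" "\<omega> (pid X)"
    "\<forall>Z\<in>F. \<not> \<omega> (pid Z)" "\<forall>s\<in>X - \<Union>F. P s" by blast
  let ?U = "{\<omega>. \<omega> (pid X)} \<inter> (\<Inter>Z\<in>F. {\<omega>. \<not> \<omega> (pid Z)})"
  have "open ?U" by (intro open_Int open_INT ballI open_eval XF(2))
  then have "\<forall>\<^sub>F s in near \<omega>. point_char s \<in> ?U" by (rule near_open) (use XF in auto)
  then show "eventually P (near \<omega>)"
  proof (rule eventually_mono)
    fix s assume "point_char s \<in> ?U"
    then have "point_char s (pid X)" "\<And>Z. Z \<in> F \<Longrightarrow> \<not> point_char s (pid Z)" by auto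
    then have "s \<in> X - \<Union>F" using XF(1,3) point_char_pid by blast
    then show "P s" using XF(6) by blast
  qed
qed

text \<open>The same basis in the language of C*-regularity and of the relation defining \<G>(S). As
  \<open>char_ext\<close> quantifies over presentations of \<open>Y\<close>, any presentation that
  occurs can be used.\<close>

lemma eventually_near_char_ext:
  assumes "\<omega> \<in> Omega"
  shows "eventually P (near \<omega>) \<longleftrightarrow> (\<exists>Y\<in>constructible_diffs. char_ext \<omega> Y \<and> (\<forall>s\<in>Y. P s))"
proof
  assume "eventually P (near \<omega>)"
  then obtain X F where XF: "X \<in> constructible" "finite F" "F \<subseteq> constructible" "\<omega> (pid X)"
    "\<forall>Z\<in>F. \<not> \<omega> (pid Z)" "\<forall>s\<in>X - \<Union>F. P s" unfolding eventually_near_iff[OF assms] by blast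
  have "X - \<Union>F \<in> constructible_diffs"
    unfolding constructible_diffs_def by (rule CollectI) (use XF in blast)
  moreover have "char_ext \<omega> (X - \<Union>F)" unfolding char_ext_def using XF by blast
  ultimately show "\<exists>Y\<in>constructible_diffs. char_ext \<omega> Y \<and> (\<forall>s\<in>Y. P s)" using XF(6) by blast
next
  assume "\<exists>Y\<in>constructible_diffs. char_ext \<omega> Y \<and> (\<forall>s\<in>Y. P s)"
  then obtain Y where "char_ext \<omega> Y" "\<forall>s\<in>Y. P s" by blast
  then show "eventually P (near \<omega>)" unfolding eventually_near_iff[OF assms] char_ext_def by metis
qed

lemma near_pid:
  assumes \<omega>: "\<omega> \<in> Omega" and X: "X \<in> constructible"
  shows "\<omega> (pid X) \<longleftrightarrow> (\<forall>\<^sub>F s in near \<omega>. s \<in> X)" "\<not> \<omega> (pid X) \<longleftrightarrow> (\<forall>\<^sub>F s in near \<omega>. s \<notin> X)"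
proof -
  have 1: "\<forall>\<^sub>F s in near \<omega>. s \<in> X" if "\<omega> (pid X)"
    using that X unfolding eventually_near_iff[OF \<omega>] by (intro exI[of _ X] exI[of _ "{}"]) auto
  have 2: "\<forall>\<^sub>F s in near \<omega>. s \<notin> X" if "\<not> \<omega> (pid X)"
    using that X \<omega> unfolding eventually_near_iff[OF \<omega>]
    by (intro exI[of _ UNIV] exI[of _ "{X}"]) (auto simp: constructible.whole)
  have 3: False if "\<forall>\<^sub>F s in near \<omega>. s \<in> X" "\<forall>\<^sub>F s in near \<omega>. s \<notin> X"
    using eventually_conj[OF that] near_neq_bot[OF \<omega>] by (simp add: eventually_False)
  from 1 2 3 show "\<omega> (pid X) \<longleftrightarrow> (\<forall>\<^sub>F s in near \<omega>. s \<in> X)" "\<not> \<omega> (pid X) \<longleftrightarrow> (\<forall>\<^sub>F s in near \<omega>. s \<notin> X)"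
    by blast+
qed

text \<open>The filter need not be an ultrafilter on the subsets of S, but it decides every member
  of \<open>constructible_diffs\<close>. This is what makes a finite cover by such sets
  usable.\<close>

lemma near_diffs:
  assumes \<omega>: "\<omega> \<in> Omega" and Y: "Y \<in> constructible_diffs"
  shows "(\<forall>\<^sub>F s in near \<omega>. s \<in> Y) \<or> (\<forall>\<^sub>F s in near \<omega>. s \<notin> Y)"
proof -
  obtain X F where XF: "Y = X - \<Union>F" "X \<in> constructible" "finite F" "F \<subseteq> constructible"
    using Y by (auto simp: constructible_diffs_def)
  show ?thesis
  proof (cases "\<omega> (pid X) \<and> (\<forall>Z\<in>F. \<not> \<omega> (pid Z))")
    case True
    then have "char_ext \<omega> Y" unfolding char_ext_def using XF by blast
    then have "\<forall>\<^sub>F s in near \<omega>. s \<in> Y"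
      unfolding eventually_near_char_ext[OF \<omega>] by (rule_tac bexI[OF _ Y]) blast
    then show ?thesis ..
  next
    case False
    then consider "\<not> \<omega> (pid X)" | Z where "Z \<in> F" "\<omega> (pid Z)" by blast
    then show ?thesis
    proof cases
      case 1
      then have "\<forall>\<^sub>F s in near \<omega>. s \<notin> X" using near_pid(2)[OF \<omega> XF(2)] by blast
      then have "\<forall>\<^sub>F s in near \<omega>. s \<notin> Y" by (rule eventually_mono) (use XF(1) in blast)
      then show ?thesis ..
    next
      case 2
      then have "\<forall>\<^sub>F s in near \<omega>. s \<in> Z" using near_pid(1)[OF \<omega>] XF(4) by blast
      then have "\<forall>\<^sub>F s in near \<omega>. s \<notin> Y" by (rule eventually_mono) (use 2 XF(1) in blast)
      then show ?thesis ..
    qed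
  qed
qed

lemma Omega_eqI:
  assumes "\<omega> \<in> Omega" "\<omega>' \<in> Omega" "\<And>X. X \<in> constructible \<Longrightarrow> \<omega> (pid X) \<longleftrightarrow> \<omega>' (pid X)"
  shows "\<omega> = \<omega>'"
proof
  fix p
  show "\<omega> p = \<omega>' p"
    using Omega_idem[OF assms(1), of p] Omega_idem[OF assms(2), of p] assms(3) by blast
qed

text \<open>The only use of C*-regularity.\<close>

lemma regular_avoid:
  assumes reg: "cstar_regular TYPE('a::left_cancellative_monoid)"
    and \<omega>: "\<omega> \<in> (Omega :: 'a semichar set)" and H: "finite H" "H \<subseteq> left_hull"
    and nt: "\<And>h. h \<in> H \<Longrightarrow> \<not> (\<forall>\<^sub>F s in near \<omega>. h s = Some s)"
  shows "\<exists>\<^sub>F s in near \<omega>. \<forall>h\<in>H. h s \<noteq> Some s"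
proof (rule ccontr)
  assume "\<not> ?thesis"
  \<comment> \<open>Negating the claim makes the fixed point sets of \<open>H\<close> cover a basic
    set of the filter, to which regularity applies.\<close>
  then have "\<forall>\<^sub>F s in near \<omega>. \<exists>h\<in>H. h s = Some s" by (simp add: not_frequently)
  then obtain Y where Y: "Y \<in> constructible_diffs" "char_ext \<omega> Y" "\<And>s. s \<in> Y \<Longrightarrow> \<exists>h\<in>H. h s = Some s"
    unfolding eventually_near_char_ext[OF \<omega>] by blast
  have evY: "\<forall>\<^sub>F s in near \<omega>. s \<in> Y"
    unfolding eventually_near_char_ext[OF \<omega>] by (rule bexI[OF _ Y(1)]) (use Y(2) in blast)
  have "Y \<noteq> {}"
  proof
    assume "Y = {}"
    with evY have "\<forall>\<^sub>F s in near \<omega>. False" by simp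
    then show False using near_neq_bot[OF \<omega>] by (simp add: eventually_False)
  qed
  then obtain \<Y> where \<Y>: "finite \<Y>" "\<Y> \<subseteq> constructible_diffs" "Y \<subseteq> \<Union>\<Y>"
      "\<And>Z. Z \<in> \<Y> \<Longrightarrow> \<exists>h\<in>H. \<forall>y\<in>Z. h y = Some y"
  proof -
    have "Y \<subseteq> (\<Union>h\<in>H. {s. h s = Some s})" using Y(3) by blast
    then have "\<exists>\<Y>. finite \<Y> \<and> \<Y> \<subseteq> constructible_diffs \<and> Y \<subseteq> \<Union>\<Y> \<and> (\<forall>Z\<in>\<Y>. \<exists>h\<in>H. \<forall>y\<in>Z. h y = Some y)"
      using reg H Y(1) \<open>Y \<noteq> {}\<close> unfolding cstar_regular_def by auto
    then show ?thesis using that by blast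
  qed
  \<comment> \<open>If some piece \<open>Z\<close> were in the filter, the element of
    \<open>H\<close> that is the identity on \<open>Z\<close> would be trivial at
    \<open>\<omega>\<close>. So all the finitely many pieces are eventually avoided, although they
    cover \<open>Y\<close>.\<close>
  have "\<forall>\<^sub>F s in near \<omega>. s \<notin> Z" if Z: "Z \<in> \<Y>" for Z
  proof (rule ccontr)
    assume "\<not> ?thesis"
    then have ev: "\<forall>\<^sub>F s in near \<omega>. s \<in> Z" using near_diffs[OF \<omega>] \<Y>(2) Z by blast
    obtain h where h: "h \<in> H" "\<forall>y\<in>Z. h y = Some y" using \<Y>(4)[OF Z] by blast
    from ev have "\<forall>\<^sub>F s in near \<omega>. h s = Some s" by (rule eventually_mono) (use h in blast)
    then show False using nt[OF h(1)] by blast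
  qed
  then have "\<forall>\<^sub>F s in near \<omega>. \<forall>Z\<in>\<Y>. s \<notin> Z" by (intro eventually_ball_finite \<Y>(1)) blast
  with evY have "\<forall>\<^sub>F s in near \<omega>. False"
    by (rule eventually_elim2) (use \<Y>(3) in blast)
  then show False using near_neq_bot[OF \<omega>] by (simp add: eventually_False)
qed

subsection \<open>The action on characters\<close>

lemma conj_char_pid:
  "g \<in> left_hull \<Longrightarrow> X \<in> constructible \<Longrightarrow> conj_char g \<omega> (pid X) \<longleftrightarrow> \<omega> (pid (preimg g X))"
  by (simp add: conj_char_def pid_idem conj_pid)

lemma conj_char_point:
  assumes "g \<in> left_hull" "g s = Some t"
  shows "conj_char g (point_char s) = point_char t"
proof
  fix p
  show "conj_char g (point_char s) p = point_char t p"
  proof (cases "p \<in> idems")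
    case True
    then obtain X where X: "X \<in> constructible" "p = pid X" by (auto simp: idems_eq)
    then show ?thesis using assms
      by (simp add: conj_char_pid point_char_pid preimg_constructible) (simp add: preimg_def)
  next
    case False
    then show ?thesis by (auto simp: conj_char_def point_char_def idems_eq)
  qed
qed

lemma continuous_conj_char: "continuous_on UNIV (conj_char g)"
proof (rule continuous_on_coordinatewise_then_product)
  fix p
  show "continuous_on UNIV (\<lambda>\<omega>. conj_char g \<omega> p)"
    by (cases "p \<in> idems") (auto simp: conj_char_def)
qed

text \<open>An open neighbourhood of the image character is pulled back by continuity; a point s
  near \<open>\<omega>\<close> in the pullback lies in the domain of \<open>g\<close>, and the
  character of g(s) lies in the neighbourhood.\<close>

lemma conj_char_Omega:
  assumes g: "g \<in> left_hull" and \<omega>: "\<omega> \<in> Omega" "\<omega> (pid (dom g))"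
  shows "conj_char g \<omega> \<in> Omega"
  unfolding Omega_eq closure_iff_nhds_not_empty
proof (intro allI impI)
  fix V U assume U: "U \<subseteq> V" "open U" "conj_char g \<omega> \<in> U"
  have "open (conj_char g -` U)" using open_vimage[OF U(2) continuous_conj_char] .
  then have "\<forall>\<^sub>F s in near \<omega>. point_char s \<in> conj_char g -` U" by (rule near_open) (use U in auto)
  moreover have "\<forall>\<^sub>F s in near \<omega>. s \<in> dom g" using near_pid(1)[OF \<omega>(1)] g \<omega>(2) by blast
  ultimately have "\<forall>\<^sub>F s in near \<omega>. \<exists>t. point_char t \<in> U"
  proof eventually_elim
    case (elim s)
    then obtain t where "g s = Some t" by auto
    with elim conj_char_point[OF g this] show ?case by auto
  qed
  then have "\<exists>t. point_char t \<in> U" using near_neq_bot[OF \<omega>(1)] eventually_const by blast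
  then show "range point_char \<inter> V \<noteq> {}" using U(1) by blast
qed

lemma conj_char_conj_char:
  assumes "g \<in> left_hull" "h \<in> left_hull"
  shows "conj_char g (conj_char h \<omega>) = conj_char (g \<circ>\<^sub>m h) \<omega>"
proof
  fix p
  show "conj_char g (conj_char h \<omega>) p = conj_char (g \<circ>\<^sub>m h) \<omega> p"
  proof (cases "p \<in> idems")
    case True
    then obtain X where "X \<in> constructible" "p = pid X" by (auto simp: idems_eq)
    then show ?thesis using assms by (simp add: conj_char_pid preimg_constructible left_hull.comp preimg_comp)
  qed (simp add: conj_char_def)
qed

lemma conj_char_dom_comp:
  assumes "g \<in> left_hull" "h \<in> left_hull"
  shows "conj_char h \<omega> (pid (dom g)) \<longleftrightarrow> \<omega> (pid (dom (g \<circ>\<^sub>m h)))"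
  using assms by (simp add: conj_char_pid dom_constructible) (simp add: dom_eq_preimg preimg_comp)

lemma conj_char_UNIV:
  fixes \<omega> :: "'a::left_cancellative_monoid semichar"
  assumes \<omega>: "\<omega> \<in> Omega"
  shows "conj_char (pid UNIV) \<omega> = \<omega>"
proof
  fix p :: "'a \<rightharpoonup> 'a"
  have "pinverse (pid UNIV) \<circ>\<^sub>m p \<circ>\<^sub>m pid UNIV = p"
    by simp
  then show "conj_char (pid UNIV) \<omega> p = \<omega> p"
    using Omega_idem[OF \<omega>, of p] pid_idem by (auto simp: conj_char_def)
qed

lemma conj_char_dom:
  "g \<in> left_hull \<Longrightarrow> \<omega> (pid (dom g)) \<Longrightarrow> conj_char g \<omega> (pid (dom (pinverse g)))"
  by (simp add: conj_char_dom_comp left_hull.inverse pinverse_comp_self)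

lemma conj_char_inv:
  fixes \<omega> :: "'a::left_cancellative_monoid semichar"
  assumes g: "g \<in> left_hull" and \<omega>: "\<omega> \<in> Omega" "\<omega> (pid (dom g))"
  shows "conj_char (pinverse g) (conj_char g \<omega>) = \<omega>"
proof (rule Omega_eqI)
  show "conj_char (pinverse g) (conj_char g \<omega>) \<in> Omega"
    using g \<omega> by (intro conj_char_Omega left_hull.inverse conj_char_dom)
  fix X :: "'a set" assume X: "X \<in> constructible"
  \<comment> \<open>\<open>pinverse g \<circ>\<^sub>m g\<close> is the identity on
    \<open>dom g\<close>, so \<open>X\<close> is replaced by \<open>X \<inter> dom g\<close>, where
    \<open>\<omega>\<close> takes the same value because it is 1 at \<open>dom g\<close>.\<close>
  have "preimg (pid (dom g)) X = X \<inter> dom g" by (auto simp: preimg_def pid_iff)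
  then show "conj_char (pinverse g) (conj_char g \<omega>) (pid X) \<longleftrightarrow> \<omega> (pid X)"
    using X g \<omega> by (simp add: conj_char_conj_char left_hull.inverse pinverse_comp_self conj_char_pid
        pid_left_hull dom_constructible Omega_pid_Int)
qed (rule \<omega>)

lemma near_conj_char1:
  assumes g: "g \<in> left_hull" and \<omega>: "\<omega> \<in> Omega" "\<omega> (pid (dom g))"
    and ev: "eventually P (near (conj_char g \<omega>))"
  shows "\<forall>\<^sub>F s in near \<omega>. \<forall>t. g s = Some t \<longrightarrow> P t"
proof -
  obtain X F where XF: "X \<in> constructible" "finite F" "F \<subseteq> constructible" "conj_char g \<omega> (pid X)"
      "\<forall>Z\<in>F. \<not> conj_char g \<omega> (pid Z)" "\<forall>s\<in>X - \<Union>F. P s"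
    using ev unfolding eventually_near_iff[OF conj_char_Omega[OF g \<omega>]] by (elim exE conjE) (rule that)
  have 1: "\<forall>\<^sub>F s in near \<omega>. s \<in> preimg g X"
    using XF(1,4) g by (simp add: conj_char_pid flip: near_pid[OF \<omega>(1) preimg_constructible])
  have "\<forall>\<^sub>F s in near \<omega>. \<forall>Z\<in>F. s \<notin> preimg g Z"
  proof (intro eventually_ball_finite XF(2) ballI)
    fix Z assume "Z \<in> F"
    then show "\<forall>\<^sub>F s in near \<omega>. s \<notin> preimg g Z"
      using XF(3,5) g by (simp add: conj_char_pid subset_iff flip: near_pid(2)[OF \<omega>(1) preimg_constructible])
  qed
  with 1 show ?thesis by eventually_elim (use XF(6) in \<open>fastforce simp: preimg_def\<close>)
qed

text \<open>The filter at the image character is the image filter under \<open>g\<close>, which lets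
  every statement near the range of an arrow be pulled back to its source. The converse direction is
  the direct one for \<open>pinverse g\<close>.\<close>

lemma near_conj_char:
  assumes g: "g \<in> left_hull" and \<omega>: "\<omega> \<in> Omega" "\<omega> (pid (dom g))"
  shows "eventually P (near (conj_char g \<omega>)) \<longleftrightarrow> (\<forall>\<^sub>F s in near \<omega>. \<forall>t. g s = Some t \<longrightarrow> P t)"
proof
  assume ev: "\<forall>\<^sub>F s in near \<omega>. \<forall>t. g s = Some t \<longrightarrow> P t"
  have inv: "pinverse g \<in> left_hull" "conj_char g \<omega> \<in> Omega" "conj_char g \<omega> (pid (dom (pinverse g)))"
    using g \<omega> by (auto intro: left_hull.inverse conj_char_Omega conj_char_dom)
  have "\<forall>\<^sub>F t in near (conj_char g \<omega>). \<forall>s. pinverse g t = Some s \<longrightarrow> (\<forall>t. g s = Some t \<longrightarrow> P t)"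
    by (rule near_conj_char1[OF inv]) (use conj_char_inv[OF g \<omega>] ev in simp)
  moreover have "\<forall>\<^sub>F t in near (conj_char g \<omega>). t \<in> dom (pinverse g)"
    using near_pid(1)[OF inv(2)] inv by blast
  ultimately show "eventually P (near (conj_char g \<omega>))"
    by eventually_elim (auto simp: pinverse_iff[OF g])
qed (rule near_conj_char1[OF g \<omega>])

lemma near_dom:
  assumes "g \<in> left_hull" "\<omega> \<in> Omega" "\<omega> (pid (dom g))"
  shows "\<forall>\<^sub>F s in near \<omega>. \<exists>t. g s = Some t"
  using near_pid(1)[OF assms(2) dom_constructible[OF assms(1)]] assms(3) by (simp add: dom_def)

text \<open>The action of \<open>g\<close> on \<open>\<omega>\<close> depends on \<open>g\<close>
  only through eventual membership in preimages, and these agree eventually for \<open>g\<close> and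
  \<open>h\<close>.\<close>

lemma conj_char_cong:
  assumes "g \<in> left_hull" "h \<in> left_hull" "\<omega> \<in> Omega" "\<forall>\<^sub>F s in near \<omega>. g s = h s"
    "\<omega> (pid (dom g))"
  shows "conj_char g \<omega> = conj_char h \<omega>" "\<omega> (pid (dom h))"
proof -
  have eq: "\<omega> (pid (preimg g X)) = \<omega> (pid (preimg h X))" if "X \<in> constructible" for X
  proof -
    have "(\<forall>\<^sub>F s in near \<omega>. s \<in> preimg g X) \<longleftrightarrow> (\<forall>\<^sub>F s in near \<omega>. s \<in> preimg h X)"
      by (rule eventually_subst, use assms(4) in eventually_elim) (simp add: preimg_def)
    then show ?thesis using near_pid(1)[OF assms(3) preimg_constructible] assms that by metis
  qed
  show d: "\<omega> (pid (dom h))" using eq[OF constructible.whole] assms(5) by (simp add: dom_eq_preimg)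
  show "conj_char g \<omega> = conj_char h \<omega>"
    by (rule Omega_eqI) (use assms d in \<open>auto intro: conj_char_Omega simp: conj_char_pid eq\<close>)
qed

text \<open>Every set in the filter at the character of \<open>r\<close> contains \<open>r\<close>,
  and the principal right ideal generated by \<open>r\<close> is constructible and hence belongs to
  the filter.\<close>

lemma near_point:
  shows "eventually P (near (point_char r)) \<Longrightarrow> P r"
    and "(\<And>u. P (r * u)) \<Longrightarrow> eventually P (near (point_char r))"
proof -
  show "eventually P (near (point_char r)) \<Longrightarrow> P r"
    by (auto simp: near_def eventually_filtercomap eventually_nhds)
  assume P: "\<And>u. P (r * u)"
  let ?X = "{u. \<exists>x\<in>UNIV. 1 * u = r * x}"
  have X: "?X \<in> constructible" by (rule constructible.step[OF constructible.whole])
  have "r \<in> ?X" by (auto intro: exI[of _ 1])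
  then have "\<forall>\<^sub>F s in near (point_char r). s \<in> ?X"
    using near_pid(1)[OF point_char_Omega X] point_char_pid[OF X] by blast
  then show "eventually P (near (point_char r))" by (rule eventually_mono) (use P in auto)
qed

text \<open>At a point character the class of a hull element is its value at the point: agreement at
  \<open>r\<close> extends to the right ideal of \<open>r\<close> by
  \<open>left_hull_mult\<close>.\<close>

lemma near_point_eq:
  assumes "g \<in> left_hull" "h \<in> left_hull" "g r = Some t"
  shows "(\<forall>\<^sub>F s in near (point_char r). g s = h s) \<longleftrightarrow> h r = Some t"
  using near_point[of "\<lambda>s. g s = h s" r] left_hull_mult[OF assms(1,3)] left_hull_mult[OF assms(2)] assms(3)
  by metis

section \<open>Groupoid algebra in terms of source fibres\<close>

text \<open>The purely algebraic laws, with units regarded as arrows. The unit law has the form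
  \<open>mul_inv_src\<close> because units are met as divisors: dividing an arrow by its source must
  return the arrow.\<close>

locale groupoid =
  fixes G :: "'g top_groupoid"
  assumes src_closed: "g \<in> arrows G \<Longrightarrow> gsrc G g \<in> arrows G"
    and src_src: "g \<in> arrows G \<Longrightarrow> gsrc G (gsrc G g) = gsrc G g"
    and inv_closed: "g \<in> arrows G \<Longrightarrow> ginv G g \<in> arrows G"
    and src_inv: "g \<in> arrows G \<Longrightarrow> gsrc G (ginv G g) = grng G g"
    and rng_inv: "g \<in> arrows G \<Longrightarrow> grng G (ginv G g) = gsrc G g"
    and inv_inv: "g \<in> arrows G \<Longrightarrow> ginv G (ginv G g) = g"
    and mul_closed: "\<lbrakk>g \<in> arrows G; h \<in> arrows G; gsrc G g = grng G h\<rbrakk> \<Longrightarrow> gmul G g h \<in> arrows G"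
    and src_mul: "\<lbrakk>g \<in> arrows G; h \<in> arrows G; gsrc G g = grng G h\<rbrakk> \<Longrightarrow> gsrc G (gmul G g h) = gsrc G h"
    and rng_mul: "\<lbrakk>g \<in> arrows G; h \<in> arrows G; gsrc G g = grng G h\<rbrakk> \<Longrightarrow> grng G (gmul G g h) = grng G g"
    and assoc: "\<lbrakk>g \<in> arrows G; h \<in> arrows G; k \<in> arrows G; gsrc G g = grng G h; gsrc G h = grng G k\<rbrakk>
      \<Longrightarrow> gmul G (gmul G g h) k = gmul G g (gmul G h k)"
    and inv_mul_cancel: "\<lbrakk>g \<in> arrows G; h \<in> arrows G; gsrc G g = grng G h\<rbrakk>
      \<Longrightarrow> gmul G (ginv G g) (gmul G g h) = h"
    and inv_mul: "\<lbrakk>g \<in> arrows G; h \<in> arrows G; gsrc G g = grng G h\<rbrakk>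
      \<Longrightarrow> ginv G (gmul G g h) = gmul G (ginv G h) (ginv G g)"
    and mul_inv_src: "g \<in> arrows G \<Longrightarrow> gmul G g (ginv G (gsrc G g)) = g"
begin

text \<open>On a source fibre, a function \<open>f\<close> acts by the matrix with entries f(a
  b^{-1}); this quotient is the coordinate in which convolution and involution become the matrix
  operations.\<close>

definition gdiv :: "'g \<Rightarrow> 'g \<Rightarrow> 'g" where
  "gdiv a b = gmul G a (ginv G b)"

context
  fixes x a b assumes a: "a \<in> src_fibre G x" and b: "b \<in> src_fibre G x"
begin

lemma fibre_facts: "a \<in> arrows G" "b \<in> arrows G" "gsrc G a = grng G (ginv G b)" "ginv G b \<in> arrows G"
  using a b by (auto simp: src_fibre_def inv_closed rng_inv)

lemma gdiv_rng: "gdiv a b \<in> rng_fibre G (grng G a)"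
  using fibre_facts by (simp add: rng_fibre_def gdiv_def mul_closed rng_mul)

lemma gdiv_arrow: "gdiv a b \<in> arrows G" "grng G (gdiv a b) = grng G a"
  using gdiv_rng by (auto simp: rng_fibre_def)

lemma inv_gdiv: "ginv G (gdiv a b) = gdiv b a"
  using fibre_facts by (simp add: gdiv_def inv_mul inv_inv)

lemma inv_gdiv_mul: "gmul G (ginv G (gdiv a b)) a = b"
proof -
  have "gmul G (gmul G b (ginv G a)) a = gmul G b (gmul G (ginv G a) a)"
    using a b by (intro assoc) (auto simp: src_fibre_def inv_closed rng_inv src_inv)
  also have "gmul G (ginv G a) a = gmul G (ginv G a) (gmul G a (ginv G (gsrc G a)))"
    by (simp only: mul_inv_src[OF fibre_facts(1)])
  also have "\<dots> = ginv G (gsrc G a)"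
    using a by (intro inv_mul_cancel) (auto simp: src_fibre_def inv_closed rng_inv src_closed src_src)
  also have "gmul G b (ginv G (gsrc G a)) = b"
    using a b mul_inv_src[OF fibre_facts(2)] by (simp add: src_fibre_def)
  finally show ?thesis using inv_gdiv by (simp add: gdiv_def)
qed

end

lemma gdiv_cancel:
  assumes a: "a \<in> src_fibre G x" and b: "b \<in> src_fibre G x" and d: "d \<in> src_fibre G x"
  shows "gmul G (ginv G (gdiv a d)) (gdiv a b) = gdiv d b"
proof -
  have "gmul G (ginv G (gdiv a d)) (gmul G a (ginv G b)) = gmul G (gmul G (ginv G (gdiv a d)) a) (ginv G b)"
    using a b gdiv_arrow[OF a d]
    by (intro assoc[symmetric]) (auto simp: src_fibre_def inv_closed rng_inv src_inv)
  then show ?thesis using inv_gdiv_mul[OF a d] by (simp add: gdiv_def)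
qed

text \<open>The change of variable h = a b^{-1} that turns sums over a range fibre, as in
  convolution, into sums over a source fibre.\<close>

lemma bij_gdiv:
  assumes a: "a \<in> src_fibre G x"
  shows "bij_betw (gdiv a) (src_fibre G x) (rng_fibre G (grng G a))"
proof (rule bij_betwI[where g = "\<lambda>h. gmul G (ginv G h) a"])
  show "gdiv a \<in> src_fibre G x \<rightarrow> rng_fibre G (grng G a)" using gdiv_rng[OF a] by blast
  show "gmul G (ginv G (gdiv a b)) a = b" if "b \<in> src_fibre G x" for b
    by (rule inv_gdiv_mul[OF a that])
  have h: "gmul G (ginv G h) a \<in> src_fibre G x \<and> gdiv a (gmul G (ginv G h) a) = h"
    if h: "h \<in> rng_fibre G (grng G a)" for h
  proof
    have arr: "h \<in> arrows G" "ginv G h \<in> arrows G" "a \<in> arrows G" "gsrc G (ginv G h) = grng G a" "gsrc G a = x"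
      using h a by (auto simp: rng_fibre_def src_fibre_def inv_closed src_inv)
    let ?b = "gmul G (ginv G h) a"
    have b: "?b \<in> src_fibre G x" using arr by (simp add: src_fibre_def mul_closed src_mul)
    show "?b \<in> src_fibre G x" by (rule b)
    have "gmul G ?b (ginv G a) = ginv G h"
    proof -
      have "gmul G ?b (ginv G a) = gmul G (ginv G h) (gmul G a (ginv G a))"
        using arr by (intro assoc) (auto simp: inv_closed rng_inv)
      \<comment> \<open>The unit a a^{-1} is written as the inverse of a source, the only shape in
        which \<open>mul_inv_src\<close> absorbs it.\<close>
      also have "gmul G a (ginv G a) = ginv G (gsrc G (ginv G a))"
        using inv_mul_cancel[OF inv_closed[OF arr(3)] inv_closed[OF src_closed[OF inv_closed[OF arr(3)]]]]
          mul_inv_src[OF inv_closed[OF arr(3)]] arr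
        by (simp add: inv_inv rng_inv src_closed inv_closed src_src)
      also have "gmul G (ginv G h) \<dots> = ginv G h"
        using mul_inv_src[OF arr(2)] arr by (simp add: src_inv)
      finally show ?thesis .
    qed
    then have "gdiv ?b a = ginv G h" by (simp add: gdiv_def)
    then show "gdiv a ?b = h" using inv_gdiv[OF b a] arr(1) inv_inv by simp
  qed
  show "(\<lambda>h. gmul G (ginv G h) a) \<in> rng_fibre G (grng G a) \<rightarrow> src_fibre G x" using h by blast
  show "gdiv a (gmul G (ginv G h) a) = h" if "h \<in> rng_fibre G (grng G a)" for h using h[OF that] by blast
qed

lemma regular_rep_eq: "regular_rep G x f = mat_op (src_fibre G x) (\<lambda>a b. f (gdiv a b))"
proof (intro ext)
  fix \<xi> a
  show "regular_rep G x f \<xi> a = mat_op (src_fibre G x) (\<lambda>a b. f (gdiv a b)) \<xi> a"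
  proof (cases "\<xi> \<in> ell2 (src_fibre G x) \<and> a \<in> src_fibre G x")
    case True
    then have a: "a \<in> src_fibre G x" by simp
    have "(\<Sum>\<^sub>\<infinity>b\<in>src_fibre G x. f (gdiv a b) * \<xi> b) =
        (\<Sum>\<^sub>\<infinity>b\<in>src_fibre G x. f (gdiv a b) * \<xi> (gmul G (ginv G (gdiv a b)) a))"
      by (intro infsum_cong) (simp add: inv_gdiv_mul[OF a])
    also have "\<dots> = (\<Sum>\<^sub>\<infinity>h\<in>rng_fibre G (grng G a). f h * \<xi> (gmul G (ginv G h) a))"
      by (rule infsum_reindex_bij_betw[OF bij_gdiv[OF a]])
    finally show ?thesis using True by (simp add: regular_rep_def mat_op_def)
  qed (auto simp: regular_rep_def mat_op_def)
qed

text \<open>Matrix multiplication, since (a d^{-1})^{-1} (a b^{-1}) = d b^{-1}.\<close>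

lemma convolution_gdiv:
  assumes a: "a \<in> src_fibre G x" and b: "b \<in> src_fibre G x"
  shows "convolution G f1 f2 (gdiv a b) = (\<Sum>\<^sub>\<infinity>d\<in>src_fibre G x. f1 (gdiv a d) * f2 (gdiv d b))"
proof -
  have "(\<Sum>\<^sub>\<infinity>d\<in>src_fibre G x. f1 (gdiv a d) * f2 (gdiv d b)) =
      (\<Sum>\<^sub>\<infinity>d\<in>src_fibre G x. f1 (gdiv a d) * f2 (gmul G (ginv G (gdiv a d)) (gdiv a b)))"
    by (intro infsum_cong) (simp add: gdiv_cancel[OF a b])
  also have "\<dots> = (\<Sum>\<^sub>\<infinity>h\<in>rng_fibre G (grng G a). f1 h * f2 (gmul G (ginv G h) (gdiv a b)))"
    by (rule infsum_reindex_bij_betw[OF bij_gdiv[OF a]])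
  finally show ?thesis using gdiv_arrow[OF a b] by (simp add: convolution_def)
qed

lemma gstar_gdiv:
  assumes "a \<in> src_fibre G x" and "b \<in> src_fibre G x"
  shows "gstar G f (gdiv a b) = cnj (f (gdiv b a))"
  using gdiv_arrow[OF assms] inv_gdiv[OF assms] by (simp add: gstar_def)

lemma gdiv_src: "g \<in> arrows G \<Longrightarrow> gdiv g (gsrc G g) = g"
  by (simp add: gdiv_def mul_inv_src)

end

section \<open>Arrows of the groupoid of a monoid\<close>

text \<open>The pairs that represent arrows after reduction to \<open>Omega\<close>;
  \<open>germ_pairs\<close> allows arbitrary semi-characters.\<close>

definition gpair :: "('a::left_cancellative_monoid \<rightharpoonup> 'a) \<Rightarrow> 'a semichar \<Rightarrow> bool" where
  "gpair g \<omega> \<longleftrightarrow> g \<in> left_hull \<and> \<omega> \<in> Omega \<and> \<omega> (pid (dom g))"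

lemma gpairD: "gpair g \<omega> \<Longrightarrow> g \<in> left_hull" "gpair g \<omega> \<Longrightarrow> \<omega> \<in> Omega" "gpair g \<omega> \<Longrightarrow> \<omega> (pid (dom g))"
  by (auto simp: gpair_def)

lemma gpair_UNIV: "\<omega> \<in> Omega \<Longrightarrow> gpair (pid UNIV) \<omega>"
  by (simp add: gpair_def)

lemma gpair_conj: "gpair g \<omega> \<Longrightarrow> conj_char g \<omega> \<in> Omega"
  by (simp add: gpair_def conj_char_Omega)

lemma gpair_inv: "gpair g \<omega> \<Longrightarrow> gpair (pinverse g) (conj_char g \<omega>)"
  by (simp add: gpair_def conj_char_Omega conj_char_dom left_hull.inverse)

lemma gpair_comp: "gpair h \<omega> \<Longrightarrow> gpair g (conj_char h \<omega>) \<longleftrightarrow> g \<in> left_hull \<and> \<omega> (pid (dom (g \<circ>\<^sub>m h)))"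
  using conj_char_dom_comp[of g h \<omega>] by (auto simp: gpair_def conj_char_Omega)

lemma gpair_compI: "gpair h \<omega> \<Longrightarrow> gpair g (conj_char h \<omega>) \<Longrightarrow> gpair (g \<circ>\<^sub>m h) \<omega>"
  using gpair_comp[of h \<omega> g] by (simp add: gpair_def left_hull.comp)

lemma gpair_near: "gpair g \<omega> \<Longrightarrow> \<forall>\<^sub>F s in near \<omega>. \<exists>t. g s = Some t"
  by (simp add: gpair_def near_dom)

lemma gpair_germ_pairs: "gpair g \<omega> \<Longrightarrow> (g, \<omega>) \<in> germ_pairs"
  using Omega_subset by (auto simp: gpair_def germ_pairs_def pinverse_comp_self)

section \<open>Germs and the operations of the Paterson groupoid\<close>

lemma comp_pid_eq: "g \<circ>\<^sub>m pid X = h \<circ>\<^sub>m pid X \<longleftrightarrow> (\<forall>s\<in>X. g s = h s)"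
proof
  assume eq: "g \<circ>\<^sub>m pid X = h \<circ>\<^sub>m pid X"
  show "\<forall>s\<in>X. g s = h s"
  proof
    fix s assume "s \<in> X"
    then have "(g \<circ>\<^sub>m pid X) s = g s" "(h \<circ>\<^sub>m pid X) s = h s" by (simp_all add: map_comp_def pid_def)
    with eq show "g s = h s" by metis
  qed
qed (auto simp: fun_eq_iff map_comp_def pid_def restrict_map_def)

lemma equiv_germ_rel: "equiv germ_pairs (germ_rel :: (_ \<times> (('a::left_cancellative_monoid \<rightharpoonup> 'a) \<times> _)) set)"
  (is "equiv _ ?R")
proof (rule equivI)
  show "?R \<subseteq> germ_pairs \<times> germ_pairs" by (auto simp: germ_rel_def)
  show "refl_on germ_pairs ?R"
    by (rule refl_onI) (auto simp: germ_rel_def germ_pairs_def semichars_def)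
  show "sym ?R"
    by (rule symI) (clarsimp simp: germ_rel_def, metis)
  show "trans ?R"
  proof (rule transI)
    fix a b c :: "('a \<rightharpoonup> 'a) \<times> 'a semichar" assume "(a, b) \<in> germ_rel" "(b, c) \<in> germ_rel"
    then obtain g1 g2 g3 \<omega> p q where *: "a = (g1, \<omega>)" "b = (g2, \<omega>)" "c = (g3, \<omega>)" "a \<in> germ_pairs" "c \<in> germ_pairs"
      "p \<in> idems" "\<omega> p" "g1 \<circ>\<^sub>m p = g2 \<circ>\<^sub>m p" "q \<in> idems" "\<omega> q" "g2 \<circ>\<^sub>m q = g3 \<circ>\<^sub>m q"
      by (auto simp: germ_rel_def)
    then obtain X Y where XY: "X \<in> constructible" "Y \<in> constructible" "p = pid X" "q = pid Y"
      by (auto simp: idems_eq)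
    have "\<omega> \<in> semichars" using * by (simp add: germ_pairs_def)
    then have "\<omega> (pid (X \<inter> Y))" using XY * by (simp add: semichars_pid_Int)
    moreover have "g1 \<circ>\<^sub>m pid (X \<inter> Y) = g3 \<circ>\<^sub>m pid (X \<inter> Y)"
      using * XY unfolding comp_pid_eq by (auto simp: comp_pid_eq)
    ultimately show "(a, c) \<in> germ_rel"
      using * pid_idem[OF constructible_Int[OF XY(1,2)]] by (auto simp: germ_rel_def)
  qed
qed

text \<open>The groupoid operations are saturations of sets built from all representatives. Showing
  every member of such a set related to one chosen member proves independence of choices and
  evaluates the operation simultaneously.\<close>

lemma equiv_Image_eq:
  assumes "equiv A R" "a \<in> B" "\<And>b. b \<in> B \<Longrightarrow> (a, b) \<in> R"
  shows "R `` B = R `` {a}"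
proof -
  have "R `` {b} = R `` {a}" if "b \<in> B" for b
    using equiv_class_eq[OF assms(1) assms(3)[OF that]] by simp
  then show ?thesis using assms(2) by blast
qed

lemma germ_rel_iff:
  assumes "gpair g \<omega>"
  shows "((g, \<omega>), (h, \<omega>')) \<in> germ_rel \<longleftrightarrow>
    \<omega>' = \<omega> \<and> gpair h \<omega> \<and> (\<exists>X\<in>constructible. \<omega> (pid X) \<and> (\<forall>s\<in>X. g s = h s))"
proof -
  have "(h, \<omega>) \<in> germ_pairs \<longleftrightarrow> gpair h \<omega>"
    using assms Omega_subset by (auto simp: gpair_def germ_pairs_def pinverse_comp_self)
  then show ?thesis
    using gpair_germ_pairs[OF assms] by (auto simp: germ_rel_def idems_eq comp_pid_eq)
qed

text \<open>Equality of germs means agreement on a constructible ideal with value 1. It implies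
  eventual agreement, which also permits agreement on a difference of ideals only and is the coarser
  relation surviving in \<G>(S).\<close>

lemma germ_mem:
  assumes "gpair g \<omega>" "(h, \<omega>') \<in> germ g \<omega>"
  shows "\<omega>' = \<omega>" "gpair h \<omega>" "\<forall>\<^sub>F s in near \<omega>. g s = h s" "((g, \<omega>), (h, \<omega>)) \<in> germ_rel"
proof -
  have r: "((g, \<omega>), (h, \<omega>')) \<in> germ_rel" using assms(2) by (simp add: germ_def)
  with germ_rel_iff[OF assms(1)] obtain X where X: "\<omega>' = \<omega>" "gpair h \<omega>" "X \<in> constructible" "\<omega> (pid X)" "\<forall>s\<in>X. g s = h s"
    by blast
  then show "\<omega>' = \<omega>" "gpair h \<omega>" "((g, \<omega>), (h, \<omega>)) \<in> germ_rel" using r by auto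
  have "\<forall>\<^sub>F s in near \<omega>. s \<in> X" using near_pid(1)[OF gpairD(2)[OF X(2)] X(3)] X(4) by blast
  then show "\<forall>\<^sub>F s in near \<omega>. g s = h s" by (rule eventually_mono) (use X(5) in blast)
qed

lemma germ_self: "gpair g \<omega> \<Longrightarrow> (g, \<omega>) \<in> germ g \<omega>"
  unfolding germ_def by (rule equiv_class_self[OF equiv_germ_rel gpair_germ_pairs])

lemma germ_eqD:
  assumes "gpair g \<omega>" "germ g \<omega> = germ h \<omega>'"
  shows "\<omega>' = \<omega>" "gpair h \<omega>" "\<forall>\<^sub>F s in near \<omega>. g s = h s"
proof -
  have "(g, \<omega>) \<in> germ h \<omega>'" unfolding assms(2)[symmetric] by (rule germ_self[OF assms(1)])
  then have "((h, \<omega>'), (g, \<omega>)) \<in> germ_rel" by (simp add: germ_def)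
  then have "((g, \<omega>), (h, \<omega>')) \<in> germ_rel" using equiv_germ_rel by (meson equivE symE)
  then have "(h, \<omega>') \<in> germ g \<omega>" by (simp add: germ_def)
  from germ_mem[OF assms(1) this] show "\<omega>' = \<omega>" "gpair h \<omega>" "\<forall>\<^sub>F s in near \<omega>. g s = h s" by auto
qed

lemma germ_Image:
  assumes "(g, \<omega>) \<in> B" "\<And>h \<omega>'. (h, \<omega>') \<in> B \<Longrightarrow> ((g, \<omega>), (h, \<omega>')) \<in> germ_rel"
  shows "germ_rel `` B = germ g \<omega>"
  unfolding germ_def using assms by (intro equiv_Image_eq[OF equiv_germ_rel]) auto

lemma germ_rel_refl: "(g, \<omega>) \<in> germ_pairs \<Longrightarrow> ((g, \<omega>), (g, \<omega>)) \<in> germ_rel"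
  using equiv_class_self[OF equiv_germ_rel] by simp

lemma src_germ_pairs:
  fixes g :: "'a::left_cancellative_monoid \<rightharpoonup> 'a"
  assumes g: "(g, \<omega>) \<in> germ_pairs"
  shows "gsrc Paterson (germ g \<omega>) = germ (pid UNIV) \<omega>"
proof -
  have "{(pid UNIV :: 'a \<rightharpoonup> 'a, \<omega>') |ga \<omega>'. (ga, \<omega>') \<in> germ g \<omega>} = {(pid UNIV, \<omega>)}"
    using germ_rel_refl[OF g] by (auto simp: germ_def germ_rel_def)
  then show ?thesis by (simp add: Paterson_def germ_def[of "pid UNIV"])
qed

lemma src_germ: "gpair g \<omega> \<Longrightarrow> gsrc Paterson (germ g \<omega>) = germ (pid UNIV) \<omega>"
  by (rule src_germ_pairs[OF gpair_germ_pairs])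

lemma conj_char_germ:
  assumes "gpair g \<omega>" "gpair h \<omega>" "\<forall>\<^sub>F s in near \<omega>. g s = h s"
  shows "conj_char g \<omega> = conj_char h \<omega>"
  using conj_char_cong(1) assms by (auto simp: gpair_def)

lemma rng_germ:
  fixes g :: "'a::left_cancellative_monoid \<rightharpoonup> 'a"
  assumes g: "gpair g \<omega>"
  shows "grng Paterson (germ g \<omega>) = germ (pid UNIV) (conj_char g \<omega>)"
  unfolding Paterson_def
proof (simp, rule germ_Image)
  show "(pid UNIV :: 'a \<rightharpoonup> 'a, conj_char g \<omega>) \<in> {(pid UNIV, conj_char ga \<omega>') |ga \<omega>'. (ga, \<omega>') \<in> germ g \<omega>}"
    using germ_self[OF g] by blast
  fix h :: "'a \<rightharpoonup> 'a" and \<omega>' assume "(h, \<omega>') \<in> {(pid UNIV, conj_char ga \<omega>') |ga \<omega>'. (ga, \<omega>') \<in> germ g \<omega>}"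
  then obtain k \<omega>'' where k: "h = pid UNIV" "\<omega>' = conj_char k \<omega>''" "(k, \<omega>'') \<in> germ g \<omega>" by blast
  then have "\<omega>' = conj_char g \<omega>" using germ_mem[OF g k(3)] conj_char_germ[OF g] by simp
  then show "((pid UNIV, conj_char g \<omega>), h, \<omega>') \<in> germ_rel"
    using k germ_rel_refl[OF gpair_germ_pairs[OF gpair_UNIV[OF gpair_conj[OF g]]]] by simp
qed

lemma inv_germ:
  assumes g: "gpair g \<omega>"
  shows "ginv Paterson (germ g \<omega>) = germ (pinverse g) (conj_char g \<omega>)"
  unfolding Paterson_def
proof (simp, rule germ_Image)
  show "(pinverse g, conj_char g \<omega>) \<in> {(pinverse ga, conj_char ga \<omega>') |ga \<omega>'. (ga, \<omega>') \<in> germ g \<omega>}"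
    using germ_self[OF g] by blast
  fix h \<omega>' assume "(h, \<omega>') \<in> {(pinverse ga, conj_char ga \<omega>') |ga \<omega>'. (ga, \<omega>') \<in> germ g \<omega>}"
  then obtain k \<omega>'' where k: "h = pinverse k" "\<omega>' = conj_char k \<omega>''" "(k, \<omega>'') \<in> germ g \<omega>" by blast
  note m = germ_mem[OF g k(3)]
  have eq: "conj_char k \<omega> = conj_char g \<omega>" using conj_char_germ[OF g m(2,3)] by simp
  have hull: "g \<in> left_hull" "k \<in> left_hull" using gpairD(1)[OF g] gpairD(1)[OF m(2)] .
  obtain X where X: "X \<in> constructible" "\<omega> (pid X)" "\<forall>s\<in>X. g s = k s"
    using m(4) germ_rel_iff[OF g] by blast
  \<comment> \<open>The image of \<open>X\<close> under \<open>g\<close>: the ideal on which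
    \<open>g\<close> and \<open>k\<close> agree is carried to the range side, where the two inverses
    agree.\<close>
  let ?Y = "preimg (pinverse g) X"
  have Y: "?Y \<in> constructible" using X(1) hull by (intro preimg_constructible left_hull.inverse)
  have "preimg g ?Y = X \<inter> dom g"
    using left_hull_inj[OF hull(1)] by (auto simp: preimg_def pinverse_iff[OF hull(1)])
  then have "conj_char g \<omega> (pid ?Y)"
    using X(1,2) hull(1) Y gpairD[OF g] by (simp add: conj_char_pid Omega_pid_Int dom_constructible)
  moreover have "pinverse g t = pinverse k t" if "t \<in> ?Y" for t
  proof -
    obtain x where "x \<in> X" "g x = Some t" using \<open>t \<in> ?Y\<close> by (auto simp: preimg_def pinverse_iff[OF hull(1)])
    then have "pinverse g t = Some x" "pinverse k t = Some x" using X(3) hull by (auto simp: pinverse_iff)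
    then show ?thesis by simp
  qed
  ultimately show "((pinverse g, conj_char g \<omega>), h, \<omega>') \<in> germ_rel"
    unfolding germ_rel_iff[OF gpair_inv[OF g]] using Y k m(1) eq gpair_inv[OF m(2)] by auto
qed

lemma mul_germ:
  assumes h: "gpair h \<psi>" and g: "gpair g (conj_char h \<psi>)"
  shows "gmul Paterson (germ g (conj_char h \<psi>)) (germ h \<psi>) = germ (g \<circ>\<^sub>m h) \<psi>"
  unfolding Paterson_def
proof (simp, rule germ_Image)
  let ?B = "{(g' \<circ>\<^sub>m h', \<psi>') |g' h' \<psi>'. (g', conj_char h' \<psi>') \<in> germ g (conj_char h \<psi>) \<and> (h', \<psi>') \<in> germ h \<psi>}"
  show "(g \<circ>\<^sub>m h, \<psi>) \<in> ?B" using germ_self[OF g] germ_self[OF h] by blast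
  fix k \<psi>' assume "(k, \<psi>') \<in> ?B"
  then obtain g' h' where k: "k = g' \<circ>\<^sub>m h'" "(g', conj_char h' \<psi>') \<in> germ g (conj_char h \<psi>)" "(h', \<psi>') \<in> germ h \<psi>"
    by blast
  note mh = germ_mem[OF h k(3)] and mg = germ_mem[OF g k(2)]
  have hull: "g \<in> left_hull" "h \<in> left_hull" using gpairD(1)[OF g] gpairD(1)[OF h] .
  have eq: "conj_char h' \<psi> = conj_char h \<psi>" using conj_char_germ[OF h mh(2,3)] by simp
  obtain X where X: "X \<in> constructible" "\<psi> (pid X)" "\<forall>s\<in>X. h s = h' s"
    using mh(4) germ_rel_iff[OF h] by blast
  obtain Y where Y: "Y \<in> constructible" "conj_char h \<psi> (pid Y)" "\<forall>s\<in>Y. g s = g' s"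
    using mg(4) germ_rel_iff[OF g] by blast
  have Y': "preimg h Y \<in> constructible" "\<psi> (pid (preimg h Y))" using Y hull by (auto simp: conj_char_pid)
  \<comment> \<open>On \<open>X\<close> the right factors agree, and \<open>h\<close> sends the
    preimage of \<open>Y\<close> to where the left factors agree, so both products coincide on the
    intersection.\<close>
  have "\<psi> (pid (X \<inter> preimg h Y))" using X Y' gpairD(2)[OF h] by (simp add: Omega_pid_Int)
  moreover have "\<forall>s\<in>X \<inter> preimg h Y. (g \<circ>\<^sub>m h) s = (g' \<circ>\<^sub>m h') s"
    using X(3) Y(3) by (auto simp: preimg_def map_comp_def split: option.splits)
  moreover have "gpair (g' \<circ>\<^sub>m h') \<psi>"
    using mg(2) mh(2) eq by (intro gpair_compI) auto
  ultimately show "((g \<circ>\<^sub>m h, \<psi>), k, \<psi>') \<in> germ_rel"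
    unfolding germ_rel_iff[OF gpair_compI[OF h g]] using k(1) mh(1) constructible_Int[OF X(1) Y'(1)] by blast
qed

lemma topspace_Paterson: "topspace (gtop Paterson) = {germ g \<omega> | g \<omega>. (g, \<omega>) \<in> germ_pairs}"
proof (intro equalityI subsetI)
  fix \<gamma> :: "'a germ" assume "\<gamma> \<in> topspace (gtop Paterson)"
  then obtain g U \<omega> where *: "\<gamma> = germ g \<omega>" "\<omega> \<in> U" "g \<in> left_hull" "openin semichar_topology U"
      "U \<subseteq> {\<omega>. \<omega> (pinverse g \<circ>\<^sub>m g)}"
    by (auto simp: Paterson_def topology_generated_by_topspace germ_basic_def)
  then have "\<omega> \<in> semichars" using openin_subset[of semichar_topology U] by (auto simp: semichar_topology_def)
  then have "(g, \<omega>) \<in> germ_pairs" using * by (auto simp: germ_pairs_def)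
  then show "\<gamma> \<in> {germ g \<omega> | g \<omega>. (g, \<omega>) \<in> germ_pairs}" using *(1) by blast
next
  fix \<gamma> :: "'a germ" assume "\<gamma> \<in> {germ g \<omega> | g \<omega>. (g, \<omega>) \<in> germ_pairs}"
  then obtain g \<omega> where *: "\<gamma> = germ g \<omega>" "g \<in> left_hull" "\<omega> \<in> semichars" "\<omega> (pinverse g \<circ>\<^sub>m g)"
    by (auto simp: germ_pairs_def)
  let ?U = "semichars \<inter> {\<omega>. \<omega> (pinverse g \<circ>\<^sub>m g)}"
  have "openin semichar_topology ?U"
    unfolding semichar_topology_def
    by (rule openin_subtopology_Int2) (simp add: open_eval)
  then have "germ_basic g ?U \<in> {germ_basic g U | g U. g \<in> left_hull \<and>
      openin semichar_topology U \<and> U \<subseteq> {\<omega>. \<omega> (pinverse g \<circ>\<^sub>m g)}}" using *(2) by blast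
  moreover have "\<gamma> \<in> germ_basic g ?U" using * by (auto simp: germ_basic_def)
  ultimately show "\<gamma> \<in> topspace (gtop Paterson)"
    by (auto simp: Paterson_def topology_generated_by_topspace)
qed

lemma arrows_GP: "(arrows GP :: 'a::left_cancellative_monoid germ set) = {germ g \<omega> | g \<omega>. gpair g \<omega>}"
proof -
  note src = src_germ_pairs
  have inj: "\<omega> \<in> Omega" if "germ (pid UNIV) \<omega> \<in> germ (pid UNIV) ` Omega" "(g, \<omega>) \<in> germ_pairs" for g :: "'a \<rightharpoonup> 'a" and \<omega>
  proof -
    obtain \<omega>' where \<omega>': "\<omega>' \<in> Omega" "germ (pid UNIV) \<omega> = germ (pid UNIV) \<omega>'" using \<open>germ (pid UNIV) \<omega> \<in> _\<close> by blast
    have "\<omega> = \<omega>'" using germ_eqD(1)[OF gpair_UNIV[OF \<omega>'(1)] \<omega>'(2)[symmetric]] .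
    then show ?thesis using \<omega>'(1) by simp
  qed
  have "(arrows GP :: 'a germ set) = topspace (gtop Paterson) \<inter> {\<gamma>. gsrc Paterson \<gamma> \<in> germ (pid UNIV) ` Omega}"
    by (simp add: GP_def reduction_def)
  also have "\<dots> = {germ g \<omega> | g \<omega>. gpair g \<omega>}"
  proof (intro equalityI subsetI)
    fix \<gamma> :: "'a germ" assume "\<gamma> \<in> topspace (gtop Paterson) \<inter> {\<gamma>. gsrc Paterson \<gamma> \<in> germ (pid UNIV) ` Omega}"
    then obtain g \<omega> where *: "\<gamma> = germ g \<omega>" "(g, \<omega>) \<in> germ_pairs" "germ (pid UNIV) \<omega> \<in> germ (pid UNIV) ` Omega"
    proof -
      obtain g \<omega> where *: "\<gamma> = germ g \<omega>" "(g, \<omega>) \<in> germ_pairs"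
        using \<open>\<gamma> \<in> _\<close> unfolding topspace_Paterson by blast
      moreover have "germ (pid UNIV) \<omega> \<in> germ (pid UNIV) ` Omega"
        using \<open>\<gamma> \<in> _\<close> src[OF *(2)] *(1) by (metis IntD2 mem_Collect_eq)
      ultimately show ?thesis using that by blast
    qed
    then have "gpair g \<omega>" using inj[OF *(3,2)] by (auto simp: gpair_def germ_pairs_def pinverse_comp_self)
    then show "\<gamma> \<in> {germ g \<omega> | g \<omega>. gpair g \<omega>}" using *(1) by blast
  next
    fix \<gamma> :: "'a germ" assume "\<gamma> \<in> {germ g \<omega> | g \<omega>. gpair g \<omega>}"
    then obtain g \<omega> where *: "\<gamma> = germ g \<omega>" "gpair g \<omega>" by blast
    then show "\<gamma> \<in> topspace (gtop Paterson) \<inter> {\<gamma>. gsrc Paterson \<gamma> \<in> germ (pid UNIV) ` Omega}"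
      unfolding topspace_Paterson using gpair_germ_pairs[OF *(2)] src gpairD(2)[OF *(2)] by auto
  qed
  finally show ?thesis .
qed

text \<open>By \<open>eventually_near_char_ext\<close>, agreement on a member of
  \<open>constructible_diffs\<close> with value 1 is eventual agreement. The definition speaks of
  some representatives; passing between representatives of one germ changes a map only off a set of
  the filter.\<close>

lemma GP_rel_iff:
  assumes g: "gpair g \<omega>" and h: "gpair h \<omega>'"
  shows "(germ g \<omega>, germ h \<omega>') \<in> GP_rel \<longleftrightarrow> \<omega>' = \<omega> \<and> (\<forall>\<^sub>F s in near \<omega>. g s = h s)"
proof
  assume "(germ g \<omega>, germ h \<omega>') \<in> GP_rel"
  then obtain g' h' \<omega>'' X where *: "germ g \<omega> = germ g' \<omega>''" "germ h \<omega>' = germ h' \<omega>''"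
      "X \<in> constructible_diffs" "char_ext \<omega>'' X" "g' |` X = h' |` X"
    unfolding GP_rel_def by blast
  note a = germ_eqD[OF g *(1)] and b = germ_eqD[OF h *(2)]
  have X: "g' s = h' s" if "s \<in> X" for s using fun_cong[OF *(5), of s] that by simp
  have "\<forall>\<^sub>F s in near \<omega>. g' s = h' s"
    unfolding eventually_near_char_ext[OF gpairD(2)[OF g]] using *(3,4) a(1) X by blast
  moreover have "\<omega>' = \<omega>" using a(1) b(1) by simp
  moreover from this have "\<forall>\<^sub>F s in near \<omega>. h s = h' s" using b(3) by simp
  moreover have "\<forall>\<^sub>F s in near \<omega>. g s = h s"
    using a(3) calculation(1,3) by eventually_elim simp
  ultimately show "\<omega>' = \<omega> \<and> (\<forall>\<^sub>F s in near \<omega>. g s = h s)" by blast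
next
  assume *: "\<omega>' = \<omega> \<and> (\<forall>\<^sub>F s in near \<omega>. g s = h s)"
  then obtain X where X: "X \<in> constructible_diffs" "char_ext \<omega> X" "\<forall>s\<in>X. g s = h s"
    using eventually_near_char_ext[OF gpairD(2)[OF g]] by blast
  then have "g |` X = h |` X" by (auto simp: restrict_map_def)
  moreover have "germ g \<omega> \<in> arrows GP" "germ h \<omega>' \<in> arrows GP" using g h arrows_GP by blast+
  ultimately show "(germ g \<omega>, germ h \<omega>') \<in> GP_rel" unfolding GP_rel_def using X * by blast
qed

lemma equiv_GP_rel: "equiv (arrows GP) (GP_rel :: ('a::left_cancellative_monoid germ \<times> 'a germ) set)"
proof (rule equivI)
  show "(GP_rel :: ('a germ \<times> 'a germ) set) \<subseteq> arrows GP \<times> arrows GP" by (auto simp: GP_rel_def)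
  show "refl_on (arrows GP) (GP_rel :: ('a germ \<times> 'a germ) set)"
    by (rule refl_onI) (auto simp: arrows_GP GP_rel_iff)
  show "sym (GP_rel :: ('a germ \<times> 'a germ) set)"
  proof (rule symI)
    fix \<gamma> \<delta> :: "'a germ" assume *: "(\<gamma>, \<delta>) \<in> GP_rel"
    then have "\<gamma> \<in> arrows GP" "\<delta> \<in> arrows GP" by (auto simp: GP_rel_def)
    then obtain g \<omega> h \<omega>' where "\<gamma> = germ g \<omega>" "gpair g \<omega>" "\<delta> = germ h \<omega>'" "gpair h \<omega>'"
      unfolding arrows_GP by blast
    then show "(\<delta>, \<gamma>) \<in> GP_rel" using * by (auto simp: GP_rel_iff eq_commute)
  qed
  show "trans (GP_rel :: ('a germ \<times> 'a germ) set)"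
  proof (rule transI)
    fix \<gamma> \<delta> \<epsilon> :: "'a germ" assume *: "(\<gamma>, \<delta>) \<in> GP_rel" "(\<delta>, \<epsilon>) \<in> GP_rel"
    then have "\<gamma> \<in> arrows GP" "\<delta> \<in> arrows GP" "\<epsilon> \<in> arrows GP" by (auto simp: GP_rel_def)
    then obtain g \<omega> h \<omega>' k \<omega>'' where "\<gamma> = germ g \<omega>" "gpair g \<omega>" "\<delta> = germ h \<omega>'" "gpair h \<omega>'"
      "\<epsilon> = germ k \<omega>''" "gpair k \<omega>''"
      unfolding arrows_GP by blast
    moreover from this have "\<omega>' = \<omega>" "\<omega>'' = \<omega>" "\<forall>\<^sub>F s in near \<omega>. g s = h s" "\<forall>\<^sub>F s in near \<omega>. h s = k s"
      using * by (auto simp: GP_rel_iff)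
    moreover from this(3,4) have "\<forall>\<^sub>F s in near \<omega>. g s = k s" by eventually_elim simp
    ultimately show "(\<gamma>, \<epsilon>) \<in> GP_rel" by (simp add: GP_rel_iff)
  qed
qed

lemma GS_class_eq_iff:
  assumes g: "gpair g \<omega>" and h: "gpair h \<omega>'"
  shows "GS_class g \<omega> = GS_class h \<omega>' \<longleftrightarrow> \<omega>' = \<omega> \<and> (\<forall>\<^sub>F s in near \<omega>. g s = h s)"
proof -
  have "germ g \<omega> \<in> arrows GP" "germ h \<omega>' \<in> arrows GP" using g h arrows_GP by blast+
  then show ?thesis
    unfolding GS_class_def GP_rel_iff[OF g h, symmetric] using equiv_GP_rel by (metis eq_equiv_class_iff)
qed

lemma GS_class_eqI: "gpair g \<omega> \<Longrightarrow> gpair h \<omega> \<Longrightarrow> \<forall>\<^sub>F s in near \<omega>. g s = h s \<Longrightarrow> GS_class g \<omega> = GS_class h \<omega>"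
  by (simp add: GS_class_eq_iff)

lemma arrows_GS: "arrows GS = {GS_class g \<omega> | g \<omega>. gpair g \<omega>}"
  by (auto simp: GS_def quotient_groupoid_def topspace_quotient_topology quotient_def arrows_GP GS_class_def)

lemma GS_class_arrow: "gpair g \<omega> \<Longrightarrow> GS_class g \<omega> \<in> arrows GS"
  using arrows_GS by blast

lemma GS_class_mem:
  assumes "gpair g \<omega>" "\<gamma> \<in> GS_class g \<omega>"
  obtains h where "\<gamma> = germ h \<omega>" "gpair h \<omega>" "\<forall>\<^sub>F s in near \<omega>. g s = h s"
proof -
  have r: "(germ g \<omega>, \<gamma>) \<in> GP_rel" using assms(2) by (simp add: GS_class_def)
  then have "\<gamma> \<in> arrows GP" by (auto simp: GP_rel_def)
  then obtain h \<omega>' where h: "\<gamma> = germ h \<omega>'" "gpair h \<omega>'" unfolding arrows_GP by blast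
  then show ?thesis using r GP_rel_iff[OF assms(1) h(2)] that by auto
qed

lemma GS_class_self: "gpair g \<omega> \<Longrightarrow> germ g \<omega> \<in> GS_class g \<omega>"
  by (simp add: GS_class_def GP_rel_iff)

lemma GP_Image:
  assumes "gpair g \<omega>" "germ g \<omega> \<in> B"
    "\<And>\<gamma>. \<gamma> \<in> B \<Longrightarrow> \<exists>h. \<gamma> = germ h \<omega> \<and> gpair h \<omega> \<and> (\<forall>\<^sub>F s in near \<omega>. g s = h s)"
  shows "GP_rel `` B = GS_class g \<omega>"
  unfolding GS_class_def
proof (rule equiv_Image_eq[OF equiv_GP_rel assms(2)])
  fix \<gamma> assume "\<gamma> \<in> B"
  with assms(3) obtain h where "\<gamma> = germ h \<omega>" "gpair h \<omega>" "\<forall>\<^sub>F s in near \<omega>. g s = h s" by blast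
  then show "(germ g \<omega>, \<gamma>) \<in> GP_rel" using GP_rel_iff[OF assms(1)] by simp
qed

lemma GP_ops: "gsrc GP = gsrc Paterson" "grng GP = grng Paterson" "gmul GP = gmul Paterson" "ginv GP = ginv Paterson"
  by (simp_all add: GP_def reduction_def)

lemma gsrc_GS:
  assumes g: "gpair g \<omega>"
  shows "gsrc GS (GS_class g \<omega>) = GS_class (pid UNIV) \<omega>"
proof -
  have "GP_rel `` (gsrc GP ` GS_class g \<omega>) = GS_class (pid UNIV) \<omega>"
  proof (rule GP_Image)
    show u: "gpair (pid UNIV) \<omega>" using gpair_UNIV[OF gpairD(2)[OF g]] .
    show "germ (pid UNIV) \<omega> \<in> gsrc GP ` GS_class g \<omega>"
      using GS_class_self[OF g] src_germ[OF g] by (metis GP_ops(1) image_eqI)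
    fix \<gamma> assume "\<gamma> \<in> gsrc GP ` GS_class g \<omega>"
    then obtain \<delta> where \<delta>: "\<gamma> = gsrc GP \<delta>" "\<delta> \<in> GS_class g \<omega>" by blast
    obtain h where "\<delta> = germ h \<omega>" "gpair h \<omega>" using GS_class_mem[OF g \<delta>(2)] by blast
    then show "\<exists>h. \<gamma> = germ h \<omega> \<and> gpair h \<omega> \<and> (\<forall>\<^sub>F s in near \<omega>. pid UNIV s = h s)"
      using \<delta>(1) u by (auto simp: GP_ops src_germ)
  qed
  then show ?thesis by (simp add: GS_def quotient_groupoid_def)
qed

lemma grng_GS:
  assumes g: "gpair g \<omega>"
  shows "grng GS (GS_class g \<omega>) = GS_class (pid UNIV) (conj_char g \<omega>)"
proof -
  have "GP_rel `` (grng GP ` GS_class g \<omega>) = GS_class (pid UNIV) (conj_char g \<omega>)"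
  proof (rule GP_Image)
    show u: "gpair (pid UNIV) (conj_char g \<omega>)" using gpair_UNIV[OF gpair_conj[OF g]] .
    show "germ (pid UNIV) (conj_char g \<omega>) \<in> grng GP ` GS_class g \<omega>"
      using GS_class_self[OF g] rng_germ[OF g] by (metis GP_ops(2) image_eqI)
    fix \<gamma> assume "\<gamma> \<in> grng GP ` GS_class g \<omega>"
    then obtain \<delta> where \<delta>: "\<gamma> = grng GP \<delta>" "\<delta> \<in> GS_class g \<omega>" by blast
    obtain h where h: "\<delta> = germ h \<omega>" "gpair h \<omega>" "\<forall>\<^sub>F s in near \<omega>. g s = h s" using GS_class_mem[OF g \<delta>(2)] by blast
    have "\<gamma> = germ (pid UNIV) (conj_char g \<omega>)"
      using \<delta>(1) h conj_char_germ[OF g h(2,3)] by (simp add: GP_ops rng_germ)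
    then show "\<exists>h. \<gamma> = germ h (conj_char g \<omega>) \<and> gpair h (conj_char g \<omega>) \<and> (\<forall>\<^sub>F s in near (conj_char g \<omega>). pid UNIV s = h s)"
      using u by auto
  qed
  then show ?thesis by (simp add: GS_def quotient_groupoid_def)
qed

lemma near_inv_cong:
  assumes g: "gpair g \<omega>" and h: "gpair h \<omega>" and eq: "\<forall>\<^sub>F s in near \<omega>. g s = h s"
  shows "\<forall>\<^sub>F t in near (conj_char g \<omega>). pinverse g t = pinverse h t"
  unfolding near_conj_char[OF gpairD[OF g]]
  using eq
proof eventually_elim
  case (elim s)
  show ?case
  proof (intro allI impI)
    fix t assume "g s = Some t"
    then have "pinverse g t = Some s" "pinverse h t = Some s"
      using elim gpairD(1)[OF g] gpairD(1)[OF h] by (simp_all add: pinverse_iff)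
    then show "pinverse g t = pinverse h t" by simp
  qed
qed

lemma ginv_GS:
  assumes g: "gpair g \<omega>"
  shows "ginv GS (GS_class g \<omega>) = GS_class (pinverse g) (conj_char g \<omega>)"
proof -
  have "GP_rel `` (ginv GP ` GS_class g \<omega>) = GS_class (pinverse g) (conj_char g \<omega>)"
  proof (rule GP_Image[OF gpair_inv[OF g]])
    show "germ (pinverse g) (conj_char g \<omega>) \<in> ginv GP ` GS_class g \<omega>"
      using GS_class_self[OF g] inv_germ[OF g] by (metis GP_ops(4) image_eqI)
    fix \<gamma> assume "\<gamma> \<in> ginv GP ` GS_class g \<omega>"
    then obtain \<delta> where \<delta>: "\<gamma> = ginv GP \<delta>" "\<delta> \<in> GS_class g \<omega>" by blast
    obtain h where h: "\<delta> = germ h \<omega>" "gpair h \<omega>" "\<forall>\<^sub>F s in near \<omega>. g s = h s" using GS_class_mem[OF g \<delta>(2)] by blast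
    have eq: "conj_char h \<omega> = conj_char g \<omega>" using conj_char_germ[OF g h(2,3)] by simp
    have "\<gamma> = germ (pinverse h) (conj_char g \<omega>)" using \<delta>(1) h eq by (simp add: GP_ops inv_germ)
    then show "\<exists>h. \<gamma> = germ h (conj_char g \<omega>) \<and> gpair h (conj_char g \<omega>) \<and> (\<forall>\<^sub>F s in near (conj_char g \<omega>). pinverse g s = h s)"
      using gpair_inv[OF h(2)] eq near_inv_cong[OF g h(2,3)] by auto
  qed
  then show ?thesis by (simp add: GS_def quotient_groupoid_def)
qed

lemma near_comp_cong:
  assumes h: "gpair h \<psi>" and hh: "\<forall>\<^sub>F s in near \<psi>. h s = h' s"
    and gg: "\<forall>\<^sub>F t in near (conj_char h \<psi>). g t = g' t"
  shows "\<forall>\<^sub>F s in near \<psi>. (g \<circ>\<^sub>m h) s = (g' \<circ>\<^sub>m h') s"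
  using gg[unfolded near_conj_char[OF gpairD[OF h]]] hh
  by eventually_elim (auto simp: map_comp_def split: option.splits)

lemma gmul_GS:
  assumes h: "gpair h \<psi>" and g: "gpair g (conj_char h \<psi>)"
  shows "gmul GS (GS_class g (conj_char h \<psi>)) (GS_class h \<psi>) = GS_class (g \<circ>\<^sub>m h) \<psi>"
proof -
  let ?\<omega> = "conj_char h \<psi>"
  let ?B = "{gmul GP c d | c d. c \<in> GS_class g ?\<omega> \<and> d \<in> GS_class h \<psi> \<and> gsrc GP c = grng GP d}"
  have "GP_rel `` ?B = GS_class (g \<circ>\<^sub>m h) \<psi>"
  proof (rule GP_Image[OF gpair_compI[OF h g]])
    have "gsrc GP (germ g ?\<omega>) = grng GP (germ h \<psi>)" by (simp add: GP_ops src_germ[OF g] rng_germ[OF h])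
    then show "germ (g \<circ>\<^sub>m h) \<psi> \<in> ?B"
      using GS_class_self[OF g] GS_class_self[OF h] mul_germ[OF h g, folded GP_ops] by (metis (mono_tags, lifting) mem_Collect_eq)
    fix \<gamma> assume "\<gamma> \<in> ?B"
    then obtain c d where cd: "\<gamma> = gmul GP c d" "c \<in> GS_class g ?\<omega>" "d \<in> GS_class h \<psi>" by blast
    obtain g' where g': "c = germ g' ?\<omega>" "gpair g' ?\<omega>" "\<forall>\<^sub>F s in near ?\<omega>. g s = g' s" using GS_class_mem[OF g cd(2)] by blast
    obtain h' where h': "d = germ h' \<psi>" "gpair h' \<psi>" "\<forall>\<^sub>F s in near \<psi>. h s = h' s" using GS_class_mem[OF h cd(3)] by blast
    have eq: "conj_char h' \<psi> = ?\<omega>" using conj_char_germ[OF h h'(2,3)] by simp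
    have g'': "gpair g' (conj_char h' \<psi>)" using g'(2) eq by simp
    have "\<gamma> = germ (g' \<circ>\<^sub>m h') \<psi>" using mul_germ[OF h'(2) g''] cd(1) g'(1) h'(1) eq by (simp add: GP_ops)
    then show "\<exists>k. \<gamma> = germ k \<psi> \<and> gpair k \<psi> \<and> (\<forall>\<^sub>F s in near \<psi>. (g \<circ>\<^sub>m h) s = k s)"
      using gpair_compI[OF h'(2) g''] near_comp_cong[OF h h'(3) g'(3)] by blast
  qed
  then show ?thesis by (simp add: GS_def quotient_groupoid_def)
qed

section \<open>The groupoid laws in the quotient\<close>

lemma arrows_GS_cases:
  assumes "\<gamma> \<in> arrows GS"
  obtains g \<omega> where "\<gamma> = GS_class g \<omega>" "gpair g \<omega>"
  using assms arrows_GS by blast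

lemma composable_iff:
  assumes "gpair g \<omega>" "gpair h \<psi>"
  shows "gsrc GS (GS_class g \<omega>) = grng GS (GS_class h \<psi>) \<longleftrightarrow> \<omega> = conj_char h \<psi>"
  unfolding gsrc_GS[OF assms(1)] grng_GS[OF assms(2)]
    GS_class_eq_iff[OF gpair_UNIV[OF gpairD(2)[OF assms(1)]] gpair_UNIV[OF gpair_conj[OF assms(2)]]]
  by auto

lemma composable_cases:
  assumes "\<gamma> \<in> arrows GS" "\<delta> \<in> arrows GS" "gsrc GS \<gamma> = grng GS \<delta>"
  obtains g h \<psi> where "\<gamma> = GS_class g (conj_char h \<psi>)" "\<delta> = GS_class h \<psi>" "gpair h \<psi>" "gpair g (conj_char h \<psi>)"
proof -
  obtain g \<omega> where g: "\<gamma> = GS_class g \<omega>" "gpair g \<omega>" using arrows_GS_cases[OF assms(1)] .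
  obtain h \<psi> where h: "\<delta> = GS_class h \<psi>" "gpair h \<psi>" using arrows_GS_cases[OF assms(2)] .
  have "\<omega> = conj_char h \<psi>" using assms(3) composable_iff[OF g(2) h(2)] g(1) h(1) by simp
  with g h show ?thesis using that by blast
qed

lemma conj_char_comp:
  "gpair h \<psi> \<Longrightarrow> gpair g (conj_char h \<psi>) \<Longrightarrow> conj_char (g \<circ>\<^sub>m h) \<psi> = conj_char g (conj_char h \<psi>)"
  by (simp add: gpair_def conj_char_conj_char)

lemma conj_char_pinverse: "gpair g \<omega> \<Longrightarrow> conj_char (pinverse g) (conj_char g \<omega>) = \<omega>"
  by (simp add: gpair_def conj_char_inv)

lemma groupoid_GS: "groupoid (GS :: 'a::left_cancellative_monoid germ set top_groupoid)"
proof
  fix \<gamma> :: "'a germ set" assume \<gamma>: "\<gamma> \<in> arrows GS"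
  then obtain g \<omega> where g: "\<gamma> = GS_class g \<omega>" "gpair g \<omega>" using arrows_GS_cases by blast
  note u = gpair_UNIV[OF gpairD(2)[OF g(2)]] and i = gpair_inv[OF g(2)]
  note u' = gpair_UNIV[OF gpair_conj[OF g(2)]]
  have g0: "g \<in> left_hull" using gpairD(1)[OF g(2)] .
  show "gsrc GS \<gamma> \<in> arrows GS" by (simp add: g gsrc_GS GS_class_arrow u)
  show "gsrc GS (gsrc GS \<gamma>) = gsrc GS \<gamma>" by (simp add: g gsrc_GS u)
  show "ginv GS \<gamma> \<in> arrows GS" by (simp add: g ginv_GS GS_class_arrow i)
  show "gsrc GS (ginv GS \<gamma>) = grng GS \<gamma>" by (simp add: g ginv_GS gsrc_GS grng_GS i)
  show "grng GS (ginv GS \<gamma>) = gsrc GS \<gamma>" by (simp add: g ginv_GS gsrc_GS grng_GS i conj_char_pinverse)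
  show "ginv GS (ginv GS \<gamma>) = \<gamma>" by (simp add: g ginv_GS i conj_char_pinverse pinverse_pinverse g0)
  have "ginv GS (gsrc GS \<gamma>) = GS_class (pid UNIV) \<omega>"
    using u gpairD(2)[OF g(2)] by (simp add: g gsrc_GS ginv_GS conj_char_UNIV)
  then show "gmul GS \<gamma> (ginv GS (gsrc GS \<gamma>)) = \<gamma>"
    using gmul_GS[OF u, of g] gpairD(2)[OF g(2)] g by (simp add: conj_char_UNIV)
next
  fix \<gamma> \<delta> :: "'a germ set" assume "\<gamma> \<in> arrows GS" "\<delta> \<in> arrows GS" "gsrc GS \<gamma> = grng GS \<delta>"
  then obtain g h \<psi> where e: "\<gamma> = GS_class g (conj_char h \<psi>)" "\<delta> = GS_class h \<psi>"
    and h: "gpair h \<psi>" and g: "gpair g (conj_char h \<psi>)"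
    using composable_cases by blast
  note gh = gpair_compI[OF h g]
  have c: "conj_char (g \<circ>\<^sub>m h) \<psi> = conj_char g (conj_char h \<psi>)" by (rule conj_char_comp[OF h g])
  show "gmul GS \<gamma> \<delta> \<in> arrows GS" by (simp add: e gmul_GS[OF h g] GS_class_arrow gh)
  show "gsrc GS (gmul GS \<gamma> \<delta>) = gsrc GS \<delta>" by (simp add: e gmul_GS[OF h g] gsrc_GS gh h)
  show "grng GS (gmul GS \<gamma> \<delta>) = grng GS \<gamma>" by (simp add: e gmul_GS[OF h g] grng_GS gh g c)
  show "gmul GS (ginv GS \<gamma>) (gmul GS \<gamma> \<delta>) = \<delta>"
  proof -
    have i: "gpair (pinverse g) (conj_char (g \<circ>\<^sub>m h) \<psi>)" using gpair_inv[OF g] c by simp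
    have "gmul GS (ginv GS \<gamma>) (gmul GS \<gamma> \<delta>) = GS_class (pinverse g \<circ>\<^sub>m (g \<circ>\<^sub>m h)) \<psi>"
      using gmul_GS[OF gh i] by (simp add: e gmul_GS[OF h g] ginv_GS[OF g] c)
    \<comment> \<open>The product with the inverse is only a restriction of \<open>h\<close>; the
      two agree wherever \<open>g \<circ>\<^sub>m h\<close> is defined, which is eventually the
      case.\<close>
    also have "\<dots> = GS_class h \<psi>"
    proof (rule GS_class_eqI[OF gpair_compI[OF gh i] h])
      show "\<forall>\<^sub>F s in near \<psi>. (pinverse g \<circ>\<^sub>m (g \<circ>\<^sub>m h)) s = h s"
        using gpair_near[OF gh]
        by eventually_elim (auto simp: map_comp_def pinverse_iff[OF gpairD(1)[OF g]] split: option.splits)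
    qed
    finally show ?thesis using e by simp
  qed
  show "ginv GS (gmul GS \<gamma> \<delta>) = gmul GS (ginv GS \<delta>) (ginv GS \<gamma>)"
  proof -
    have i: "gpair (pinverse h) (conj_char (pinverse g) (conj_char g (conj_char h \<psi>)))"
      using gpair_inv[OF h] conj_char_pinverse[OF g] by simp
    have "gmul GS (ginv GS \<delta>) (ginv GS \<gamma>) = GS_class (pinverse h \<circ>\<^sub>m pinverse g) (conj_char g (conj_char h \<psi>))"
      using gmul_GS[OF gpair_inv[OF g] i] by (simp add: e ginv_GS h g conj_char_pinverse)
    then show ?thesis
      by (simp add: e gmul_GS[OF h g] ginv_GS[OF gh] c pinverse_comp gpairD(1)[OF h] gpairD(1)[OF g])
  qed
  fix \<epsilon> :: "'a germ set" assume "\<epsilon> \<in> arrows GS" "gsrc GS \<delta> = grng GS \<epsilon>"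
  then obtain k \<phi> where k: "\<epsilon> = GS_class k \<phi>" "gpair k \<phi>" using arrows_GS_cases by blast
  have \<psi>: "\<psi> = conj_char k \<phi>"
    using composable_iff[OF h k(2)] e(2) k(1) \<open>gsrc GS \<delta> = grng GS \<epsilon>\<close> by simp
  have h': "gpair h (conj_char k \<phi>)" using h \<psi> by simp
  have g': "gpair g (conj_char (h \<circ>\<^sub>m k) \<phi>)" using g \<psi> conj_char_comp[OF k(2) h'] by simp
  have gh': "gpair (g \<circ>\<^sub>m h) (conj_char k \<phi>)" using gh \<psi> by simp
  have "gmul GS (gmul GS \<gamma> \<delta>) \<epsilon> = GS_class ((g \<circ>\<^sub>m h) \<circ>\<^sub>m k) \<phi>"
    using gmul_GS[OF k(2) gh'] unfolding e k(1) gmul_GS[OF h g] by (simp add: \<psi>)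
  moreover have "gmul GS \<gamma> (gmul GS \<delta> \<epsilon>) = GS_class (g \<circ>\<^sub>m (h \<circ>\<^sub>m k)) \<phi>"
    using gmul_GS[OF gpair_compI[OF k(2) h'] g'] gmul_GS[OF k(2) h'] conj_char_comp[OF k(2) h'] \<psi> by (simp add: e k)
  ultimately show "gmul GS (gmul GS \<gamma> \<delta>) \<epsilon> = gmul GS \<gamma> (gmul GS \<delta> \<epsilon>)" by (simp add: map_comp_assoc)
qed

interpretation GS: groupoid GS
  by (rule groupoid_GS)

section \<open>Units, source fibres and quotients within a fibre\<close>

lemma gunits_GS: "gunits GS = GS_class (pid UNIV) ` Omega"
proof (intro equalityI subsetI)
  fix x :: "'a germ set" assume "x \<in> gunits GS"
  then obtain g \<omega> where "gpair g \<omega>" "x = gsrc GS (GS_class g \<omega>)" unfolding gunits_def arrows_GS by blast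
  then show "x \<in> GS_class (pid UNIV) ` Omega" using gsrc_GS gpairD(2) by blast
next
  fix x :: "'a germ set" assume "x \<in> GS_class (pid UNIV) ` Omega"
  then obtain \<omega> where "\<omega> \<in> Omega" "x = GS_class (pid UNIV) \<omega>" by blast
  then have "x = gsrc GS (GS_class (pid UNIV) \<omega>)" "GS_class (pid UNIV) \<omega> \<in> arrows GS"
    using gsrc_GS[OF gpair_UNIV] GS_class_arrow[OF gpair_UNIV] by auto
  then show "x \<in> gunits GS" unfolding gunits_def by blast
qed

lemma src_fibre_GS:
  assumes \<omega>: "\<omega> \<in> Omega"
  shows "src_fibre GS (GS_class (pid UNIV) \<omega>) = {GS_class g \<omega> | g. gpair g \<omega>}"
proof (intro equalityI subsetI)
  fix \<gamma> assume \<gamma>: "\<gamma> \<in> src_fibre GS (GS_class (pid UNIV) \<omega>)"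
  then obtain g \<omega>' where g: "\<gamma> = GS_class g \<omega>'" "gpair g \<omega>'" using arrows_GS_cases by (auto simp: src_fibre_def)
  have "GS_class (pid UNIV) \<omega>' = GS_class (pid UNIV) \<omega>" using \<gamma> g(1) gsrc_GS[OF g(2)] by (simp add: src_fibre_def)
  then have "\<omega> = \<omega>'" using GS_class_eq_iff[OF gpair_UNIV gpair_UNIV] \<omega> gpairD(2)[OF g(2)] by blast
  with g show "\<gamma> \<in> {GS_class g \<omega> | g. gpair g \<omega>}" by blast
qed (auto simp: src_fibre_def gsrc_GS GS_class_arrow)

lemma GS_class_fibre: "gpair g \<omega> \<Longrightarrow> GS_class g \<omega> \<in> src_fibre GS (GS_class (pid UNIV) \<omega>)"
  using src_fibre_GS gpairD(2) by blast

lemma gpair_div: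
  assumes "gpair a \<omega>" "gpair b \<omega>"
  shows "gpair (a \<circ>\<^sub>m pinverse b) (conj_char b \<omega>)"
  by (rule gpair_compI[OF gpair_inv[OF assms(2)]]) (simp add: conj_char_pinverse assms)

lemma gdiv_GS:
  assumes "gpair a \<omega>" "gpair b \<omega>"
  shows "GS.gdiv (GS_class a \<omega>) (GS_class b \<omega>) = GS_class (a \<circ>\<^sub>m pinverse b) (conj_char b \<omega>)"
proof -
  have a: "gpair a (conj_char (pinverse b) (conj_char b \<omega>))" using assms by (simp add: conj_char_pinverse)
  show ?thesis
    using gmul_GS[OF gpair_inv[OF assms(2)] a] by (simp add: GS.gdiv_def ginv_GS[OF assms(2)] conj_char_pinverse assms)
qed

section \<open>The topology\<close>

definition char_dom :: "('a::left_cancellative_monoid \<rightharpoonup> 'a) \<Rightarrow> 'a semichar set" where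
  "char_dom g = Omega \<inter> {\<omega>. \<omega> (pid (dom g))}"

lemma gpair_iff_char_dom: "g \<in> left_hull \<Longrightarrow> gpair g \<omega> \<longleftrightarrow> \<omega> \<in> char_dom g"
  by (simp add: gpair_def char_dom_def)

lemma Dm_subset: "char_dom g \<subseteq> Omega"
  by (simp add: char_dom_def)

lemma openin_char_dom: "open W \<Longrightarrow> openin (top_of_set Omega) (char_dom g \<inter> W)"
  unfolding char_dom_def Int_assoc by (intro openin_open_Int open_Int open_eval)

lemma compact_char_dom: "closed W \<Longrightarrow> compact (char_dom g \<inter> W)"
  unfolding char_dom_def Int_assoc by (intro compact_Int_closed compact_Omega closed_Int closed_eval)

lemma inj_GS_class: "g \<in> left_hull \<Longrightarrow> inj_on (GS_class g) (char_dom g)"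
  by (rule inj_onI) (simp add: GS_class_eq_iff flip: gpair_iff_char_dom)

lemma GS_gtop: "gtop GS = quotient_topology (gtop GP) GP_rel"
  by (simp add: GS_def quotient_groupoid_def)

lemma GP_gtop: "gtop GP = subtopology (gtop Paterson) {\<gamma>. gsrc Paterson \<gamma> \<in> germ (pid UNIV) ` Omega}"
  by (simp add: GP_def reduction_def)

text \<open>If \<open>g\<close> and \<open>h\<close> have the same germ at one character, they agree
  on an ideal \<open>X\<close>, and then have the same germ at all characters in both domains that
  take the value 1 at \<open>X\<close>. This is an open condition.\<close>

lemma continuous_germ:
  fixes g :: "'a::left_cancellative_monoid \<rightharpoonup> 'a"
  assumes g: "g \<in> left_hull"
  shows "continuous_map (top_of_set (char_dom g)) (gtop GP) (germ g)"
  unfolding GP_gtop continuous_map_in_subtopology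
proof
  let ?B = "{germ_basic g U | (g :: 'a \<rightharpoonup> 'a) U. g \<in> left_hull \<and>
              openin semichar_topology U \<and> U \<subseteq> {\<omega>. \<omega> (pinverse g \<circ>\<^sub>m g)}}"
  have top: "gtop Paterson = topology_generated_by ?B" by (simp add: Paterson_def)
  have arr: "germ g \<omega> \<in> topspace (gtop Paterson)" if "\<omega> \<in> char_dom g" for \<omega>
    using that gpair_germ_pairs gpair_iff_char_dom[OF g] unfolding topspace_Paterson by blast
  show "continuous_map (top_of_set (char_dom g)) (gtop Paterson) (germ g)"
    unfolding top continuous_on_generated_topo_iff
  proof (intro conjI allI impI)
    show "germ g ` topspace (top_of_set (char_dom g)) \<subseteq> \<Union>?B"
      using arr unfolding top topology_generated_by_topspace by auto
    fix V assume "V \<in> ?B"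
    then obtain h U where V: "V = germ_basic h U" "h \<in> left_hull" "openin semichar_topology U"
        "U \<subseteq> {\<omega>. \<omega> (pinverse h \<circ>\<^sub>m h)}" by blast
    obtain U' where U': "open U'" "U = semichars \<inter> U'"
      using V(3) by (auto simp: semichar_topology_def openin_open)
    show "openin (top_of_set (char_dom g)) (germ g -` V \<inter> topspace (top_of_set (char_dom g)))"
    proof (subst openin_subopen, intro ballI)
      fix \<omega> assume \<omega>: "\<omega> \<in> germ g -` V \<inter> topspace (top_of_set (char_dom g))"
      then have gp: "gpair g \<omega>" using gpair_iff_char_dom[OF g] by simp
      obtain \<omega>' where \<omega>': "germ g \<omega> = germ h \<omega>'" "\<omega>' \<in> U" using \<omega> V(1) by (auto simp: germ_basic_def)
      have eq: "\<omega>' = \<omega>" "gpair h \<omega>" using germ_eqD[OF gp \<omega>'(1)] by auto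
      have "(h, \<omega>) \<in> germ g \<omega>" using \<omega>'(1) eq germ_self[OF eq(2)] by simp
      from germ_mem(4)[OF gp this] obtain X where X: "X \<in> constructible" "\<omega> (pid X)" "\<forall>s\<in>X. g s = h s"
        unfolding germ_rel_iff[OF gp] by blast
      let ?T = "char_dom g \<inter> (U' \<inter> {\<omega>. \<omega> (pid X)})"
      have "openin (top_of_set (char_dom g)) ?T" using U'(1) by (intro openin_open_Int open_Int open_eval)
      moreover have "\<omega> \<in> ?T" using \<omega> X(2) \<omega>'(2) eq(1) U'(2) by auto
      moreover have "?T \<subseteq> germ g -` V \<inter> topspace (top_of_set (char_dom g))"
      proof
        fix \<phi> assume \<phi>: "\<phi> \<in> ?T"
        have g\<phi>: "gpair g \<phi>" using \<phi> gpair_iff_char_dom[OF g] by simp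
        have \<phi>U: "\<phi> \<in> U" using \<phi> U'(2) Omega_subset Dm_subset by blast
        have "\<phi> (pid (dom h))" using \<phi>U V(4) pinverse_comp_self[OF V(2)] by auto
        then have "gpair h \<phi>" using V(2) gpairD(2)[OF g\<phi>] by (simp add: gpair_def)
        then have "((g, \<phi>), (h, \<phi>)) \<in> germ_rel" unfolding germ_rel_iff[OF g\<phi>] using X(1,3) \<phi> by blast
        then have "germ g \<phi> = germ h \<phi>" unfolding germ_def by (rule equiv_class_eq[OF equiv_germ_rel])
        then show "\<phi> \<in> germ g -` V \<inter> topspace (top_of_set (char_dom g))" using \<phi> \<phi>U V(1) by (auto simp: germ_basic_def)
      qed
      ultimately show "\<exists>T. openin (top_of_set (char_dom g)) T \<and> \<omega> \<in> T \<and> T \<subseteq> germ g -` V \<inter> topspace (top_of_set (char_dom g))"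
        by blast
    qed
  qed
  show "germ g \<in> topspace (top_of_set (char_dom g)) \<rightarrow> {\<gamma>. gsrc Paterson \<gamma> \<in> germ (pid UNIV) ` Omega}"
  proof
    fix \<omega> assume "\<omega> \<in> topspace (top_of_set (char_dom g))"
    then have "gpair g \<omega>" using gpair_iff_char_dom[OF g] by simp
    then show "germ g \<omega> \<in> {\<gamma>. gsrc Paterson \<gamma> \<in> germ (pid UNIV) ` Omega}"
      by (simp add: src_germ gpairD(2))
  qed
qed

lemma continuous_GS_class:
  assumes "g \<in> left_hull"
  shows "continuous_map (top_of_set (char_dom g)) (gtop GS) (GS_class g)"
proof -
  have "continuous_map (gtop GP) (gtop GS) (\<lambda>\<gamma>. GP_rel `` {\<gamma>})"
    unfolding GS_gtop by (rule quotient_imp_continuous_map[OF quotient_map_quotient_topology])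
  from continuous_map_compose[OF continuous_germ[OF assms] this] show ?thesis
    by (simp add: o_def GS_class_def[abs_def])
qed

text \<open>Openness in the quotient needs the saturation of a bisection to be open: a germ of
  \<open>h\<close> equivalent to one of \<open>g\<close> at \<open>\<omega>\<close> stays equivalent
  to it at nearby characters.\<close>

lemma open_GS_class:
  fixes g :: "'a::left_cancellative_monoid \<rightharpoonup> 'a"
  assumes g: "g \<in> left_hull" and U: "openin (top_of_set Omega) U" "U \<subseteq> char_dom g"
  shows "openin (gtop GS) (GS_class g ` U)"
  unfolding GS_gtop openin_quotient_topology
proof
  have gU: "gpair g \<omega>" if "\<omega> \<in> U" for \<omega> using that U(2) gpair_iff_char_dom[OF g] by blast
  show "GS_class g ` U \<subseteq> arrows GP // GP_rel"
    using gU GS_class_arrow unfolding topspace_quotient_topology[symmetric] GS_gtop[symmetric] by blast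
  obtain U' where U': "open U'" "U = Omega \<inter> U'" using U(1) by (auto simp: openin_open)
  let ?P = "{x \<in> arrows GP. GP_rel `` {x} \<in> GS_class g ` U}"
  show "openin (gtop GP) ?P"
  proof (subst openin_subopen, intro ballI)
    fix \<gamma> assume \<gamma>: "\<gamma> \<in> ?P"
    then obtain h \<omega> where h: "\<gamma> = germ h \<omega>" "gpair h \<omega>" unfolding arrows_GP by blast
    obtain \<omega>' where \<omega>': "\<omega>' \<in> U" "GS_class h \<omega> = GS_class g \<omega>'" using \<gamma> h(1) by (auto simp: GS_class_def)
    then have eq: "\<omega>' = \<omega>" "\<forall>\<^sub>F s in near \<omega>. h s = g s" using GS_class_eq_iff[OF h(2) gU] by auto
    then obtain X F where XF: "X \<in> constructible" "finite F" "F \<subseteq> constructible" "\<omega> (pid X)"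
        "\<forall>Z\<in>F. \<not> \<omega> (pid Z)" "\<forall>s\<in>X - \<Union>F. h s = g s"
      unfolding eventually_near_iff[OF gpairD(2)[OF h(2)]] by (elim exE conjE) (rule that)
    \<comment> \<open>The conditions at \<open>X\<close> and \<open>F\<close> keep
      \<open>X - \<Union>F\<close> in the filter of each character in this open set, so the
      agreement of \<open>h\<close> and \<open>g\<close> there persists; the rest keeps the
      character in \<open>U\<close> and in the domain of \<open>h\<close>.\<close>
    let ?O = "U' \<inter> ({\<omega>. \<omega> (pid X)} \<inter> ((\<Inter>Z\<in>F. {\<omega>. \<not> \<omega> (pid Z)}) \<inter> {\<omega>. \<omega> (pid (dom h))}))"
    have hh: "h \<in> left_hull" using gpairD(1)[OF h(2)] .
    have O: "open ?O" by (intro open_Int open_INT ballI open_eval U'(1) XF(2))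
    have "openin semichar_topology (semichars \<inter> ?O)"
      unfolding semichar_topology_def by (rule openin_open_Int[OF O])
    moreover have "semichars \<inter> ?O \<subseteq> {\<omega>. \<omega> (pinverse h \<circ>\<^sub>m h)}" using pinverse_comp_self[OF hh] by auto
    ultimately have "germ_basic h (semichars \<inter> ?O) \<in> {germ_basic g U | (g :: 'a \<rightharpoonup> 'a) U. g \<in> left_hull \<and>
              openin semichar_topology U \<and> U \<subseteq> {\<omega>. \<omega> (pinverse g \<circ>\<^sub>m g)}}" using hh by blast
    then have "openin (gtop Paterson) (germ_basic h (semichars \<inter> ?O))"
      unfolding Paterson_def by (simp, intro topology_generated_by_Basis) simp
    moreover define T where "T = germ_basic h (semichars \<inter> ?O) \<inter> {\<gamma>. gsrc Paterson \<gamma> \<in> germ (pid UNIV) ` Omega}"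
    ultimately have op: "openin (gtop GP) T" unfolding GP_gtop by (simp only: openin_subtopology_Int)
    have "\<omega> \<in> semichars \<inter> ?O"
      using XF(4,5) \<omega>'(1) eq(1) U'(2) gpairD[OF h(2)] Omega_subset by auto
    then have "\<gamma> \<in> germ_basic h (semichars \<inter> ?O)" using h(1) by (auto simp: germ_basic_def)
    then have "\<gamma> \<in> T" using src_germ[OF h(2)] gpairD(2)[OF h(2)] h(1) by (simp add: T_def)
    moreover have "T \<subseteq> ?P"
    proof
      fix \<delta> assume \<delta>': "\<delta> \<in> T"
      then have \<delta>: "\<delta> \<in> germ_basic h (semichars \<inter> ?O) \<inter> arrows GP"
        using openin_subset[OF op] by (auto simp: T_def)
      then obtain \<phi> where \<phi>: "\<delta> = germ h \<phi>" "\<phi> \<in> ?O" by (auto simp: germ_basic_def)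
      obtain k \<psi> where k: "germ k \<psi> = germ h \<phi>" "gpair k \<psi>" using \<delta> \<phi>(1) unfolding arrows_GP by auto
      have h\<phi>: "gpair h \<phi>" using germ_eqD[OF k(2,1)] by simp
      have \<phi>U: "\<phi> \<in> U" using \<phi>(2) U'(2) gpairD(2)[OF h\<phi>] by blast
      have "\<forall>\<^sub>F s in near \<phi>. h s = g s"
        unfolding eventually_near_iff[OF gpairD(2)[OF h\<phi>]]
        by (rule exI[of _ X], rule exI[of _ F]) (use XF \<phi>(2) in auto)
      then have "GS_class h \<phi> = GS_class g \<phi>" by (rule GS_class_eqI[OF h\<phi> gU[OF \<phi>U]])
      then show "\<delta> \<in> ?P" using \<delta> \<phi>(1) \<phi>U by (auto simp: GS_class_def)
    qed
    ultimately show "\<exists>T. openin (gtop GP) T \<and> \<gamma> \<in> T \<and> T \<subseteq> ?P" using op by blast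
  qed
qed

lemma compact_GS_class:
  assumes "g \<in> left_hull" "closed W"
  shows "compactin (gtop GS) (GS_class g ` (char_dom g \<inter> W))"
  by (rule image_compactin[OF _ continuous_GS_class[OF assms(1)]])
    (simp add: compactin_subtopology compact_char_dom assms)

text \<open>Distinct arrows in one basic bisection have distinct characters and are separated by a
  coordinate. Arrows in different bisections over the same character may be inseparable.\<close>

lemma Hausdorff_GS_class:
  assumes g: "g \<in> left_hull"
  shows "Hausdorff_space (subtopology (gtop GS) (GS_class g ` char_dom g))"
  unfolding Hausdorff_space_def
proof (intro allI impI; elim conjE)
  let ?V = "GS_class g ` char_dom g"
  fix \<gamma> \<delta> assume "\<gamma> \<in> topspace (subtopology (gtop GS) ?V)" "\<delta> \<in> topspace (subtopology (gtop GS) ?V)" "\<gamma> \<noteq> \<delta>"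
  then obtain \<omega> \<psi> where *: "\<omega> \<in> char_dom g" "\<psi> \<in> char_dom g" "\<gamma> = GS_class g \<omega>" "\<delta> = GS_class g \<psi>" "\<omega> \<noteq> \<psi>" by auto
  then obtain p where p: "\<omega> p \<noteq> \<psi> p" by (auto simp: fun_eq_iff)
  let ?A = "GS_class g ` (char_dom g \<inter> {\<phi>. \<phi> p})" and ?B = "GS_class g ` (char_dom g \<inter> {\<phi>. \<not> \<phi> p})"
  have op: "openin (gtop GS) (GS_class g ` (char_dom g \<inter> W))" if "open W" for W
    by (rule open_GS_class[OF g openin_char_dom[OF that]]) simp
  have sub: "openin (subtopology (gtop GS) ?V) (GS_class g ` (char_dom g \<inter> W))" if "open W" for W
  proof -
    have "GS_class g ` (char_dom g \<inter> W) \<subseteq> ?V" by blast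
    then show ?thesis using openin_subtopology_Int2[OF op[OF that], of ?V] by (simp only: inf.absorb2)
  qed
  have d: "disjnt ?A ?B" using inj_GS_class[OF g] by (auto simp: disjnt_def inj_on_def)
  show "\<exists>U V. openin (subtopology (gtop GS) ?V) U \<and> openin (subtopology (gtop GS) ?V) V \<and> \<gamma> \<in> U \<and> \<delta> \<in> V \<and> disjnt U V"
  proof (cases "\<omega> p")
    case True
    then have "\<gamma> \<in> ?A" "\<delta> \<in> ?B" using p * by auto
    then show ?thesis using sub[OF open_eval(1)[of p]] sub[OF open_eval(2)[of p]] d by blast
  next
    case False
    then have "\<gamma> \<in> ?B" "\<delta> \<in> ?A" using p * by auto
    then show ?thesis using sub[OF open_eval(1)[of p]] sub[OF open_eval(2)[of p]] d disjnt_sym by blast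
  qed
qed

section \<open>Functions supported on basic bisections\<close>

text \<open>Extension by zero from the open bisection of \<open>g\<close>; it need not be continuous
  on the whole groupoid. Only the values of \<open>\<phi>\<close> on \<open>char_dom g\<close>
  matter.\<close>

definition bisection_fn :: "('a::left_cancellative_monoid \<rightharpoonup> 'a) \<Rightarrow> ('a semichar \<Rightarrow> complex) \<Rightarrow> 'a germ set \<Rightarrow> complex" where
  "bisection_fn g \<phi> \<gamma> = (if \<gamma> \<in> GS_class g ` char_dom g then \<phi> (the_inv_into (char_dom g) (GS_class g) \<gamma>) else 0)"

lemma bisection_fn_self: "g \<in> left_hull \<Longrightarrow> \<omega> \<in> char_dom g \<Longrightarrow> bisection_fn g \<phi> (GS_class g \<omega>) = \<phi> \<omega>"
  by (simp add: bisection_fn_def the_inv_into_f_f inj_GS_class)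

lemma bisection_fn_off: "\<gamma> \<notin> GS_class g ` char_dom g \<Longrightarrow> bisection_fn g \<phi> \<gamma> = 0"
  by (simp add: bisection_fn_def)

lemma bisection_fn_GS_class:
  assumes g: "g \<in> left_hull" and h: "gpair h \<omega>"
  shows "bisection_fn g \<phi> (GS_class h \<omega>) = (if \<forall>\<^sub>F s in near \<omega>. h s = g s then \<phi> \<omega> else 0)"
proof (cases "\<forall>\<^sub>F s in near \<omega>. h s = g s")
  case True
  then have "gpair g \<omega>" using conj_char_cong(2) g gpairD[OF h] by (auto simp: gpair_def)
  then have "GS_class h \<omega> = GS_class g \<omega>" "\<omega> \<in> char_dom g" using GS_class_eqI[OF h] True gpair_iff_char_dom[OF g] by auto
  then show ?thesis using True bisection_fn_self[OF g] by simp
next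
  case False
  have "GS_class h \<omega> \<notin> GS_class g ` char_dom g"
  proof
    assume "GS_class h \<omega> \<in> GS_class g ` char_dom g"
    then obtain \<psi> where "gpair g \<psi>" "GS_class h \<omega> = GS_class g \<psi>" using gpair_iff_char_dom[OF g] by blast
    then show False using GS_class_eq_iff[OF h] False by blast
  qed
  then show ?thesis using False by (simp add: bisection_fn_off)
qed

lemma bisection_fn_Cc:
  assumes g: "g \<in> left_hull" and \<phi>: "continuous_on (char_dom g) \<phi>"
  shows "bisection_fn g \<phi> \<in> Cc (gtop GS)"
proof (rule Cc.base)
  let ?V = "GS_class g ` char_dom g"
  have D: "openin (top_of_set Omega) (char_dom g)" using openin_char_dom[of UNIV g] by simp
  show V: "openin (gtop GS) ?V" by (rule open_GS_class[OF g D]) simp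
  show "Hausdorff_space (subtopology (gtop GS) ?V)" by (rule Hausdorff_GS_class[OF g])
  have top: "topspace (subtopology (gtop GS) ?V) = ?V" using openin_subset[OF V] by (simp add: inf.absorb2)
  have cont: "continuous_map (subtopology (gtop GS) ?V) euclidean (bisection_fn g \<phi>)"
    unfolding continuous_map_def top
  proof (intro conjI allI impI)
    fix O' :: "complex set" assume "openin euclidean O'"
    then have "open O'" by simp
    then have "openin (top_of_set (char_dom g)) (char_dom g \<inter> \<phi> -` O')" using \<phi> by (simp add: continuous_openin_preimage_gen)
    then have "openin (top_of_set Omega) (char_dom g \<inter> \<phi> -` O')" using D openin_trans by blast
    then have o: "openin (gtop GS) (GS_class g ` (char_dom g \<inter> \<phi> -` O'))" by (intro open_GS_class[OF g]) auto
    have "{x \<in> ?V. bisection_fn g \<phi> x \<in> O'} = ?V \<inter> GS_class g ` (char_dom g \<inter> \<phi> -` O')"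
      using bisection_fn_self[OF g, of _ \<phi>] by auto
    then show "openin (subtopology (gtop GS) ?V) {x \<in> ?V. bisection_fn g \<phi> x \<in> O'}"
      using openin_subtopology_Int2[OF o, of ?V] by simp
  qed auto
  \<comment> \<open>The bisection itself is compact, so the support condition holds for every
    continuous function on it.\<close>
  have "compactin (gtop GS) ?V" using compact_GS_class[OF g closed_UNIV] by simp
  then have cs: "compact_space (subtopology (gtop GS) ?V)" by (rule compact_space_subtopology)
  show "bisection_fn g \<phi> \<in> Cc_on (gtop GS) ?V"
    unfolding Cc_on_def
    by (intro CollectI conjI cont closedin_compact_space[OF cs] closedin_closure_of) (simp add: bisection_fn_off)
qed

text \<open>Scalars are absorbed into \<open>\<phi>\<close>, so that inductions have just the two
  cases of one bisection and of a sum.\<close>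

inductive_set bisection_span :: "('a::left_cancellative_monoid germ set \<Rightarrow> complex) set" where
  bisection_fn: "g \<in> left_hull \<Longrightarrow> continuous_on (char_dom g) \<phi> \<Longrightarrow> bisection_fn g \<phi> \<in> bisection_span"
| add: "f \<in> bisection_span \<Longrightarrow> f' \<in> bisection_span \<Longrightarrow> (\<lambda>\<gamma>. f \<gamma> + f' \<gamma>) \<in> bisection_span"

lemma bisection_span_scale: "f \<in> bisection_span \<Longrightarrow> (\<lambda>\<gamma>. c * f \<gamma>) \<in> bisection_span"
proof (induction rule: bisection_span.induct)
  case (bisection_fn g \<phi>)
  have "(\<lambda>\<gamma>. c * bisection_fn g \<phi> \<gamma>) = bisection_fn g (\<lambda>\<omega>. c * \<phi> \<omega>)" by (auto simp: bisection_fn_def)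
  then show ?case using bisection_span.bisection_fn[OF bisection_fn(1), of "\<lambda>\<omega>. c * \<phi> \<omega>"] bisection_fn(2) by (simp add: continuous_on_mult_left)
next
  case (add f f')
  then show ?case using bisection_span.add[OF add.IH] by (simp add: distrib_left)
qed

lemma zero_bisection_span: "(\<lambda>\<gamma> :: 'a::left_cancellative_monoid germ set. 0) \<in> bisection_span"
proof -
  have "bisection_fn (pid UNIV) (\<lambda>\<omega>. 0) = (\<lambda>\<gamma> :: 'a germ set. 0)" by (auto simp: bisection_fn_def)
  moreover have "bisection_fn (pid UNIV :: 'a \<rightharpoonup> 'a) (\<lambda>\<omega>. 0) \<in> bisection_span" by (rule bisection_span.bisection_fn) auto
  ultimately show ?thesis by simp
qed

text \<open>In place of a partition of unity, the members of the cover are split off one at a time.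
  Each is open and compact, hence clopen in the Hausdorff set \<open>V\<close>, and cutting
  \<open>f\<close> along it preserves continuity.\<close>

lemma bisection_span_of_finite_cover:
  fixes V :: "'a::left_cancellative_monoid germ set set"
  assumes V: "openin (gtop GS) V" "Hausdorff_space (subtopology (gtop GS) V)"
  shows "finite \<F> \<Longrightarrow> \<F> \<subseteq> {GS_class g ` (char_dom g \<inter> W) | g W. g \<in> left_hull \<and> open W \<and> closed W \<and> GS_class g ` (char_dom g \<inter> W) \<subseteq> V}
    \<Longrightarrow> continuous_map (subtopology (gtop GS) V) euclidean f \<Longrightarrow> (\<And>\<gamma>. \<gamma> \<notin> \<Union>\<F> \<Longrightarrow> f \<gamma> = 0) \<Longrightarrow> f \<in> bisection_span"
proof (induction \<F> arbitrary: f rule: finite_induct)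
  case empty
  then have "f = (\<lambda>\<gamma>. 0)" by auto
  then show ?case using zero_bisection_span by simp
next
  case (insert B \<F>)
  have "B \<in> {GS_class g ` (char_dom g \<inter> W) | g W. g \<in> left_hull \<and> open W \<and> closed W \<and> GS_class g ` (char_dom g \<inter> W) \<subseteq> V}"
    by (rule subsetD[OF insert.prems(1) insertI1])
  then obtain g W where B: "B = GS_class g ` (char_dom g \<inter> W)" "g \<in> left_hull" "open W" "closed W" "B \<subseteq> V" by blast
  let ?X = "subtopology (gtop GS) V"
  have topX: "topspace ?X = V" using openin_subset[OF V(1)] by (simp add: inf.absorb2)
  have oB: "openin ?X B"
  proof -
    have "openin (gtop GS) B" unfolding B(1) by (rule open_GS_class[OF B(2) openin_char_dom[OF B(3)]]) simp
    from openin_subtopology_Int2[OF this, of V] show ?thesis using B(5) by (simp only: inf.absorb2)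
  qed
  have cB: "closedin ?X B"
  proof (rule compactin_imp_closedin[OF V(2)])
    have "compactin (gtop GS) B" unfolding B(1) by (rule compact_GS_class[OF B(2,4)])
    then show "compactin ?X B" using B(5) by (simp add: compactin_subtopology)
  qed
  define f1 where "f1 = (\<lambda>\<gamma>. if \<gamma> \<in> B then f \<gamma> else 0)"
  define f2 where "f2 = (\<lambda>\<gamma>. if \<gamma> \<in> B then 0 else f \<gamma>)"
  have "f2 \<in> bisection_span"
  proof (rule insert.IH)
    show "continuous_map ?X euclidean f2"
      unfolding continuous_map_def topX
    proof (intro conjI allI impI)
      fix O' :: "complex set" assume O': "openin euclidean O'"
      have "openin ?X {x \<in> V. f x \<in> O'}" using insert.prems(2) O' unfolding continuous_map_def topX by blast
      then have "openin ?X (({x \<in> V. f x \<in> O'} - B) \<union> (if 0 \<in> O' then B else {}))"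
        using oB cB by (auto intro!: openin_Un openin_diff)
      moreover have "{x \<in> V. f2 x \<in> O'} = ({x \<in> V. f x \<in> O'} - B) \<union> (if 0 \<in> O' then B else {})"
        using B(5) by (auto simp: f2_def)
      ultimately show "openin ?X {x \<in> V. f2 x \<in> O'}" by simp
    qed auto
    show "f2 \<gamma> = 0" if "\<gamma> \<notin> \<Union>\<F>" for \<gamma> using that insert.prems(3)[of \<gamma>] by (auto simp: f2_def)
  qed (rule subset_trans[OF subset_insertI insert.prems(1)])
  moreover have "f1 \<in> bisection_span"
  proof -
    \<comment> \<open>The cover member is only the part of the bisection over \<open>W\<close>;
      extending by zero to all of \<open>char_dom g\<close> stays continuous because
      \<open>W\<close> is clopen.\<close>
    let ?\<phi> = "\<lambda>\<omega>. if \<omega> \<in> W then f (GS_class g \<omega>) else 0"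
    have c: "continuous_on (char_dom g \<inter> W) (\<lambda>\<omega>. f (GS_class g \<omega>))"
    proof -
      have "continuous_map (top_of_set (char_dom g \<inter> W)) (gtop GS) (GS_class g)"
        using continuous_map_from_subtopology[OF continuous_GS_class[OF B(2)], of W]
        by (simp add: subtopology_subtopology)
      then have "continuous_map (top_of_set (char_dom g \<inter> W)) ?X (GS_class g)"
        using B(1,5) unfolding continuous_map_in_subtopology by auto
      from continuous_map_compose[OF this insert.prems(2)] show ?thesis by (simp add: o_def)
    qed
    have "continuous_on ((char_dom g \<inter> W) \<union> (char_dom g - W)) ?\<phi>"
    proof (rule continuous_on_cases_local_open)
      have e: "(char_dom g \<inter> W) \<union> (char_dom g - W) = char_dom g" by blast
      show "openin (top_of_set ((char_dom g \<inter> W) \<union> (char_dom g - W))) (char_dom g \<inter> W)" unfolding e using B(3) by (rule openin_open_Int)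
      have "char_dom g - W = char_dom g \<inter> - W" by blast
      then show "openin (top_of_set ((char_dom g \<inter> W) \<union> (char_dom g - W))) (char_dom g - W)"
        unfolding e using openin_open_Int[of "- W" "char_dom g"] B(4) by (simp add: open_Compl)
    qed (use c in \<open>auto\<close>)
    moreover have "(char_dom g \<inter> W) \<union> (char_dom g - W) = char_dom g" by blast
    ultimately have c': "continuous_on (char_dom g) ?\<phi>" by simp
    have "f1 = bisection_fn g ?\<phi>"
    proof
      fix \<gamma>
      show "f1 \<gamma> = bisection_fn g ?\<phi> \<gamma>"
      proof (cases "\<gamma> \<in> GS_class g ` char_dom g")
        case True
        then obtain \<omega> where \<omega>: "\<omega> \<in> char_dom g" "\<gamma> = GS_class g \<omega>" by blast
        have "\<gamma> \<in> B \<longleftrightarrow> \<omega> \<in> W" unfolding B(1) using \<omega> inj_on_eq_iff[OF inj_GS_class[OF B(2)]] by blast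
        then show ?thesis using bisection_fn_self[OF B(2) \<omega>(1)] \<omega>(2) by (simp add: f1_def)
      next
        case False
        then have "\<gamma> \<notin> B" unfolding B(1) by blast
        then show ?thesis using False by (simp add: f1_def bisection_fn_off)
      qed
    qed
    then show ?thesis using bisection_span.bisection_fn[OF B(2) c'] by simp
  qed
  ultimately have "(\<lambda>\<gamma>. f1 \<gamma> + f2 \<gamma>) \<in> bisection_span" by (intro bisection_span.add)
  moreover have "(\<lambda>\<gamma>. f1 \<gamma> + f2 \<gamma>) = f" by (auto simp: f1_def f2_def)
  ultimately show ?case by simp
qed

lemma clopen_nbhd:
  fixes U :: "('b \<Rightarrow> bool) set"
  assumes "open U" "\<omega> \<in> U"
  obtains W where "open W" "closed W" "\<omega> \<in> W" "W \<subseteq> U"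
proof -
  obtain I where I: "finite I" "\<And>\<omega>'. (\<forall>i\<in>I. \<omega>' i = \<omega> i) \<Longrightarrow> \<omega>' \<in> U" using fun_basis[OF assms] by blast
  have 1: "open {\<omega>'. \<omega>' i = \<omega> i}" "closed {\<omega>'. \<omega>' i = \<omega> i}" for i
    using open_eval[of i] closed_eval[of i] by (cases "\<omega> i"; simp)+
  show ?thesis
  proof (rule that)
    show "open (\<Inter>i\<in>I. {\<omega>'. \<omega>' i = \<omega> i})" by (intro open_INT I(1) ballI 1)
    show "closed (\<Inter>i\<in>I. {\<omega>'. \<omega>' i = \<omega> i})" by (intro closed_INT ballI 1)
  qed (use I(2) in auto)
qed

text \<open>Inside \<open>V\<close> every arrow has a neighbourhood that is the part of a basic
  bisection over a clopen set. Finitely many of these cover the compact support, and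
  \<open>f\<close> vanishes off them.\<close>

lemma Cc_on_bisection_span:
  fixes V :: "'a::left_cancellative_monoid germ set set"
  assumes V: "openin (gtop GS) V" "Hausdorff_space (subtopology (gtop GS) V)" and f: "f \<in> Cc_on (gtop GS) V"
  shows "f \<in> bisection_span"
proof -
  let ?X = "subtopology (gtop GS) V"
  let ?B = "{GS_class g ` (char_dom g \<inter> W) | g W. g \<in> left_hull \<and> open W \<and> closed W \<and> GS_class g ` (char_dom g \<inter> W) \<subseteq> V}"
  have topX: "topspace ?X = V" using openin_subset[OF V(1)] by (simp add: inf.absorb2)
  define K where "K = ?X closure_of {g \<in> V. f g \<noteq> 0}"
  have f': "continuous_map ?X euclidean f" "compactin ?X K" "\<And>\<gamma>. \<gamma> \<notin> V \<Longrightarrow> f \<gamma> = 0"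
    using f by (auto simp: Cc_on_def K_def)
  have K: "compactin (gtop GS) K" "K \<subseteq> V" using f'(2) by (auto simp: compactin_subtopology)
  have oB: "openin (gtop GS) B" if B': "B \<in> ?B" for B
  proof -
    obtain g W where B: "B = GS_class g ` (char_dom g \<inter> W)" "g \<in> left_hull" "open W" using B' by blast
    show ?thesis unfolding B(1) by (rule open_GS_class[OF B(2) openin_char_dom[OF B(3)]]) simp
  qed
  have "V \<subseteq> \<Union>?B"
  proof
    fix \<gamma> assume \<gamma>: "\<gamma> \<in> V"
    then have "\<gamma> \<in> arrows GS" using openin_subset[OF V(1)] by blast
    then obtain g \<omega> where g: "\<gamma> = GS_class g \<omega>" "gpair g \<omega>" using arrows_GS_cases by blast
    have gh: "g \<in> left_hull" "\<omega> \<in> char_dom g" using gpairD(1)[OF g(2)] gpair_iff_char_dom g(2) by auto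
    have "openin (top_of_set (char_dom g)) {\<omega> \<in> char_dom g. GS_class g \<omega> \<in> V}"
      using continuous_GS_class[OF gh(1)] V(1) unfolding continuous_map_def by auto
    then obtain O' where O': "open O'" "{\<omega> \<in> char_dom g. GS_class g \<omega> \<in> V} = char_dom g \<inter> O'"
      unfolding openin_open by (elim exE conjE) (rule that)
    have "\<omega> \<in> {\<omega> \<in> char_dom g. GS_class g \<omega> \<in> V}" using gh(2) g(1) \<gamma> by simp
    then have "\<omega> \<in> O'" unfolding O'(2) by blast
    then obtain W where W: "open W" "closed W" "\<omega> \<in> W" "W \<subseteq> O'" using clopen_nbhd[OF O'(1)] by blast
    have "GS_class g \<psi> \<in> V" if "\<psi> \<in> char_dom g \<inter> W" for \<psi>
    proof -
      have "\<psi> \<in> {\<omega> \<in> char_dom g. GS_class g \<omega> \<in> V}" unfolding O'(2) using that W(4) by blast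
      then show ?thesis by simp
    qed
    then have "GS_class g ` (char_dom g \<inter> W) \<subseteq> V" by blast
    then have "GS_class g ` (char_dom g \<inter> W) \<in> ?B" using gh(1) W(1,2) by blast
    moreover have "\<gamma> \<in> GS_class g ` (char_dom g \<inter> W)" using g(1) gh(2) W(3) by blast
    ultimately show "\<gamma> \<in> \<Union>?B" by blast
  qed
  then have "K \<subseteq> \<Union>?B" using K(2) by blast
  then have "\<exists>\<F>. finite \<F> \<and> \<F> \<subseteq> ?B \<and> K \<subseteq> \<Union>\<F>"
    by (rule compactinD[OF K(1), rotated]) (rule oB)
  then obtain \<F> where \<F>: "finite \<F>" "\<F> \<subseteq> ?B" "K \<subseteq> \<Union>\<F>"
    by (elim exE conjE) (rule that)
  have "f \<gamma> = 0" if "\<gamma> \<notin> \<Union>\<F>" for \<gamma>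
  proof (rule ccontr)
    assume n: "f \<gamma> \<noteq> 0"
    then have "\<gamma> \<in> V" using f'(3) by blast
    with n have "\<gamma> \<in> K" unfolding K_def using closure_of_subset[of "{g \<in> V. f g \<noteq> 0}" ?X] topX by blast
    with \<F>(3) that show False by blast
  qed
  then show ?thesis by (rule bisection_span_of_finite_cover[OF V \<F>(1,2) f'(1)])
qed

lemma Cc_GS_eq: "Cc (gtop GS) = bisection_span"
proof (intro equalityI subsetI)
  fix f assume "f \<in> Cc (gtop GS)"
  then show "f \<in> bisection_span"
  proof (induction rule: Cc.induct)
    case (base V f)
    then show ?case by (rule Cc_on_bisection_span)
  next
    case (add f f')
    then show ?case by (intro bisection_span.add)
  next
    case (scale f c)
    then show ?case by (intro bisection_span_scale)
  qed
next
  fix f :: "'a germ set \<Rightarrow> complex" assume "f \<in> bisection_span"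
  then show "f \<in> Cc (gtop GS)"
  proof (induction rule: bisection_span.induct)
    case (bisection_fn g \<phi>)
    then show ?case by (rule bisection_fn_Cc)
  next
    case (add f f')
    then show ?case by (intro Cc.add)
  qed
qed

section \<open>Convolution algebra and sparsity\<close>

lemma finite_card_le_1:
  assumes "\<And>x y. x \<in> S \<Longrightarrow> y \<in> S \<Longrightarrow> x = y"
  shows "finite S \<and> card S \<le> 1"
proof (cases "S = {}")
  case False
  then obtain x where "S = {x}" using assms by blast
  then show ?thesis by simp
qed simp

lemma sparse_add:
  assumes "sparse A N C m" "sparse A N' C' m'"
  shows "sparse A (N + N') (C + C') (\<lambda>a b. m a b + m' a b)"
proof -
  have *: "finite S \<and> card S \<le> N + N'" if "finite S1 \<and> card S1 \<le> N" "finite S2 \<and> card S2 \<le> N'" "S \<subseteq> S1 \<union> S2"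
    for S S1 S2 :: "'a set"
  proof -
    have "finite S" using that by (meson finite_UnI finite_subset)
    have "card S \<le> card (S1 \<union> S2)" using that by (intro card_mono) auto
    also have "\<dots> \<le> card S1 + card S2" by (rule card_Un_le)
    finally show ?thesis using that \<open>finite S\<close> by simp
  qed
  show ?thesis
    unfolding sparse_def
  proof (intro conjI ballI)
    fix a assume a: "a \<in> A"
    let ?S = "{b \<in> A. m a b + m' a b \<noteq> 0}" and ?T = "{b \<in> A. m b a + m' b a \<noteq> 0}"
    have "finite ?S \<and> card ?S \<le> N + N'"
      by (rule *[of "{b \<in> A. m a b \<noteq> 0}" "{b \<in> A. m' a b \<noteq> 0}"]) (use assms a in \<open>auto simp: sparse_def\<close>)
    then show "finite ?S" "card ?S \<le> N + N'" by auto
    have "finite ?T \<and> card ?T \<le> N + N'"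
      by (rule *[of "{b \<in> A. m b a \<noteq> 0}" "{b \<in> A. m' b a \<noteq> 0}"]) (use assms a in \<open>auto simp: sparse_def\<close>)
    then show "finite ?T" "card ?T \<le> N + N'" by auto
    fix b assume b: "b \<in> A"
    show "cmod (m a b + m' a b) \<le> C + C'"
      using norm_triangle_ineq[of "m a b" "m' a b"] sparse_entry[OF assms(1) a b] sparse_entry[OF assms(2) a b] by linarith
  qed
qed

lemma summable_finite_support:
  fixes h :: "'b \<Rightarrow> complex"
  assumes "finite {d \<in> A. h d \<noteq> 0}"
  shows "h summable_on A"
proof -
  have "h summable_on A \<longleftrightarrow> h summable_on {d \<in> A. h d \<noteq> 0}"
    by (rule summable_on_cong_neutral) auto
  then show ?thesis using assms by simp
qed

lemma gpair_comp_dom: "h \<in> left_hull \<Longrightarrow> gpair (g \<circ>\<^sub>m h) \<omega> \<Longrightarrow> gpair h \<omega>"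
proof -
  assume h: "h \<in> left_hull" and gh: "gpair (g \<circ>\<^sub>m h) \<omega>"
  have "\<forall>\<^sub>F s in near \<omega>. s \<in> dom h"
    using gpair_near[OF gh] by eventually_elim (auto simp: map_comp_iff)
  then show ?thesis using near_pid(1)[OF gpairD(2)[OF gh] dom_constructible[OF h]] h gpairD(2)[OF gh] by (simp add: gpair_def)
qed

text \<open>The quotient of \<open>a\<close> by \<open>b\<close> lives at the range of
  \<open>b\<close>; pulled back along \<open>b\<close>, the condition that it agrees with
  \<open>g\<close> becomes agreement of \<open>a\<close> with \<open>g \<circ>\<^sub>m b\<close> at
  \<open>\<omega>\<close>. The coefficient is taken at the range of \<open>b\<close>.\<close>

lemma bisection_fn_gdiv:
  assumes g: "g \<in> left_hull" and a: "gpair a \<omega>" and b: "gpair b \<omega>"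
  shows "bisection_fn g \<phi> (GS.gdiv (GS_class a \<omega>) (GS_class b \<omega>)) =
    (if \<forall>\<^sub>F s in near \<omega>. a s = (g \<circ>\<^sub>m b) s then \<phi> (conj_char b \<omega>) else 0)"
proof -
  have "(\<forall>\<^sub>F t in near (conj_char b \<omega>). (a \<circ>\<^sub>m pinverse b) t = g t) \<longleftrightarrow> (\<forall>\<^sub>F s in near \<omega>. a s = (g \<circ>\<^sub>m b) s)"
    unfolding near_conj_char[OF gpairD[OF b]]
  proof (rule eventually_subst)
    show "\<forall>\<^sub>F s in near \<omega>. (\<forall>t. b s = Some t \<longrightarrow> (a \<circ>\<^sub>m pinverse b) t = g t) = (a s = (g \<circ>\<^sub>m b) s)"
      using gpair_near[OF b]
    proof eventually_elim
      case (elim s)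
      then obtain t where t: "b s = Some t" by blast
      then have "pinverse b t = Some s" using pinverse_iff[OF gpairD(1)[OF b]] by simp
      with t show ?case by (simp add: map_comp_def)
    qed
  qed
  then show ?thesis
    using bisection_fn_GS_class[OF g gpair_div[OF a b], of \<phi>] gdiv_GS[OF a b] by simp
qed

lemma bounded_on_char_dom:
  assumes "continuous_on (char_dom g) \<phi>"
  obtains C :: real where "0 \<le> C" "\<And>\<omega>. \<omega> \<in> char_dom g \<Longrightarrow> cmod (\<phi> \<omega>) \<le> C"
proof -
  have "compact (\<phi> ` char_dom g)" using compact_continuous_image[OF assms] compact_char_dom[of UNIV g] by simp
  then obtain C where "\<And>z. z \<in> \<phi> ` char_dom g \<Longrightarrow> cmod z \<le> C" using compact_imp_bounded bounded_iff by metis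
  then show ?thesis using that[of "max C 0"] by force
qed

text \<open>The matrix is a weighted partial permutation: a column index \<open>b\<close> forces the
  row \<open>g \<circ>\<^sub>m b\<close>, and a row index forces the column because \<open>g\<close>
  is injective.\<close>

lemma sparse_bisection_fn:
  assumes g: "g \<in> left_hull" and C: "\<And>\<omega>. \<omega> \<in> char_dom g \<Longrightarrow> cmod (\<phi> \<omega>) \<le> C" "0 \<le> C" and \<omega>: "\<omega> \<in> Omega"
  shows "sparse (src_fibre GS (GS_class (pid UNIV) \<omega>)) 1 C (\<lambda>a b. bisection_fn g \<phi> (GS.gdiv a b))"
proof -
  let ?A = "src_fibre GS (GS_class (pid UNIV) \<omega>)"
  have cs: "\<exists>a. \<alpha> = GS_class a \<omega> \<and> gpair a \<omega>" if "\<alpha> \<in> ?A" for \<alpha>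
    using that unfolding src_fibre_GS[OF \<omega>] by blast
  have nz: "\<forall>\<^sub>F s in near \<omega>. a s = (g \<circ>\<^sub>m b) s"
    if "gpair a \<omega>" "gpair b \<omega>" "bisection_fn g \<phi> (GS.gdiv (GS_class a \<omega>) (GS_class b \<omega>)) \<noteq> 0" for a b
    using bisection_fn_gdiv[OF g that(1,2), of \<phi>] that(3) by presburger
  have row: "\<beta> = \<beta>'" if "\<alpha> \<in> ?A" "\<beta> \<in> ?A" "\<beta>' \<in> ?A" "bisection_fn g \<phi> (GS.gdiv \<alpha> \<beta>) \<noteq> 0" "bisection_fn g \<phi> (GS.gdiv \<alpha> \<beta>') \<noteq> 0" for \<alpha> \<beta> \<beta>'
  proof -
    obtain a b b' where e: "\<alpha> = GS_class a \<omega>" "gpair a \<omega>" "\<beta> = GS_class b \<omega>" "gpair b \<omega>" "\<beta>' = GS_class b' \<omega>" "gpair b' \<omega>"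
      using cs \<open>\<alpha> \<in> ?A\<close> \<open>\<beta> \<in> ?A\<close> \<open>\<beta>' \<in> ?A\<close> by meson
    have 1: "\<forall>\<^sub>F s in near \<omega>. a s = (g \<circ>\<^sub>m b) s" and 2: "\<forall>\<^sub>F s in near \<omega>. a s = (g \<circ>\<^sub>m b') s"
      using nz[OF e(2,4)] nz[OF e(2,6)] that(4,5) e by auto
    have "\<forall>\<^sub>F s in near \<omega>. b s = b' s"
      using 1 2 gpair_near[OF e(2)] gpair_near[OF e(4)] gpair_near[OF e(6)]
    proof eventually_elim
      case (elim s)
      then obtain r t t' where r: "a s = Some r" "b s = Some t" "b' s = Some t'" by blast
      with elim have "g t = Some r" "g t' = Some r" by (simp_all add: map_comp_def)
      then show ?case using left_hull_inj[OF g] r by simp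
    qed
    then show ?thesis using GS_class_eqI e by simp
  qed
  have col: "\<alpha> = \<alpha>'" if "\<alpha> \<in> ?A" "\<alpha>' \<in> ?A" "\<beta> \<in> ?A" "bisection_fn g \<phi> (GS.gdiv \<alpha> \<beta>) \<noteq> 0" "bisection_fn g \<phi> (GS.gdiv \<alpha>' \<beta>) \<noteq> 0" for \<alpha> \<alpha>' \<beta>
  proof -
    obtain a a' b where e: "\<alpha> = GS_class a \<omega>" "gpair a \<omega>" "\<alpha>' = GS_class a' \<omega>" "gpair a' \<omega>" "\<beta> = GS_class b \<omega>" "gpair b \<omega>"
      using cs \<open>\<alpha> \<in> ?A\<close> \<open>\<beta> \<in> ?A\<close> \<open>\<alpha>' \<in> ?A\<close> by meson
    have 1: "\<forall>\<^sub>F s in near \<omega>. a s = (g \<circ>\<^sub>m b) s" and 2: "\<forall>\<^sub>F s in near \<omega>. a' s = (g \<circ>\<^sub>m b) s"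
      using nz[OF e(2,6)] nz[OF e(4,6)] that(4,5) e by auto
    have "\<forall>\<^sub>F s in near \<omega>. a s = a' s" using 1 2 by eventually_elim simp
    then show ?thesis using GS_class_eqI e by simp
  qed
  have "cmod (bisection_fn g \<phi> (GS.gdiv \<alpha> \<beta>)) \<le> C" for \<alpha> \<beta>
  proof (cases "GS.gdiv \<alpha> \<beta> \<in> GS_class g ` char_dom g")
    case True
    then obtain \<psi> where "\<psi> \<in> char_dom g" "GS.gdiv \<alpha> \<beta> = GS_class g \<psi>" by blast
    then show ?thesis using bisection_fn_self[OF g] C(1) by simp
  qed (simp add: bisection_fn_off C(2))
  then show ?thesis
    unfolding sparse_def
  proof (intro conjI ballI)
    fix \<alpha> assume \<alpha>: "\<alpha> \<in> ?A"
    let ?S = "{b \<in> ?A. bisection_fn g \<phi> (GS.gdiv \<alpha> b) \<noteq> 0}" and ?T = "{b \<in> ?A. bisection_fn g \<phi> (GS.gdiv b \<alpha>) \<noteq> 0}"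
    have "finite ?S \<and> card ?S \<le> 1" by (rule finite_card_le_1) (use row[OF \<alpha>] in blast)
    then show "finite ?S" "card ?S \<le> 1" by blast+
    have "finite ?T \<and> card ?T \<le> 1" by (rule finite_card_le_1) (use col[OF _ _ \<alpha>] in blast)
    then show "finite ?T" "card ?T \<le> 1" by blast+
  qed blast
qed

lemma sparse_bisection_span:
  "f \<in> bisection_span \<Longrightarrow> \<exists>N C. 0 \<le> C \<and> (\<forall>\<omega>\<in>Omega. sparse (src_fibre GS (GS_class (pid UNIV) \<omega>)) N C (\<lambda>a b. f (GS.gdiv a b)))"
proof (induction rule: bisection_span.induct)
  case (bisection_fn g \<phi>)
  obtain C where "0 \<le> C" "\<And>\<omega>. \<omega> \<in> char_dom g \<Longrightarrow> cmod (\<phi> \<omega>) \<le> C" using bounded_on_char_dom[OF bisection_fn(2)] by metis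
  then show ?case using sparse_bisection_fn[OF bisection_fn(1)] by blast
next
  case (add f f')
  obtain N C where 1: "0 \<le> C" "\<And>\<omega>. \<omega> \<in> Omega \<Longrightarrow> sparse (src_fibre GS (GS_class (pid UNIV) \<omega>)) N C (\<lambda>a b. f (GS.gdiv a b))"
    using add.IH(1) by blast
  obtain N' C' where 2: "0 \<le> C'" "\<And>\<omega>. \<omega> \<in> Omega \<Longrightarrow> sparse (src_fibre GS (GS_class (pid UNIV) \<omega>)) N' C' (\<lambda>a b. f' (GS.gdiv a b))"
    using add.IH(2) by blast
  show ?case
    using sparse_add[OF 1(2) 2(2)] 1(1) 2(1) by (intro exI[of _ "N + N'"] exI[of _ "C + C'"]) simp
qed

section \<open>Closure of the span of bisection functions under convolution and involution\<close>

lemma convolution_GS_class: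
  assumes \<gamma>: "gpair k \<omega>"
  shows "convolution GS f1 f2 (GS_class k \<omega>) =
    (\<Sum>\<^sub>\<infinity>d\<in>src_fibre GS (GS_class (pid UNIV) \<omega>). f1 (GS.gdiv (GS_class k \<omega>) d) * f2 d)"
proof -
  let ?x = "GS_class (pid UNIV) \<omega>"
  have u: "?x \<in> src_fibre GS ?x" using GS_class_fibre[OF gpair_UNIV[OF gpairD(2)[OF \<gamma>]]] .
  have d: "GS.gdiv d ?x = d" if "d \<in> src_fibre GS ?x" for d
    using that GS.gdiv_src[of d] by (simp add: src_fibre_def)
  have "convolution GS f1 f2 (GS.gdiv (GS_class k \<omega>) ?x) =
      (\<Sum>\<^sub>\<infinity>d\<in>src_fibre GS ?x. f1 (GS.gdiv (GS_class k \<omega>) d) * f2 (GS.gdiv d ?x))"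
    by (rule GS.convolution_gdiv[OF GS_class_fibre[OF \<gamma>] u])
  also have "\<dots> = (\<Sum>\<^sub>\<infinity>d\<in>src_fibre GS ?x. f1 (GS.gdiv (GS_class k \<omega>) d) * f2 d)"
    by (intro infsum_cong) (simp add: d)
  finally show ?thesis using d[OF GS_class_fibre[OF \<gamma>]] by simp
qed

text \<open>\<open>infsum\<close> is additive for summable families. Summability comes from the left
  factor alone, whose matrix has finite rows, so the right factors may be arbitrary
  functions.\<close>

lemma convolution_add:
  fixes f1 :: "'a::left_cancellative_monoid germ set \<Rightarrow> complex"
  assumes "f1 \<in> bisection_span" "f1' \<in> bisection_span"
  shows "convolution GS (\<lambda>\<gamma>. f1 \<gamma> + f1' \<gamma>) f2 = (\<lambda>\<gamma>. convolution GS f1 f2 \<gamma> + convolution GS f1' f2 \<gamma>)"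
    and "convolution GS f1 (\<lambda>\<gamma>. f2 \<gamma> + f2' \<gamma>) = (\<lambda>\<gamma>. convolution GS f1 f2 \<gamma> + convolution GS f1 f2' \<gamma>)"
proof -
  have fin: "(\<lambda>d. f (GS.gdiv (GS_class k \<omega>) d) * h d) summable_on src_fibre GS (GS_class (pid UNIV) \<omega>)"
    if f: "f \<in> bisection_span" and k: "gpair k \<omega>" for f h and k :: "'a \<rightharpoonup> 'a" and \<omega>
  proof (rule summable_finite_support)
    let ?A = "src_fibre GS (GS_class (pid UNIV) \<omega>)"
    have "finite {d \<in> ?A. f (GS.gdiv (GS_class k \<omega>) d) \<noteq> 0}"
      using sparse_bisection_span[OF f] sparse_row[OF _ GS_class_fibre[OF k]] gpairD(2)[OF k] by blast
    then show "finite {d \<in> ?A. f (GS.gdiv (GS_class k \<omega>) d) * h d \<noteq> 0}"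
      by (rule rev_finite_subset) auto
  qed
  show "convolution GS (\<lambda>\<gamma>. f1 \<gamma> + f1' \<gamma>) f2 = (\<lambda>\<gamma>. convolution GS f1 f2 \<gamma> + convolution GS f1' f2 \<gamma>)"
  proof
    fix \<gamma>
    show "convolution GS (\<lambda>\<gamma>. f1 \<gamma> + f1' \<gamma>) f2 \<gamma> = convolution GS f1 f2 \<gamma> + convolution GS f1' f2 \<gamma>"
    proof (cases "\<gamma> \<in> arrows GS")
      case True
      then obtain k \<omega> where k: "\<gamma> = GS_class k \<omega>" "gpair k \<omega>" using arrows_GS_cases by blast
      show ?thesis unfolding k(1) convolution_GS_class[OF k(2)] distrib_right
        by (rule infsum_add[OF fin[OF assms(1) k(2)] fin[OF assms(2) k(2)]])
    qed (simp add: convolution_def)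
  qed
  show "convolution GS f1 (\<lambda>\<gamma>. f2 \<gamma> + f2' \<gamma>) = (\<lambda>\<gamma>. convolution GS f1 f2 \<gamma> + convolution GS f1 f2' \<gamma>)"
  proof
    fix \<gamma>
    show "convolution GS f1 (\<lambda>\<gamma>. f2 \<gamma> + f2' \<gamma>) \<gamma> = convolution GS f1 f2 \<gamma> + convolution GS f1 f2' \<gamma>"
    proof (cases "\<gamma> \<in> arrows GS")
      case True
      then obtain k \<omega> where k: "\<gamma> = GS_class k \<omega>" "gpair k \<omega>" using arrows_GS_cases by blast
      show ?thesis unfolding k(1) convolution_GS_class[OF k(2)] distrib_left
        by (rule infsum_add[OF fin[OF assms(1) k(2)] fin[OF assms(1) k(2)]])
    qed (simp add: convolution_def)
  qed
qed

text \<open>In the fibre over \<open>\<omega>\<close> the only arrow in the bisection of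
  \<open>h\<close> is its class at \<open>\<omega>\<close>, so the sum has one term, and the left
  coefficient is read at the range of that arrow.\<close>

lemma convolution_bisection_fn:
  assumes g: "g \<in> left_hull" and h: "h \<in> left_hull"
  shows "convolution GS (bisection_fn g \<phi>) (bisection_fn h \<psi>) = bisection_fn (g \<circ>\<^sub>m h) (\<lambda>\<omega>. \<phi> (conj_char h \<omega>) * \<psi> \<omega>)"
proof
  fix \<gamma>
  have gh: "g \<circ>\<^sub>m h \<in> left_hull" by (rule left_hull.comp[OF g h])
  show "convolution GS (bisection_fn g \<phi>) (bisection_fn h \<psi>) \<gamma> = bisection_fn (g \<circ>\<^sub>m h) (\<lambda>\<omega>. \<phi> (conj_char h \<omega>) * \<psi> \<omega>) \<gamma>"
  proof (cases "\<gamma> \<in> arrows GS")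
    case True
    then obtain k \<omega> where k: "\<gamma> = GS_class k \<omega>" "gpair k \<omega>" using arrows_GS_cases by blast
    let ?A = "src_fibre GS (GS_class (pid UNIV) \<omega>)"
    let ?t = "\<lambda>d. bisection_fn g \<phi> (GS.gdiv (GS_class k \<omega>) d) * bisection_fn h \<psi> d"
    have z: "bisection_fn h \<psi> d = 0 \<or> (gpair h \<omega> \<and> d = GS_class h \<omega>)" if d: "d \<in> ?A" for d
    proof (cases "d \<in> GS_class h ` char_dom h")
      case True
      then obtain \<psi>' where p: "gpair h \<psi>'" "d = GS_class h \<psi>'" using gpair_iff_char_dom[OF h] by blast
      obtain b where "d = GS_class b \<omega>" "gpair b \<omega>" using d unfolding src_fibre_GS[OF gpairD(2)[OF k(2)]] by blast
      then have "\<psi>' = \<omega>" using p GS_class_eq_iff by blast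
      with p show ?thesis by simp
    qed (simp add: bisection_fn_off)
    have "convolution GS (bisection_fn g \<phi>) (bisection_fn h \<psi>) \<gamma> = infsum ?t ?A"
      unfolding k(1) by (rule convolution_GS_class[OF k(2)])
    also have "\<dots> = bisection_fn (g \<circ>\<^sub>m h) (\<lambda>\<omega>. \<phi> (conj_char h \<omega>) * \<psi> \<omega>) \<gamma>"
    proof (cases "gpair h \<omega>")
      case True
      have "infsum ?t ?A = sum ?t {GS_class h \<omega>}"
        by (rule infsum_finite_support) (use z GS_class_fibre[OF True] in auto)
      also have "\<dots> = bisection_fn g \<phi> (GS.gdiv (GS_class k \<omega>) (GS_class h \<omega>)) * \<psi> \<omega>"
        using bisection_fn_self[OF h] gpair_iff_char_dom[OF h] True by simp
      also have "\<dots> = bisection_fn (g \<circ>\<^sub>m h) (\<lambda>\<omega>. \<phi> (conj_char h \<omega>) * \<psi> \<omega>) \<gamma>"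
        unfolding k(1) bisection_fn_gdiv[OF g k(2) True] bisection_fn_GS_class[OF gh k(2)] by simp
      finally show ?thesis .
    next
      case False
      have "infsum ?t ?A = 0"
        by (rule infsum_0) (use z False in auto)
      \<comment> \<open>Without \<open>h\<close> at \<open>\<omega>\<close> the sum is empty; the
        right-hand side vanishes as well, since \<open>g \<circ>\<^sub>m h\<close> is defined only
        where \<open>h\<close> is.\<close>
      moreover have "\<not> (\<forall>\<^sub>F s in near \<omega>. k s = (g \<circ>\<^sub>m h) s)"
      proof
        assume "\<forall>\<^sub>F s in near \<omega>. k s = (g \<circ>\<^sub>m h) s"
        then have "gpair (g \<circ>\<^sub>m h) \<omega>" using conj_char_cong(2) gh gpairD[OF k(2)] by (auto simp: gpair_def)
        then show False using False gpair_comp_dom[OF h] by blast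
      qed
      ultimately show ?thesis unfolding k(1) bisection_fn_GS_class[OF gh k(2)] by simp
    qed
    finally show ?thesis .
  next
    case False
    have "\<gamma> \<notin> GS_class (g \<circ>\<^sub>m h) ` char_dom (g \<circ>\<^sub>m h)" using False GS_class_arrow gpair_iff_char_dom[OF gh] by blast
    then show ?thesis using False by (simp add: convolution_def bisection_fn_off)
  qed
qed

lemma continuous_on_conj_char:
  assumes h: "h \<in> left_hull" and "continuous_on (char_dom g) \<phi>" and "\<And>\<omega>. \<omega> \<in> D \<Longrightarrow> conj_char h \<omega> \<in> char_dom g"
  shows "continuous_on D (\<lambda>\<omega>. \<phi> (conj_char h \<omega>))"
  using continuous_on_compose2[OF assms(2) continuous_on_subset[OF continuous_conj_char subset_UNIV]] assms(3) by blast

lemma bisection_span_convolution: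
  assumes "f1 \<in> bisection_span" "f2 \<in> bisection_span"
  shows "convolution GS f1 f2 \<in> bisection_span"
  using assms(1)
proof (induction rule: bisection_span.induct)
  case (bisection_fn g \<phi>)
  note g = bisection_fn
  show ?case
    using assms(2)
  proof (induction rule: bisection_span.induct)
    case (bisection_fn h \<psi>)
    have gh: "g \<circ>\<^sub>m h \<in> left_hull" using g(1) bisection_fn(1) by (rule left_hull.comp)
    have D: "gpair h \<omega>" "gpair g (conj_char h \<omega>)" if "\<omega> \<in> char_dom (g \<circ>\<^sub>m h)" for \<omega>
    proof -
      have gp: "gpair (g \<circ>\<^sub>m h) \<omega>" using that gpair_iff_char_dom[OF gh] by simp
      show "gpair h \<omega>" by (rule gpair_comp_dom[OF bisection_fn(1) gp])
      then show "gpair g (conj_char h \<omega>)" using gpair_comp[of h \<omega> g] g(1) gpairD(3)[OF gp] by simp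
    qed
    have "char_dom (g \<circ>\<^sub>m h) \<subseteq> char_dom h" using D(1) gpair_iff_char_dom[OF bisection_fn(1)] by blast
    moreover have "continuous_on (char_dom (g \<circ>\<^sub>m h)) (\<lambda>\<omega>. \<phi> (conj_char h \<omega>))"
      by (rule continuous_on_conj_char[OF bisection_fn(1) g(2)]) (use D(2) gpair_iff_char_dom[OF g(1)] in blast)
    ultimately have "continuous_on (char_dom (g \<circ>\<^sub>m h)) (\<lambda>\<omega>. \<phi> (conj_char h \<omega>) * \<psi> \<omega>)"
      using bisection_fn(2) by (intro continuous_on_mult) (auto intro: continuous_on_subset)
    then show ?case unfolding convolution_bisection_fn[OF g(1) bisection_fn(1)] by (rule bisection_span.bisection_fn[OF gh])
  next
    case (add f f')
    then show ?case using convolution_add(2)[OF bisection_span.bisection_fn[OF g] bisection_span.bisection_fn[OF g]] bisection_span.add[OF add.IH] by simp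
  qed
next
  case (add f f')
  then show ?case using convolution_add(1)[OF add.hyps] bisection_span.add[OF add.IH] by simp
qed

text \<open>The inverse of an arrow represented by \<open>h\<close> lies in the bisection of
  \<open>g\<close> when \<open>pinverse h\<close> agrees with \<open>g\<close> near the range;
  pulled back along \<open>h\<close>, this says that \<open>h\<close> agrees with
  \<open>pinverse g\<close> near the source.\<close>

lemma gstar_bisection_fn:
  assumes g: "g \<in> left_hull"
  shows "gstar GS (bisection_fn g \<phi>) = bisection_fn (pinverse g) (\<lambda>\<omega>. cnj (\<phi> (conj_char (pinverse g) \<omega>)))"
proof
  fix \<gamma>
  have g': "pinverse g \<in> left_hull" using g by (rule left_hull.inverse)
  show "gstar GS (bisection_fn g \<phi>) \<gamma> = bisection_fn (pinverse g) (\<lambda>\<omega>. cnj (\<phi> (conj_char (pinverse g) \<omega>))) \<gamma>"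
  proof (cases "\<gamma> \<in> arrows GS")
    case True
    then obtain h \<omega> where h: "\<gamma> = GS_class h \<omega>" "gpair h \<omega>" using arrows_GS_cases by blast
    have iff: "(\<forall>\<^sub>F t in near (conj_char h \<omega>). pinverse h t = g t) \<longleftrightarrow> (\<forall>\<^sub>F s in near \<omega>. h s = pinverse g s)"
      unfolding near_conj_char[OF gpairD[OF h(2)]]
    proof (rule eventually_subst)
      show "\<forall>\<^sub>F s in near \<omega>. (\<forall>t. h s = Some t \<longrightarrow> pinverse h t = g t) = (h s = pinverse g s)"
        using gpair_near[OF h(2)]
      proof eventually_elim
        case (elim s)
        then obtain t where t: "h s = Some t" by blast
        then have 1: "pinverse h t = Some s" using pinverse_iff[OF gpairD(1)[OF h(2)]] by simp
        have "g t = Some s \<longleftrightarrow> pinverse g s = Some t" using pinverse_iff[OF g, of s t] by blast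
        then show ?case unfolding t using 1 by (simp add: eq_commute)
      qed
    qed
    have "gstar GS (bisection_fn g \<phi>) \<gamma> = cnj (bisection_fn g \<phi> (GS_class (pinverse h) (conj_char h \<omega>)))"
      using True ginv_GS[OF h(2)] h(1) by (simp add: gstar_def)
    also have "\<dots> = (if \<forall>\<^sub>F s in near \<omega>. h s = pinverse g s then cnj (\<phi> (conj_char h \<omega>)) else 0)"
      unfolding bisection_fn_GS_class[OF g gpair_inv[OF h(2)]] iff by simp
    also have "\<dots> = bisection_fn (pinverse g) (\<lambda>\<omega>. cnj (\<phi> (conj_char (pinverse g) \<omega>))) \<gamma>"
    proof (cases "\<forall>\<^sub>F s in near \<omega>. h s = pinverse g s")
      case True
      have "conj_char h \<omega> = conj_char (pinverse g) \<omega>"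
        by (rule conj_char_cong(1)[OF gpairD(1)[OF h(2)] g' gpairD(2)[OF h(2)] True gpairD(3)[OF h(2)]])
      with True show ?thesis unfolding h(1) bisection_fn_GS_class[OF g' h(2)] by (simp only: if_True)
    next
      case False
      then show ?thesis unfolding h(1) bisection_fn_GS_class[OF g' h(2)] by (simp only: if_False)
    qed
    finally show ?thesis .
  next
    case False
    have "\<gamma> \<notin> GS_class (pinverse g) ` char_dom (pinverse g)" using False GS_class_arrow gpair_iff_char_dom[OF g'] by blast
    then show ?thesis using False by (simp add: gstar_def bisection_fn_off)
  qed
qed

lemma bisection_span_gstar: "f \<in> bisection_span \<Longrightarrow> gstar GS f \<in> bisection_span"
proof (induction rule: bisection_span.induct)
  case (bisection_fn g \<phi>)
  have g': "pinverse g \<in> left_hull" using bisection_fn(1) by (rule left_hull.inverse)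
  have "continuous_on (char_dom (pinverse g)) (\<lambda>\<omega>. \<phi> (conj_char (pinverse g) \<omega>))"
  proof (rule continuous_on_conj_char[OF g' bisection_fn(2)])
    fix \<omega> assume "\<omega> \<in> char_dom (pinverse g)"
    then have "gpair (pinverse g) \<omega>" using gpair_iff_char_dom[OF g'] by simp
    from gpair_inv[OF this] show "conj_char (pinverse g) \<omega> \<in> char_dom g"
      using pinverse_pinverse[OF bisection_fn(1)] gpair_iff_char_dom[OF bisection_fn(1)] by simp
  qed
  then show ?case unfolding gstar_bisection_fn[OF bisection_fn(1)] by (intro bisection_span.bisection_fn[OF g'] continuous_on_cnj)
next
  case (add f f')
  have "gstar GS (\<lambda>\<gamma>. f \<gamma> + f' \<gamma>) = (\<lambda>\<gamma>. gstar GS f \<gamma> + gstar GS f' \<gamma>)" by (auto simp: gstar_def)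
  then show ?case using bisection_span.add[OF add.IH] by simp
qed

section \<open>The representation on the monoid\<close>

lemma conj_ltrans_point: "conj_char (ltrans s) (point_char 1) = point_char s"
  using conj_char_point[OF left_hull.ltrans, of s 1 "s * 1"] by (simp add: ltrans_def)

lemma gpair_ltrans: "gpair (ltrans s) (point_char 1)"
proof -
  have "1 \<in> dom (ltrans s)" by (simp add: ltrans_def)
  then have "point_char 1 (pid (dom (ltrans s)))"
    using point_char_pid[OF dom_constructible[OF left_hull.ltrans[of s]]] by blast
  then show ?thesis unfolding gpair_def by (intro conjI left_hull.ltrans point_char_Omega)
qed

section \<open>The fibre at the character of the identity, and matrix entries over the
  monoid\<close>

lemma chi_e_unit_gunits: "chi_e_unit \<in> gunits GS"
  unfolding gunits_GS chi_e_unit_def by simp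

lemma inj_fibre_map: "inj fibre_map"
proof (rule injI)
  fix s t :: 'a assume "fibre_map s = fibre_map t"
  then have "\<forall>\<^sub>F r in near (point_char 1). ltrans s r = ltrans t r"
    using GS_class_eq_iff[OF gpair_ltrans[of s] gpair_ltrans[of t]] by (simp add: fibre_map_def)
  from near_point(1)[OF this] show "s = t" by (simp add: ltrans_def)
qed

text \<open>An element representing an arrow over the character of 1 has 1 in its domain, and by
  \<open>left_hull_mult\<close> it is the left translation by its value there.\<close>

lemma bij_fibre_map: "bij_betw fibre_map UNIV (src_fibre GS chi_e_unit)"
proof -
  have "range fibre_map = src_fibre GS (chi_e_unit :: 'a germ set)"
  proof (intro equalityI subsetI)
    fix \<gamma> :: "'a germ set" assume "\<gamma> \<in> range fibre_map"
    then show "\<gamma> \<in> src_fibre GS chi_e_unit"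
      using GS_class_fibre[OF gpair_ltrans] by (auto simp: fibre_map_def chi_e_unit_def)
  next
    fix \<gamma> :: "'a germ set" assume "\<gamma> \<in> src_fibre GS chi_e_unit"
    then obtain g where g: "\<gamma> = GS_class g (point_char 1)" "gpair g (point_char 1)"
      unfolding chi_e_unit_def src_fibre_GS[OF point_char_Omega] by blast
    have gh: "g \<in> left_hull" using gpairD(1)[OF g(2)] .
    have "1 \<in> dom g" using gpairD(3)[OF g(2)] point_char_pid[OF dom_constructible[OF gh]] by blast
    then obtain s where s: "g 1 = Some s" by blast
    then have "g = ltrans s" using left_hull_mult[OF gh s] by (auto simp: ltrans_def fun_eq_iff)
    then show "\<gamma> \<in> range fibre_map" using g(1) by (auto simp: fibre_map_def)
  qed
  then show ?thesis using inj_fibre_map by (simp add: bij_betw_def)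
qed

lemma fibre_map_in: "fibre_map t \<in> src_fibre GS chi_e_unit"
  by (rule bspec[OF bij_betwE[OF bij_fibre_map]]) simp

definition entry :: "('a::left_cancellative_monoid germ set \<Rightarrow> complex) \<Rightarrow> 'a \<Rightarrow> 'a \<Rightarrow> complex" where
  "entry f s t = f (GS.gdiv (fibre_map s) (fibre_map t))"

text \<open>Agreement of the translation by \<open>s\<close> with \<open>g\<close> after translation
  by \<open>t\<close>, near the character of 1, is decided at 1 by \<open>near_point_eq\<close>. The
  entries thus recover the partial permutation \<open>g\<close> of S.\<close>

lemma entry_bisection_fn:
  assumes g: "g \<in> left_hull"
  shows "entry (bisection_fn g \<phi>) s t = (if g t = Some s then \<phi> (point_char t) else 0)"
proof -
  have "(\<forall>\<^sub>F r in near (point_char 1). ltrans s r = (g \<circ>\<^sub>m ltrans t) r) \<longleftrightarrow> g t = Some s"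
    using near_point_eq[OF left_hull.ltrans[of s] left_hull.comp[OF g left_hull.ltrans[of t]], of 1 s]
    by (simp add: ltrans_def map_comp_def)
  then show ?thesis
    unfolding entry_def fibre_map_def bisection_fn_gdiv[OF g gpair_ltrans gpair_ltrans] conj_ltrans_point by simp
qed

lemma rho_chi_e_eq: "rho_chi_e f = mat_op UNIV (entry f)"
proof (intro ext)
  fix \<xi> :: "'a vec" and s :: 'a
  let ?A = "src_fibre GS (chi_e_unit :: 'a germ set)"
  let ?\<eta> = "\<lambda>\<gamma>. if \<gamma> \<in> ?A then \<xi> (the_inv fibre_map \<gamma>) else 0"
  have A: "fibre_map t \<in> ?A" for t by (rule fibre_map_in)
  have \<eta>: "?\<eta> (fibre_map t) = \<xi> t" for t using A by (simp add: the_inv_f_f[OF inj_fibre_map])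
  have l2: "?\<eta> \<in> ell2 ?A \<longleftrightarrow> \<xi> \<in> ell2 UNIV"
    using summable_on_reindex_bij_betw[OF bij_fibre_map, of "\<lambda>\<gamma>. (cmod (?\<eta> \<gamma>))\<^sup>2"] unfolding \<eta>
    by (simp add: ell2_def)
  have "(\<Sum>\<^sub>\<infinity>\<gamma>\<in>?A. f (GS.gdiv (fibre_map s) \<gamma>) * ?\<eta> \<gamma>) = (\<Sum>\<^sub>\<infinity>t\<in>UNIV. entry f s t * \<xi> t)"
    using infsum_reindex_bij_betw[OF bij_fibre_map, of "\<lambda>\<gamma>. f (GS.gdiv (fibre_map s) \<gamma>) * ?\<eta> \<gamma>"] unfolding \<eta>
    by (simp add: entry_def)
  then show "rho_chi_e f \<xi> s = mat_op UNIV (entry f) \<xi> s"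
    unfolding rho_chi_e_def GS.regular_rep_eq mat_op_def l2 using A by simp
qed

lemma sparse_entry_bisection_span:
  assumes "f \<in> bisection_span"
  obtains N C where "0 \<le> C" "sparse UNIV N C (entry f)"
proof -
  let ?A = "src_fibre GS (chi_e_unit :: 'a germ set)"
  obtain N C where NC: "0 \<le> C" "sparse ?A N C (\<lambda>a b. f (GS.gdiv a b))"
    using sparse_bisection_span[OF assms] point_char_Omega unfolding chi_e_unit_def by blast
  have card: "finite {t. P (fibre_map t)} \<and> card {t. P (fibre_map t)} \<le> N"
    if "finite {\<gamma>\<in>?A. P \<gamma>} \<and> card {\<gamma>\<in>?A. P \<gamma>} \<le> N" for P
  proof -
    have "fibre_map ` {t :: 'a. P (fibre_map t)} = {\<gamma>\<in>?A. P \<gamma>}"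
      unfolding bij_betw_imp_surj_on[OF bij_fibre_map, symmetric] by blast
    then have b: "bij_betw fibre_map {t :: 'a. P (fibre_map t)} {\<gamma>\<in>?A. P \<gamma>}"
      using inj_on_subset[OF inj_fibre_map subset_UNIV] by (simp add: bij_betw_def)
    show ?thesis using that bij_betw_finite[OF b] bij_betw_same_card[OF b] by simp
  qed
  have A: "fibre_map t \<in> ?A" for t by (rule fibre_map_in)
  have "sparse UNIV N C (entry f)"
    unfolding sparse_def entry_def
  proof (intro conjI ballI)
    fix a :: 'a
    have "finite {b \<in> ?A. f (GS.gdiv (fibre_map a) b) \<noteq> 0} \<and> card {b \<in> ?A. f (GS.gdiv (fibre_map a) b) \<noteq> 0} \<le> N"
      using NC(2) A[of a] unfolding sparse_def by blast
    from card[OF this] show "finite {b \<in> UNIV. f (GS.gdiv (fibre_map a) (fibre_map b)) \<noteq> 0}"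
      "card {b \<in> UNIV. f (GS.gdiv (fibre_map a) (fibre_map b)) \<noteq> 0} \<le> N" by simp_all
    have "finite {b \<in> ?A. f (GS.gdiv b (fibre_map a)) \<noteq> 0} \<and> card {b \<in> ?A. f (GS.gdiv b (fibre_map a)) \<noteq> 0} \<le> N"
      using NC(2) A[of a] unfolding sparse_def by blast
    from card[OF this] show "finite {b \<in> UNIV. f (GS.gdiv (fibre_map b) (fibre_map a)) \<noteq> 0}"
      "card {b \<in> UNIV. f (GS.gdiv (fibre_map b) (fibre_map a)) \<noteq> 0} \<le> N" by simp_all
    show "cmod (f (GS.gdiv (fibre_map a) (fibre_map b))) \<le> C" for b :: 'a
      by (rule sparse_entry[OF NC(2) A A])
  qed
  with NC(1) show ?thesis using that by blast
qed

section \<open>The representation as a star-homomorphism\<close>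

lemma rho_bounded: "f \<in> bisection_span \<Longrightarrow> rho_chi_e f \<in> bounded_ops UNIV"
proof -
  assume "f \<in> bisection_span"
  then obtain N C where "0 \<le> C" "sparse UNIV N C (entry f)" using sparse_entry_bisection_span by blast
  then show ?thesis unfolding rho_chi_e_eq by (intro sparse_bounded(1))
qed

lemma rho_add:
  assumes "f \<in> bisection_span" "f' \<in> bisection_span"
  shows "rho_chi_e (\<lambda>\<gamma>. f \<gamma> + f' \<gamma>) = (\<lambda>\<xi> a. rho_chi_e f \<xi> a + rho_chi_e f' \<xi> a)"
proof -
  obtain N C where 1: "sparse UNIV N C (entry f)" using sparse_entry_bisection_span[OF assms(1)] by blast
  obtain N' C' where 2: "sparse UNIV N' C' (entry f')" using sparse_entry_bisection_span[OF assms(2)] by blast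
  show ?thesis unfolding rho_chi_e_eq mat_op_add[OF 1 2, symmetric] by (simp add: entry_def[abs_def])
qed

lemma rho_scale: "rho_chi_e (\<lambda>\<gamma>. c * f \<gamma>) = (\<lambda>\<xi> a. c * rho_chi_e f \<xi> a)"
  unfolding rho_chi_e_eq mat_op_scale[symmetric] by (simp add: entry_def[abs_def])

lemma rho_convolution:
  assumes "f \<in> bisection_span" "f' \<in> bisection_span"
  shows "rho_chi_e (convolution GS f f') = rho_chi_e f \<circ> rho_chi_e f'"
proof -
  obtain N C where 1: "sparse UNIV N C (entry f)" using sparse_entry_bisection_span[OF assms(1)] by blast
  obtain N' C' where 2: "0 \<le> C'" "sparse UNIV N' C' (entry f')" using sparse_entry_bisection_span[OF assms(2)] by blast
  have "entry (convolution GS f f') s t = (\<Sum>\<^sub>\<infinity>r\<in>UNIV. entry f s r * entry f' r t)" for s t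
    unfolding entry_def GS.convolution_gdiv[OF fibre_map_in fibre_map_in]
    by (rule infsum_reindex_bij_betw[OF bij_fibre_map, symmetric])
  then show ?thesis unfolding rho_chi_e_eq by (intro mat_op_comp[OF 1 2(2,1), symmetric])
qed

lemma rho_gstar:
  assumes "f \<in> bisection_span"
  shows "adjoint_pair UNIV (rho_chi_e f) (rho_chi_e (gstar GS f))"
proof -
  obtain N C where 1: "0 \<le> C" "sparse UNIV N C (entry f)" using sparse_entry_bisection_span[OF assms(1)] by blast
  have "entry (gstar GS f) = (\<lambda>s t. cnj (entry f t s))"
    by (intro ext) (simp add: entry_def GS.gstar_gdiv[OF fibre_map_in fibre_map_in])
  then show ?thesis unfolding rho_chi_e_eq using adjoint_pair_mat_op[OF 1(2,1)] by simp
qed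

section \<open>Comparison of norms\<close>

lemma continuous_on_nbhd:
  fixes \<phi> :: "'b::topological_space \<Rightarrow> complex"
  assumes "continuous_on D \<phi>" "\<omega> \<in> D" "e > 0"
  obtains U where "open U" "\<omega> \<in> U" "\<And>\<psi>. \<psi> \<in> D \<Longrightarrow> \<psi> \<in> U \<Longrightarrow> cmod (\<phi> \<psi> - \<phi> \<omega>) \<le> e"
proof -
  have "\<exists>A. open A \<and> \<omega> \<in> A \<and> (\<forall>y\<in>D. y \<in> A \<longrightarrow> \<phi> y \<in> ball (\<phi> \<omega>) e)"
    using assms(1)[unfolded continuous_on_topological, rule_format, of \<omega> "ball (\<phi> \<omega>) e"] assms(2,3) by simp
  then obtain A where A: "open A" "\<omega> \<in> A" "\<And>y. y \<in> D \<Longrightarrow> y \<in> A \<Longrightarrow> \<phi> y \<in> ball (\<phi> \<omega>) e" by blast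
  show ?thesis
    by (rule that[OF A(1,2)]) (use A(3) in \<open>auto simp: dist_norm norm_minus_commute less_imp_le\<close>)
qed

text \<open>The set \<open>H\<close> collects the elements \<open>k(a)\<^sup>-\<^sup>1 g k(b)\<close> that are not units at \<open>\<omega>\<close>, for \<open>g\<close> in the support of
  \<open>f\<close>: at points \<open>s\<close> not fixed by any of them, zero coefficients of \<open>f\<close> stay zero.\<close>

lemma entries_approx:
  fixes k :: "'a::left_cancellative_monoid germ set \<Rightarrow> ('a \<rightharpoonup> 'a)"
  assumes \<omega>: "\<omega> \<in> Omega" and F: "finite F"
    and k: "\<And>a. a \<in> F \<Longrightarrow> a = GS_class (k a) \<omega>" "\<And>a. a \<in> F \<Longrightarrow> gpair (k a) \<omega>"
  shows "f \<in> bisection_span \<Longrightarrow> e > 0 \<Longrightarrow> \<exists>H. finite H \<and> H \<subseteq> left_hull \<and> (\<forall>h\<in>H. \<not> (\<forall>\<^sub>F s in near \<omega>. h s = Some s)) \<and>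
    (\<forall>\<^sub>F s in near \<omega>. (\<forall>h\<in>H. h s \<noteq> Some s) \<longrightarrow>
      (\<forall>a\<in>F. \<forall>b\<in>F. cmod (f (GS.gdiv a b) - entry f (the (k a s)) (the (k b s))) \<le> e))"
proof (induction arbitrary: e rule: bisection_span.induct)
  case (bisection_fn g \<phi>)
  note g = bisection_fn(1)
  let ?h = "\<lambda>a b. pinverse (k a) \<circ>\<^sub>m (g \<circ>\<^sub>m k b)"
  let ?agree = "\<lambda>a b. \<forall>\<^sub>F s in near \<omega>. k a s = (g \<circ>\<^sub>m k b) s"
  define P where "P = {p \<in> F \<times> F. \<not> ?agree (fst p) (snd p)}"
  define H where "H = (\<lambda>p. ?h (fst p) (snd p)) ` P"
  have finH: "finite H" unfolding H_def P_def using F by simp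
  have hull: "k a \<in> left_hull" if "a \<in> F" for a using gpairD(1)[OF k(2)[OF that]] .
  have "H \<subseteq> left_hull" unfolding H_def P_def using hull g by (auto intro!: left_hull.comp left_hull.inverse)
  moreover have "\<not> (\<forall>\<^sub>F s in near \<omega>. h s = Some s)" if "h \<in> H" for h
  proof
    assume ev: "\<forall>\<^sub>F s in near \<omega>. h s = Some s"
    obtain a b where ab: "a \<in> F" "b \<in> F" "\<not> ?agree a b" "h = ?h a b"
      using \<open>h \<in> H\<close> unfolding H_def P_def by auto
    \<comment> \<open>A fixed point s of
      \<open>pinverse (k a) \<circ>\<^sub>m (g \<circ>\<^sub>m k b)\<close> satisfies g(k_b(s)) =
      k_a(s), so an element trivial at \<open>\<omega>\<close> would mean agreement.\<close>
    from ev have "?agree a b"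
    proof eventually_elim
      case (elim s)
      then obtain y where "(g \<circ>\<^sub>m k b) s = Some y" "pinverse (k a) y = Some s"
        unfolding ab(4) map_comp_iff[of "pinverse (k a)"] by blast
      then show ?case using pinverse_iff[OF hull[OF ab(1)]] by simp
    qed
    with ab(3) show False by blast
  qed
  moreover have "\<forall>\<^sub>F s in near \<omega>. (\<forall>h\<in>H. h s \<noteq> Some s) \<longrightarrow>
      (\<forall>a\<in>F. \<forall>b\<in>F. cmod (bisection_fn g \<phi> (GS.gdiv a b) - entry (bisection_fn g \<phi>) (the (k a s)) (the (k b s))) \<le> e)"
  proof -
    have "\<forall>\<^sub>F s in near \<omega>. (\<forall>h\<in>H. h s \<noteq> Some s) \<longrightarrow>
        cmod (bisection_fn g \<phi> (GS.gdiv a b) - entry (bisection_fn g \<phi>) (the (k a s)) (the (k b s))) \<le> e"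
      if a: "a \<in> F" and b: "b \<in> F" for a b
    proof (cases "?agree a b")
      case True
      have "bisection_fn g \<phi> (GS.gdiv (GS_class (k a) \<omega>) (GS_class (k b) \<omega>)) = \<phi> (conj_char (k b) \<omega>)"
        unfolding bisection_fn_gdiv[OF g k(2)[OF a] k(2)[OF b]] using True by (simp only: if_True)
      then have val: "bisection_fn g \<phi> (GS.gdiv a b) = \<phi> (conj_char (k b) \<omega>)"
        using k(1)[OF a] k(1)[OF b] by simp
      \<comment> \<open>Here both coefficients are values of \<open>\<phi>\<close>: one at the range
        of \<open>b\<close>, the other at the character of k_b(s). The latter tends to the former as
        s tends to \<open>\<omega>\<close>, and continuity of \<open>\<phi>\<close> applies.\<close>
      let ?\<psi> = "conj_char (k b) \<omega>"
      have "\<forall>\<^sub>F s in near \<omega>. s \<in> dom (g \<circ>\<^sub>m k b)"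
        using True gpair_near[OF k(2)[OF a]] by eventually_elim auto
      then have "\<omega> (pid (dom (g \<circ>\<^sub>m k b)))"
        using near_pid(1)[OF \<omega> dom_constructible[OF left_hull.comp[OF g hull[OF b]]]] by blast
      then have g\<psi>: "gpair g ?\<psi>" using gpair_comp[OF k(2)[OF b]] g by blast
      then have "?\<psi> \<in> char_dom g" using gpair_iff_char_dom[OF g] by blast
      from continuous_on_nbhd[OF bisection_fn(2) this bisection_fn(3)]
      obtain U where U: "open U" "?\<psi> \<in> U" "\<And>\<psi>. \<psi> \<in> char_dom g \<Longrightarrow> \<psi> \<in> U \<Longrightarrow> cmod (\<phi> \<psi> - \<phi> ?\<psi>) \<le> e" by blast
      have "\<forall>\<^sub>F t in near ?\<psi>. point_char t \<in> U" by (rule near_open[OF U(1,2)])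
      then have "\<forall>\<^sub>F s in near \<omega>. \<forall>t. k b s = Some t \<longrightarrow> point_char t \<in> U"
        unfolding near_conj_char[OF gpairD[OF k(2)[OF b]]] .
      then show ?thesis using True gpair_near[OF k(2)[OF a]] gpair_near[OF k(2)[OF b]]
      proof eventually_elim
        case (elim s)
        then obtain r t where rt: "k a s = Some r" "k b s = Some t" by blast
        then have gt: "g t = Some r" using elim(2) by (simp add: map_comp_def)
        then have "t \<in> dom g" by blast
        then have "point_char t \<in> char_dom g" using point_char_pid[OF dom_constructible[OF g]] by (simp add: char_dom_def)
        then have "cmod (\<phi> (point_char t) - \<phi> ?\<psi>) \<le> e" using U(3) elim(1) rt(2) by blast
        then have "cmod (\<phi> ?\<psi> - \<phi> (point_char t)) \<le> e" by (simp add: norm_minus_commute)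
        moreover have "entry (bisection_fn g \<phi>) (the (k a s)) (the (k b s)) = \<phi> (point_char t)"
          unfolding entry_bisection_fn[OF g] rt option.sel using gt by simp
        ultimately show ?case unfolding val by simp
      qed
    next
      case False
      have "bisection_fn g \<phi> (GS.gdiv (GS_class (k a) \<omega>) (GS_class (k b) \<omega>)) = 0"
        unfolding bisection_fn_gdiv[OF g k(2)[OF a] k(2)[OF b]] using False by (simp only: if_False)
      then have val: "bisection_fn g \<phi> (GS.gdiv a b) = 0" using k(1)[OF a] k(1)[OF b] by simp
      have h: "?h a b \<in> H" unfolding H_def P_def using a b False by force
      show ?thesis using gpair_near[OF k(2)[OF a]] gpair_near[OF k(2)[OF b]]
      proof eventually_elim
        case (elim s)
        then obtain r t where rt: "k a s = Some r" "k b s = Some t" by blast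
        show ?case
        proof
          assume "\<forall>h\<in>H. h s \<noteq> Some s"
          then have ne: "?h a b s \<noteq> Some s" using h by blast
          \<comment> \<open>Otherwise s would be a fixed point of the member of \<open>H\<close>
            belonging to the pair \<open>a\<close>, \<open>b\<close>.\<close>
          have "g t \<noteq> Some r"
          proof
            assume "g t = Some r"
            moreover have "pinverse (k a) r = Some s" using pinverse_iff[OF hull[OF a]] rt(1) by blast
            ultimately have "?h a b s = Some s" using rt(2) by (simp add: map_comp_def)
            with ne show False by blast
          qed
          then have "entry (bisection_fn g \<phi>) (the (k a s)) (the (k b s)) = 0"
            unfolding entry_bisection_fn[OF g] rt option.sel by (simp only: if_False)
          then show "cmod (bisection_fn g \<phi> (GS.gdiv a b) - entry (bisection_fn g \<phi>) (the (k a s)) (the (k b s))) \<le> e"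
            unfolding val using bisection_fn(3) by simp
        qed
      qed
    qed
    then have "\<forall>\<^sub>F s in near \<omega>. \<forall>a\<in>F. \<forall>b\<in>F. (\<forall>h\<in>H. h s \<noteq> Some s) \<longrightarrow>
        cmod (bisection_fn g \<phi> (GS.gdiv a b) - entry (bisection_fn g \<phi>) (the (k a s)) (the (k b s))) \<le> e"
      by (intro eventually_ball_finite F ballI)
    then show ?thesis by (rule eventually_mono) blast
  qed
  ultimately show ?case using finH by (intro exI[of _ H] conjI ballI)
next
  case (add f f')
  have e2: "e/2 > 0" using add.prems by simp
  obtain H where H: "finite H" "H \<subseteq> left_hull" "\<forall>h\<in>H. \<not> (\<forall>\<^sub>F s in near \<omega>. h s = Some s)"
    "\<forall>\<^sub>F s in near \<omega>. (\<forall>h\<in>H. h s \<noteq> Some s) \<longrightarrow>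
      (\<forall>a\<in>F. \<forall>b\<in>F. cmod (f (GS.gdiv a b) - entry f (the (k a s)) (the (k b s))) \<le> e/2)"
    using add.IH(1)[OF e2] by (elim exE conjE) (rule that)
  obtain H' where H': "finite H'" "H' \<subseteq> left_hull" "\<forall>h\<in>H'. \<not> (\<forall>\<^sub>F s in near \<omega>. h s = Some s)"
    "\<forall>\<^sub>F s in near \<omega>. (\<forall>h\<in>H'. h s \<noteq> Some s) \<longrightarrow>
      (\<forall>a\<in>F. \<forall>b\<in>F. cmod (f' (GS.gdiv a b) - entry f' (the (k a s)) (the (k b s))) \<le> e/2)"
    using add.IH(2)[OF e2] by (elim exE conjE) (rule that)
  have "\<forall>\<^sub>F s in near \<omega>. (\<forall>h\<in>H \<union> H'. h s \<noteq> Some s) \<longrightarrow>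
      (\<forall>a\<in>F. \<forall>b\<in>F. cmod (f (GS.gdiv a b) + f' (GS.gdiv a b) - entry (\<lambda>\<gamma>. f \<gamma> + f' \<gamma>) (the (k a s)) (the (k b s))) \<le> e)"
    using H(4) H'(4)
  proof eventually_elim
    case (elim s)
    show ?case
    proof (intro impI ballI)
      fix a b assume *: "\<forall>h\<in>H \<union> H'. h s \<noteq> Some s" "a \<in> F" "b \<in> F"
      let ?u = "f (GS.gdiv a b) - entry f (the (k a s)) (the (k b s))"
      let ?v = "f' (GS.gdiv a b) - entry f' (the (k a s)) (the (k b s))"
      have "cmod ?u \<le> e/2" "cmod ?v \<le> e/2" using elim * by blast+
      then have "cmod (?u + ?v) \<le> e" using norm_triangle_ineq[of ?u ?v] by linarith
      moreover have "f (GS.gdiv a b) + f' (GS.gdiv a b) - entry (\<lambda>\<gamma>. f \<gamma> + f' \<gamma>) (the (k a s)) (the (k b s)) = ?u + ?v"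
        by (simp add: entry_def)
      ultimately show "cmod (f (GS.gdiv a b) + f' (GS.gdiv a b) - entry (\<lambda>\<gamma>. f \<gamma> + f' \<gamma>) (the (k a s)) (the (k b s))) \<le> e"
        by (simp only:)
    qed
  qed
  then show ?case using H(1-3) H'(1-3) by (intro exI[of _ "H \<union> H'"] conjI) auto
qed

text \<open>The injection evaluates the representatives of the arrows at one well-chosen point
  s.\<close>

lemma fibre_approx:
  assumes reg: "cstar_regular TYPE('a::left_cancellative_monoid)"
    and f: "f \<in> (bisection_span :: ('a germ set \<Rightarrow> complex) set)" and \<omega>: "\<omega> \<in> Omega"
    and F: "finite F" "F \<subseteq> src_fibre GS (GS_class (pid UNIV) \<omega>)" and e: "e > 0"
  shows "\<exists>\<tau>. inj_on \<tau> F \<and> \<tau> ` F \<subseteq> UNIV \<and> (\<forall>a\<in>F. \<forall>b\<in>F. cmod (f (GS.gdiv a b) - entry f (\<tau> a) (\<tau> b)) \<le> e)"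
proof -
  have "\<forall>a\<in>F. \<exists>k. a = GS_class k \<omega> \<and> gpair k \<omega>" using F(2) unfolding src_fibre_GS[OF \<omega>] by blast
  then obtain k where k: "\<And>a. a \<in> F \<Longrightarrow> a = GS_class (k a) \<omega>" "\<And>a. a \<in> F \<Longrightarrow> gpair (k a) \<omega>" by metis
  have hull: "k a \<in> left_hull" if "a \<in> F" for a using gpairD(1)[OF k(2)[OF that]] .
  obtain H where H: "finite H" "H \<subseteq> left_hull" "\<forall>h\<in>H. \<not> (\<forall>\<^sub>F s in near \<omega>. h s = Some s)"
    "\<forall>\<^sub>F s in near \<omega>. (\<forall>h\<in>H. h s \<noteq> Some s) \<longrightarrow>
      (\<forall>a\<in>F. \<forall>b\<in>F. cmod (f (GS.gdiv a b) - entry f (the (k a s)) (the (k b s))) \<le> e)"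
  proof -
    have "\<exists>H. finite H \<and> H \<subseteq> left_hull \<and> (\<forall>h\<in>H. \<not> (\<forall>\<^sub>F s in near \<omega>. h s = Some s)) \<and>
      (\<forall>\<^sub>F s in near \<omega>. (\<forall>h\<in>H. h s \<noteq> Some s) \<longrightarrow>
        (\<forall>a\<in>F. \<forall>b\<in>F. cmod (f (GS.gdiv a b) - entry f (the (k a s)) (the (k b s))) \<le> e))"
      by (rule entries_approx[OF \<omega> F(1) _ _ f e]) (fact k)+
    then show ?thesis by (elim exE conjE) (rule that)
  qed
  \<comment> \<open>The quotients of distinct arrows are avoided too. They are non-trivial at
    \<open>\<omega>\<close> because the arrows differ, and a point not fixed by them has distinct
    images, which makes the evaluation injective.\<close>
  define P where "P = {p \<in> F \<times> F. fst p \<noteq> snd p}"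
  define H' where "H' = (\<lambda>p. pinverse (k (fst p)) \<circ>\<^sub>m k (snd p)) ` P"
  have H': "finite H'" "H' \<subseteq> left_hull"
    unfolding H'_def P_def using F(1) hull by (auto intro!: left_hull.comp left_hull.inverse)
  have nt: "\<not> (\<forall>\<^sub>F s in near \<omega>. h s = Some s)" if "h \<in> H \<union> H'" for h
  proof (cases "h \<in> H")
    case False
    then have "h \<in> H'" using \<open>h \<in> H \<union> H'\<close> by blast
    then obtain p where p: "p \<in> P" "h = pinverse (k (fst p)) \<circ>\<^sub>m k (snd p)" unfolding H'_def by blast
    define a b where "a = fst p" and "b = snd p"
    have ab: "a \<in> F" "b \<in> F" "a \<noteq> b" "h = pinverse (k a) \<circ>\<^sub>m k b"
      using p by (auto simp: P_def a_def b_def)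
    show ?thesis
    proof
      assume "\<forall>\<^sub>F s in near \<omega>. h s = Some s"
      then have "\<forall>\<^sub>F s in near \<omega>. k a s = k b s"
      proof eventually_elim
        case (elim s)
        then show ?case unfolding ab(4) map_comp_iff using pinverse_iff[OF hull[OF ab(1)]] by auto
      qed
      then show False using GS_class_eqI[OF k(2)[OF ab(1)] k(2)[OF ab(2)]] k(1) ab by metis
    qed
  qed (use H(3) in blast)
  have "\<exists>\<^sub>F s in near \<omega>. \<forall>h\<in>H \<union> H'. h s \<noteq> Some s"
    by (rule regular_avoid[OF reg \<omega> _ _ nt]) (use H(1,2) H' in auto)
  moreover have "\<forall>\<^sub>F s in near \<omega>. \<forall>a\<in>F. \<exists>t. k a s = Some t"
    by (intro eventually_ball_finite F(1) ballI gpair_near k(2))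
  then have "\<forall>\<^sub>F s in near \<omega>. (\<forall>h\<in>H \<union> H'. h s \<noteq> Some s) \<longrightarrow> (\<forall>h\<in>H \<union> H'. h s \<noteq> Some s) \<and> (\<forall>a\<in>F. \<exists>t. k a s = Some t) \<and>
      (\<forall>a\<in>F. \<forall>b\<in>F. cmod (f (GS.gdiv a b) - entry f (the (k a s)) (the (k b s))) \<le> e)"
    using H(4) by eventually_elim (simp only: Un_iff ball_Un, blast)
  \<comment> \<open>Avoidance is known only frequently, but it is the one condition of this kind;
    all others hold eventually, so a single s meets them all.\<close>
  ultimately have "\<exists>\<^sub>F s in near \<omega>. (\<forall>h\<in>H \<union> H'. h s \<noteq> Some s) \<and> (\<forall>a\<in>F. \<exists>t. k a s = Some t) \<and>
      (\<forall>a\<in>F. \<forall>b\<in>F. cmod (f (GS.gdiv a b) - entry f (the (k a s)) (the (k b s))) \<le> e)"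
    by (rule frequently_rev_mp)
  then obtain s where s: "\<forall>h\<in>H \<union> H'. h s \<noteq> Some s" "\<forall>a\<in>F. \<exists>t. k a s = Some t"
    "\<forall>a\<in>F. \<forall>b\<in>F. cmod (f (GS.gdiv a b) - entry f (the (k a s)) (the (k b s))) \<le> e"
    by (elim frequently_ex[THEN exE] conjE) (rule that)
  have "inj_on (\<lambda>a. the (k a s)) F"
  proof (rule inj_onI, rule ccontr)
    fix a b assume ab: "a \<in> F" "b \<in> F" "the (k a s) = the (k b s)" "a \<noteq> b"
    then obtain t where "k a s = Some t" "k b s = Some t" using s(2) by fastforce
    then have "(pinverse (k a) \<circ>\<^sub>m k b) s = Some s"
      unfolding map_comp_iff using pinverse_iff[OF hull[OF ab(1)]] by blast
    moreover have "pinverse (k a) \<circ>\<^sub>m k b \<in> H'" unfolding H'_def P_def using ab by force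
    ultimately show False using s(1) by blast
  qed
  with s(3) show ?thesis by (intro exI[of _ "\<lambda>a. the (k a s)"]) simp
qed

text \<open>Every fibre is approximated by submatrices over S, which bounds the supremum from above;
  the fibre at \<chi>_e is one of those in the supremum and gives the lower bound.\<close>

theorem reduced_norm_eq:
  assumes reg: "cstar_regular TYPE('a::left_cancellative_monoid)"
    and f: "f \<in> (bisection_span :: ('a germ set \<Rightarrow> complex) set)"
  shows "reduced_norm GS f = op_norm UNIV (rho_chi_e f)"
proof -
  let ?R = "op_norm UNIV (rho_chi_e f)"
  obtain N C where NC: "0 \<le> C" "\<And>\<omega>. \<omega> \<in> Omega \<Longrightarrow> sparse (src_fibre GS (GS_class (pid UNIV) \<omega>)) N C (\<lambda>a b. f (GS.gdiv a b))"
    using sparse_bisection_span[OF f] by blast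
  obtain N' C' where NC': "0 \<le> C'" "sparse UNIV N' C' (entry f)" using sparse_entry_bisection_span[OF f] by blast
  have R0: "0 \<le> ?R" by (rule op_norm_nonneg[OF rho_bounded[OF f]])
  have R: "mat_norm_le UNIV (entry f) ?R"
    unfolding rho_chi_e_eq by (rule mat_norm_le_op_norm[OF sparse_row[OF NC'(2)] sparse_bounded(1)[OF NC'(2,1)]])
  have le: "op_norm (src_fibre GS x) (regular_rep GS x f) \<le> ?R" if x: "x \<in> gunits GS" for x
  proof -
    obtain \<omega> where \<omega>: "\<omega> \<in> Omega" "x = GS_class (pid UNIV) \<omega>" using x unfolding gunits_GS by blast
    show ?thesis
      unfolding GS.regular_rep_eq \<omega>(2)
    proof (rule mat_op_bounded(2)[OF sparse_row[OF NC(2)[OF \<omega>(1)]] _ R0])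
      show "mat_norm_le (src_fibre GS (GS_class (pid UNIV) \<omega>)) (\<lambda>a b. f (GS.gdiv a b)) ?R"
        by (rule mat_norm_le_approx[OF R]) (rule fibre_approx[OF reg f \<omega>(1)])
    qed
  qed
  have ge: "?R \<le> op_norm (src_fibre GS chi_e_unit) (regular_rep GS chi_e_unit f)"
  proof -
    let ?A = "src_fibre GS (chi_e_unit :: 'a germ set)" and ?m = "\<lambda>a b. f (GS.gdiv a b)"
    have sp: "sparse ?A N C ?m" using NC(2)[OF point_char_Omega] unfolding chi_e_unit_def .
    note b = sparse_bounded(1)[OF sp NC(1)]
    \<comment> \<open>In this direction the submatrices agree exactly along
      \<open>fibre_map\<close>, so the error in the transfer principle is 0.\<close>
    have le': "mat_norm_le UNIV (entry f) (op_norm ?A (mat_op ?A ?m))"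
    proof (rule mat_norm_le_approx[OF mat_norm_le_op_norm[OF sparse_row[OF sp] b]])
      fix F :: "'a set" and e :: real assume "e > 0"
      then show "\<exists>\<tau>. inj_on \<tau> F \<and> \<tau> ` F \<subseteq> ?A \<and> (\<forall>a\<in>F. \<forall>b\<in>F. cmod (entry f a b - ?m (\<tau> a) (\<tau> b)) \<le> e)"
        using inj_on_subset[OF inj_fibre_map subset_UNIV] fibre_map_in
        by (intro exI[of _ fibre_map]) (auto simp: entry_def)
    qed
    show ?thesis
      unfolding GS.regular_rep_eq rho_chi_e_eq
      by (rule mat_op_bounded(2)[OF sparse_row[OF NC'(2)] le' op_norm_nonneg[OF b]])
  qed
  show ?thesis
    unfolding reduced_norm_def
  proof (rule antisym)
    show "(SUP x\<in>gunits GS. op_norm (src_fibre GS x) (regular_rep GS x f)) \<le> ?R"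
      by (rule cSUP_least) (use chi_e_unit_gunits le in auto)
    \<comment> \<open>A real supremum dominates its members only for a bounded family; the bound is
      the inequality just obtained.\<close>
    have "bdd_above ((\<lambda>x. op_norm (src_fibre GS x) (regular_rep GS x f)) ` gunits GS)"
      by (rule bdd_aboveI2[OF le])
    from order_trans[OF ge cSUP_upper[OF chi_e_unit_gunits this]]
    show "?R \<le> (SUP x\<in>gunits GS. op_norm (src_fibre GS x) (regular_rep GS x f))" .
  qed
qed

section \<open>Generation by the left translations\<close>

text \<open>The operator on l2(S) of a bisection function has this matrix. For
  \<open>g = pid UNIV\<close> it is multiplication by \<open>w\<close>.\<close>

definition wperm :: "('a \<rightharpoonup> 'a) \<Rightarrow> ('a \<Rightarrow> complex) \<Rightarrow> 'a \<Rightarrow> 'a \<Rightarrow> complex" where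
  "wperm g w s t = (if g t = Some s then w t else 0)"

lemma sparse_wperm:
  assumes g: "g \<in> left_hull" and C: "0 \<le> C" "\<And>t. t \<in> dom g \<Longrightarrow> cmod (w t) \<le> C"
  shows "sparse UNIV 1 C (wperm g w)"
  unfolding sparse_def
proof (intro conjI ballI)
  fix s
  have "finite {t\<in>UNIV. wperm g w s t \<noteq> 0} \<and> card {t\<in>UNIV. wperm g w s t \<noteq> 0} \<le> 1"
    by (rule finite_card_le_1) (auto simp: wperm_def split: if_splits intro: left_hull_inj[OF g])
  then show "finite {t\<in>UNIV. wperm g w s t \<noteq> 0}" "card {t\<in>UNIV. wperm g w s t \<noteq> 0} \<le> 1" by auto
  have "finite {t\<in>UNIV. wperm g w t s \<noteq> 0} \<and> card {t\<in>UNIV. wperm g w t s \<noteq> 0} \<le> 1"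
    by (rule finite_card_le_1) (auto simp: wperm_def split: if_splits)
  then show "finite {t\<in>UNIV. wperm g w t s \<noteq> 0}" "card {t\<in>UNIV. wperm g w t s \<noteq> 0} \<le> 1" by auto
  show "cmod (wperm g w s t) \<le> C" for t using C by (auto simp: wperm_def)
qed

lemma mat_op_wperm_comp:
  assumes "g \<in> left_hull" "h \<in> left_hull" "0 \<le> C" "\<And>t. cmod (w t) \<le> C" "0 \<le> C'" "\<And>t. cmod (v t) \<le> C'"
  shows "mat_op UNIV (wperm g w) \<circ> mat_op UNIV (wperm h v) = mat_op UNIV (wperm (g \<circ>\<^sub>m h) (\<lambda>t. w (the (h t)) * v t))"
proof (rule mat_op_comp[OF sparse_wperm[OF assms(1,3,4)] sparse_wperm[OF assms(2,5,6)] assms(5)])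
  fix s t
  show "wperm (g \<circ>\<^sub>m h) (\<lambda>t. w (the (h t)) * v t) s t = (\<Sum>\<^sub>\<infinity>b\<in>UNIV. wperm g w s b * wperm h v b t)"
  proof (cases "h t")
    case None
    then show ?thesis by (simp add: wperm_def map_comp_def)
  next
    case (Some r)
    have "(\<Sum>\<^sub>\<infinity>b\<in>UNIV. wperm g w s b * wperm h v b t) = (\<Sum>b\<in>{r}. wperm g w s b * wperm h v b t)"
      by (rule infsum_finite_support) (use Some in \<open>auto simp: wperm_def\<close>)
    then show ?thesis using Some by (simp add: wperm_def map_comp_def)
  qed
qed

lemma rho_bisection_fn: "g \<in> left_hull \<Longrightarrow> rho_chi_e (bisection_fn g \<phi>) = mat_op UNIV (wperm g (\<lambda>t. \<phi> (point_char t)))"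
  unfolding rho_chi_e_eq by (intro arg_cong[where f = "mat_op UNIV"] ext) (simp add: entry_bisection_fn wperm_def)

lemma lambda_op_eq: "lambda_op s = rho_chi_e (bisection_fn (ltrans s) (\<lambda>\<omega>. 1))"
proof (intro ext)
  fix \<xi> :: "'a vec" and t
  show "lambda_op s \<xi> t = rho_chi_e (bisection_fn (ltrans s) (\<lambda>\<omega>. 1)) \<xi> t"
  proof (cases "\<xi> \<in> ell2 UNIV")
    case True
    have fin: "finite {u. s * u = t}"
    proof (rule conjunct1[OF finite_card_le_1])
      fix x y assume "x \<in> {u. s * u = t}" "y \<in> {u. s * u = t}"
      then have "s * x = s * y" by simp
      then show "x = y" by (rule left_cancel)
    qed
    have "mat_op UNIV (wperm (ltrans s) (\<lambda>t. 1)) \<xi> t = (\<Sum>u | s * u = t. wperm (ltrans s) (\<lambda>t. 1) t u * \<xi> u)"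
      by (rule mat_op_finite[OF True UNIV_I fin subset_UNIV]) (auto simp: wperm_def ltrans_def split: if_splits)
    then show ?thesis using True unfolding rho_bisection_fn[OF left_hull.ltrans] lambda_op_def by (simp add: wperm_def ltrans_def)
  next
    case False
    then show ?thesis by (simp add: lambda_op_def rho_chi_e_eq mat_op_def)
  qed
qed

section \<open>An arbitrary closed star-subalgebra containing the left translations\<close>

context
  fixes M :: "'a::left_cancellative_monoid op set"
  assumes M: "closed_star_subalgebra (op_alg UNIV) M" and lam: "range lambda_op \<subseteq> M"
begin

lemma M_closed:
  shows "T \<in> M \<Longrightarrow> U \<in> M \<Longrightarrow> (\<lambda>\<xi> a. T \<xi> a + U \<xi> a) \<in> M"
    and "T \<in> M \<Longrightarrow> (\<lambda>\<xi> a. c * T \<xi> a) \<in> M"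
    and "T \<in> M \<Longrightarrow> U \<in> M \<Longrightarrow> T \<circ> U \<in> M"
    and "T \<in> M \<Longrightarrow> op_adjoint UNIV T \<in> M"
  using M unfolding closed_star_subalgebra_def by (simp_all add: op_alg_def)

lemma M_bounded: "T \<in> M \<Longrightarrow> T \<in> bounded_ops UNIV"
  using M unfolding closed_star_subalgebra_def by (auto simp: op_alg_def)

lemma M_limit:
  assumes L: "L \<in> bounded_ops UNIV" and near: "\<And>e. e > 0 \<Longrightarrow> \<exists>T\<in>M. op_dist UNIV T L \<le> e"
  shows "L \<in> M"
proof -
  have "\<forall>n. \<exists>T. T \<in> M \<and> op_dist UNIV T L \<le> inverse (real (Suc n))"
    using near[of "inverse (real (Suc _))"] by auto
  then obtain T where T: "\<And>n. T n \<in> M" "\<And>n. op_dist UNIV (T n) L \<le> inverse (real (Suc n))" by metis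
  have "op_lim UNIV T L"
    by (rule op_limI[OF M_bounded[OF T(1)] L T(2) LIMSEQ_inverse_real_of_nat])
  then have "(\<lambda>n. op_dist UNIV (T n) L) \<longlonglongrightarrow> 0" by (rule op_limD(3))
  moreover have "L \<in> sa_carrier (op_alg UNIV)" using L by (simp add: op_alg_def)
  ultimately show ?thesis using M T(1) unfolding closed_star_subalgebra_def by blast
qed

text \<open>Passing from \<open>g\<close> to the operator of its bisection with constant weight 1
  turns products into products and inverses into adjoints, so the generation of the hull is mirrored
  inside \<open>M\<close>.\<close>

lemma V_in_M: "g \<in> left_hull \<Longrightarrow> rho_chi_e (bisection_fn g (\<lambda>\<omega>. 1)) \<in> M"
proof (induction rule: left_hull.induct)
  case (ltrans s)
  then show ?case using lam by (auto simp flip: lambda_op_eq)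
next
  case (inverse g)
  have E: "bisection_fn g (\<lambda>\<omega>. 1) \<in> bisection_span" by (rule bisection_span.bisection_fn[OF inverse.hyps]) simp
  have "rho_chi_e (bisection_fn (pinverse g) (\<lambda>\<omega>. 1)) = op_adjoint UNIV (rho_chi_e (bisection_fn g (\<lambda>\<omega>. 1)))"
    using op_adjoint_eq[OF rho_gstar[OF E]] gstar_bisection_fn[OF inverse.hyps, of "\<lambda>\<omega>. 1"] by simp
  then show ?case using M_closed(4)[OF inverse.IH] by simp
next
  case (comp g h)
  have E: "bisection_fn g (\<lambda>\<omega>. 1) \<in> bisection_span" "bisection_fn h (\<lambda>\<omega>. 1) \<in> bisection_span" using comp.hyps by (auto intro: bisection_span.bisection_fn)
  have "rho_chi_e (bisection_fn (g \<circ>\<^sub>m h) (\<lambda>\<omega>. 1)) = rho_chi_e (bisection_fn g (\<lambda>\<omega>. 1)) \<circ> rho_chi_e (bisection_fn h (\<lambda>\<omega>. 1))"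
    using rho_convolution[OF E] convolution_bisection_fn[OF comp.hyps, of "\<lambda>\<omega>. 1" "\<lambda>\<omega>. 1"] by simp
  then show ?case using M_closed(3)[OF comp.IH] by (simp only:)
qed

text \<open>The bounded functions on S whose multiplication operators lie in \<open>M\<close>. They
  form an algebra containing the indicators of constructible ideals.\<close>

definition diags :: "('a \<Rightarrow> complex) set" where
  "diags = {w. (\<exists>C. \<forall>t. cmod (w t) \<le> C) \<and> mat_op UNIV (wperm (pid UNIV) w) \<in> M}"

lemma diags_bound: "w \<in> diags \<Longrightarrow> \<exists>C\<ge>0. \<forall>t. cmod (w t) \<le> C"
proof -
  assume "w \<in> diags"
  then obtain C where C: "\<And>t. cmod (w t) \<le> C" by (auto simp: diags_def)
  have "0 \<le> C" by (rule order_trans[OF norm_ge_zero C[of 1]])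
  with C show ?thesis by blast
qed

lemma diags_indicator:
  assumes "X \<in> constructible"
  shows "(\<lambda>t. if t \<in> X then 1 else 0) \<in> diags"
proof -
  have "wperm (pid X) (\<lambda>t. 1) = wperm (pid UNIV) (\<lambda>t. if t \<in> X then 1 else 0)"
    by (auto simp: wperm_def pid_iff fun_eq_iff)
  then have "mat_op UNIV (wperm (pid UNIV) (\<lambda>t. if t \<in> X then 1 else 0)) \<in> M"
    using V_in_M[OF pid_left_hull[OF assms]] rho_bisection_fn[OF pid_left_hull[OF assms], of "\<lambda>\<omega>. 1"] by simp
  then show ?thesis unfolding diags_def by (auto intro!: exI[of _ 1])
qed

lemma diags_one: "(\<lambda>t. 1) \<in> diags"
  using diags_indicator[OF constructible.whole] by simp

lemma diags_scale:
  assumes "w \<in> diags"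
  shows "(\<lambda>t. c * w t) \<in> diags"
proof -
  obtain C where C: "\<And>t. cmod (w t) \<le> C" using diags_bound[OF assms] by blast
  have "wperm (pid UNIV) (\<lambda>t. c * w t) = (\<lambda>s t. c * wperm (pid UNIV) w s t)" by (auto simp: wperm_def fun_eq_iff)
  then have "mat_op UNIV (wperm (pid UNIV) (\<lambda>t. c * w t)) \<in> M"
    using M_closed(2)[of "mat_op UNIV (wperm (pid UNIV) w)" c] assms by (simp add: mat_op_scale diags_def)
  moreover have "cmod (c * w t) \<le> cmod c * C" for t using C[of t] by (simp add: norm_mult mult_left_mono)
  ultimately show ?thesis unfolding diags_def by blast
qed

lemma diags_add:
  assumes "w \<in> diags" "v \<in> diags"
  shows "(\<lambda>t. w t + v t) \<in> diags"
proof -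
  obtain C where C: "0 \<le> C" "\<And>t. cmod (w t) \<le> C" using diags_bound[OF assms(1)] by blast
  obtain C' where C': "0 \<le> C'" "\<And>t. cmod (v t) \<le> C'" using diags_bound[OF assms(2)] by blast
  have "wperm (pid UNIV) (\<lambda>t. w t + v t) = (\<lambda>s t. wperm (pid UNIV) w s t + wperm (pid UNIV) v s t)"
    by (auto simp: wperm_def fun_eq_iff)
  moreover have "mat_op UNIV (wperm (pid UNIV) w) \<in> M" "mat_op UNIV (wperm (pid UNIV) v) \<in> M"
    using assms by (simp_all add: diags_def)
  ultimately have "mat_op UNIV (wperm (pid UNIV) (\<lambda>t. w t + v t)) \<in> M"
    using mat_op_add[OF sparse_wperm[OF pid_UNIV_left_hull, of C w, OF C]
        sparse_wperm[OF pid_UNIV_left_hull, of C' v, OF C']] M_closed(1) by simp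
  moreover have "cmod (w t + v t) \<le> C + C'" for t
    using C(2)[of t] C'(2)[of t] norm_triangle_ineq[of "w t" "v t"] by linarith
  ultimately show ?thesis unfolding diags_def by blast
qed

lemma wperm_diag:
  assumes g: "g \<in> left_hull" and w: "w \<in> diags"
  shows "mat_op UNIV (wperm g (\<lambda>t. 1)) \<circ> mat_op UNIV (wperm (pid UNIV) w) = mat_op UNIV (wperm g w)"
proof -
  obtain C where C: "0 \<le> C" "\<And>t. cmod (w t) \<le> C" using diags_bound[OF w] by blast
  show ?thesis using mat_op_wperm_comp[OF g pid_UNIV_left_hull, of 1 "\<lambda>t. 1" C w] C by simp
qed

lemma diags_mult:
  assumes "w \<in> diags" "v \<in> diags"
  shows "(\<lambda>t. w t * v t) \<in> diags"
proof -
  obtain C where C: "0 \<le> C" "\<And>t. cmod (w t) \<le> C" using diags_bound[OF assms(1)] by blast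
  obtain C' where C': "0 \<le> C'" "\<And>t. cmod (v t) \<le> C'" using diags_bound[OF assms(2)] by blast
  have the: "the (pid UNIV t) = t" for t :: 'a by (simp add: pid_def)
  have "mat_op UNIV (wperm (pid UNIV) w) \<in> M" "mat_op UNIV (wperm (pid UNIV) v) \<in> M"
    using assms by (simp_all add: diags_def)
  from M_closed(3)[OF this] have "mat_op UNIV (wperm (pid UNIV) (\<lambda>t. w t * v t)) \<in> M"
    using mat_op_wperm_comp[OF pid_UNIV_left_hull pid_UNIV_left_hull, of C w C' v, OF C C'] by (simp add: the)
  moreover have "cmod (w t * v t) \<le> C * C'" for t
    using C(1) C(2)[of t] C'(2)[of t] by (simp add: norm_mult mult_mono)
  ultimately show ?thesis unfolding diags_def by blast
qed

text \<open>For an idempotent coordinate p_X the condition is membership of t in X or its negation,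
  with indicator 1_X or 1 - 1_X; finitely many conditions correspond to a product.\<close>

lemma diags_cylinder:
  assumes "finite I" and \<omega>: "\<omega> \<in> Omega"
  shows "(\<lambda>t. if point_char t \<in> {\<psi>. \<forall>i\<in>I. \<psi> i = \<omega> i} then 1 else 0) \<in> diags"
  using assms(1)
proof (induction rule: finite_induct)
  case empty
  then show ?case using diags_one by simp
next
  case (insert i I)
  have "(\<lambda>t. if point_char t i = \<omega> i then 1 else 0) \<in> diags"
  proof (cases "i \<in> idems")
    case True
    then obtain X where X: "X \<in> constructible" "i = pid X" by (auto simp: idems_eq)
    show ?thesis
    proof (cases "\<omega> i")
      case True
      then show ?thesis using diags_indicator[OF X(1)] by (simp add: X point_char_pid)
    next
      case False
      have "(\<lambda>t. 1 + (-1) * (if t \<in> X then 1 else 0)) \<in> diags"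
        by (intro diags_add diags_one diags_scale diags_indicator X(1))
      moreover have "(\<lambda>t. 1 + (-1) * (if t \<in> X then 1 else 0)) = (\<lambda>t. if point_char t i = \<omega> i then 1 else (0::complex))"
        using False by (auto simp: X point_char_pid fun_eq_iff)
      ultimately show ?thesis by simp
    qed
  next
    case False
    \<comment> \<open>Off the idempotents all characters are \<open>False\<close> by convention, so
      such a coordinate imposes no condition.\<close>
    then have "\<not> \<omega> i" "\<not> point_char t i" for t
      using Omega_idem[OF \<omega>, of i] Omega_idem[OF point_char_Omega[of t], of i] pid_idem by auto
    then show ?thesis using diags_one by simp
  qed
  note m = diags_mult[OF this insert.IH]
  have "(\<lambda>t. (if point_char t i = \<omega> i then 1 else 0) * (if point_char t \<in> {\<psi>. \<forall>i\<in>I. \<psi> i = \<omega> i} then 1 else 0)) =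
      (\<lambda>t. if point_char t \<in> {\<psi>. \<forall>i\<in>insert i I. \<psi> i = \<omega> i} then 1 else (0::complex))"
    by (rule ext) simp
  from m[unfolded this] show ?case .
qed

text \<open>A direct replacement for Stone-Weierstrass on a zero-dimensional space:
  \<open>\<phi>\<close> varies by at most \<open>e\<close> about a constant on each of finitely many
  cylinders that cover the compact set \<open>char_dom g\<close>.\<close>

lemma diags_approx:
  assumes g: "g \<in> left_hull" and \<phi>: "continuous_on (char_dom g) \<phi>" and e: "e > 0"
  shows "\<exists>w\<in>diags. \<forall>t\<in>dom g. cmod (\<phi> (point_char t) - w t) \<le> e"
proof -
  define \<W> where "\<W> = {W. open W \<and> (\<lambda>t. if point_char t \<in> W then 1 else 0) \<in> diags \<and>
    (\<exists>c. \<forall>\<psi>\<in>char_dom g \<inter> W. cmod (\<phi> \<psi> - c) \<le> e)}"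
  have cov: "char_dom g \<subseteq> \<Union>\<W>"
  proof
    fix \<omega> assume \<omega>: "\<omega> \<in> char_dom g"
    from continuous_on_nbhd[OF \<phi> \<omega> e]
    obtain U where U: "open U" "\<omega> \<in> U" "\<And>\<psi>. \<psi> \<in> char_dom g \<Longrightarrow> \<psi> \<in> U \<Longrightarrow> cmod (\<phi> \<psi> - \<phi> \<omega>) \<le> e" by blast
    obtain I where I: "finite I" "\<And>\<omega>'. (\<forall>i\<in>I. \<omega>' i = \<omega> i) \<Longrightarrow> \<omega>' \<in> U" using fun_basis[OF U(1,2)] by blast
    let ?W = "{\<psi>. \<forall>i\<in>I. \<psi> i = \<omega> i}"
    have "?W = (\<Inter>i\<in>I. {\<psi>. \<psi> i = \<omega> i})" by auto
    moreover have "open {\<psi>. \<psi> i = \<omega> i}" for i using open_eval[of i] by (cases "\<omega> i") simp_all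
    ultimately have "open ?W" using I(1) by (simp add: open_INT)
    moreover have "(\<lambda>t. if point_char t \<in> ?W then 1 else 0) \<in> diags"
      by (rule diags_cylinder[OF I(1) subsetD[OF Dm_subset \<omega>]])
    moreover have "\<forall>\<psi>\<in>char_dom g \<inter> ?W. cmod (\<phi> \<psi> - \<phi> \<omega>) \<le> e"
    proof
      fix \<psi> assume "\<psi> \<in> char_dom g \<inter> ?W"
      then have "\<psi> \<in> char_dom g" "\<psi> \<in> U" using I(2)[of \<psi>] by simp_all
      then show "cmod (\<phi> \<psi> - \<phi> \<omega>) \<le> e" by (rule U(3))
    qed
    ultimately have "?W \<in> \<W>" unfolding \<W>_def by (intro CollectI conjI exI[of _ "\<phi> \<omega>"])
    moreover have "\<omega> \<in> ?W" by simp
    ultimately show "\<omega> \<in> \<Union>\<W>" by (rule UnionI)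
  qed
  have cpt: "compact (char_dom g)" using compact_char_dom[of UNIV g] by simp
  obtain \<F> where \<F>: "\<F> \<subseteq> \<W>" "finite \<F>" "char_dom g \<subseteq> \<Union>\<F>"
  proof (rule compactE[OF cpt cov])
    fix W assume "W \<in> \<W>"
    then show "open W" unfolding \<W>_def by (elim CollectE conjE)
  qed
  have ex: "\<exists>w\<in>diags. \<forall>t. point_char t \<in> char_dom g \<inter> \<Union>\<F> \<longrightarrow> cmod (\<phi> (point_char t) - w t) \<le> e"
    using \<F>(2,1)
  proof (induction rule: finite_induct)
    case empty
    then show ?case using diags_one by blast
  next
    case (insert W \<F>)
    have "\<exists>w\<in>diags. \<forall>t. point_char t \<in> char_dom g \<inter> \<Union>\<F> \<longrightarrow> cmod (\<phi> (point_char t) - w t) \<le> e"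
      by (rule insert.IH) (use insert.prems in simp)
    then obtain w where w: "w \<in> diags" "\<forall>t. point_char t \<in> char_dom g \<inter> \<Union>\<F> \<longrightarrow> cmod (\<phi> (point_char t) - w t) \<le> e"
      by (rule bexE)
    have "W \<in> \<W>" using insert.prems by simp
    then obtain c where W: "(\<lambda>t. if point_char t \<in> W then 1 else 0) \<in> diags" "\<And>\<psi>. \<psi> \<in> char_dom g \<inter> W \<Longrightarrow> cmod (\<phi> \<psi> - c) \<le> e"
      unfolding \<W>_def mem_Collect_eq by (elim exE conjE) (rule that, assumption, blast)
    let ?i = "\<lambda>t. if point_char t \<in> W then 1 else (0::complex)"
    \<comment> \<open>Overlaps are resolved by overriding: the new function is \<open>c\<close> on
      \<open>W\<close> and the old \<open>w\<close> elsewhere, so the cover need not be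
      disjoint.\<close>
    have "(\<lambda>t. c * ?i t + (1 + (-1) * ?i t) * w t) \<in> diags"
      by (intro diags_add diags_scale diags_mult diags_one W(1) w(1))
    moreover have "cmod (\<phi> (point_char t) - (c * ?i t + (1 + (-1) * ?i t) * w t)) \<le> e"
      if t: "point_char t \<in> char_dom g \<inter> \<Union>(insert W \<F>)" for t
    proof (cases "point_char t \<in> W")
      case True
      then have "point_char t \<in> char_dom g \<inter> W" using t by (elim IntE) (rule IntI)
      from W(2)[OF this] True show ?thesis by simp
    next
      case False
      then have "point_char t \<in> char_dom g \<inter> \<Union>\<F>" using t by simp
      from w(2)[rule_format, OF this] False show ?thesis by simp
    qed
    ultimately show ?case by (intro bexI[of _ "\<lambda>t. c * ?i t + (1 + (-1) * ?i t) * w t"] allI impI)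
  qed
  have in_cover: "point_char t \<in> char_dom g \<inter> \<Union>\<F>" if "t \<in> dom g" for t
  proof -
    have "point_char t \<in> char_dom g" using that point_char_pid[OF dom_constructible[OF g]] by (simp add: char_dom_def)
    then show ?thesis using \<F>(3) by blast
  qed
  from ex obtain w where w: "w \<in> diags"
    "\<forall>t. point_char t \<in> char_dom g \<inter> \<Union>\<F> \<longrightarrow> cmod (\<phi> (point_char t) - w t) \<le> e" by (rule bexE)
  show ?thesis
    by (rule bexI[OF _ w(1)]) (intro ballI w(2)[rule_format] in_cover)
qed

text \<open>The operator factors, up to \<open>e\<close>, as the one of constant weight 1 after a
  multiplication operator in \<open>M\<close>. The error is a weighted partial permutation with
  weights at most \<open>e\<close>, so its norm is at most \<open>e\<close>.\<close>

lemma rho_bisection_fn_in_M: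
  assumes g: "g \<in> left_hull" and \<phi>: "continuous_on (char_dom g) \<phi>"
  shows "rho_chi_e (bisection_fn g \<phi>) \<in> M"
proof (rule M_limit[OF rho_bounded[OF bisection_span.bisection_fn[OF g \<phi>]]])
  fix e :: real assume e: "e > 0"
  obtain w where w: "w \<in> diags" "\<And>t. t \<in> dom g \<Longrightarrow> cmod (\<phi> (point_char t) - w t) \<le> e"
    using diags_approx[OF g \<phi> e] by blast
  let ?T = "mat_op UNIV (wperm g w)" and ?v = "\<lambda>t. \<phi> (point_char t)"
  obtain C where C: "0 \<le> C" "\<And>t. cmod (w t) \<le> C" using diags_bound[OF w(1)] by blast
  have "mat_op UNIV (wperm (pid UNIV) w) \<in> M" using w(1) by (simp add: diags_def)
  moreover have "mat_op UNIV (wperm g (\<lambda>t. 1)) \<in> M" using V_in_M[OF g] rho_bisection_fn[OF g, of "\<lambda>\<omega>. 1"] by simp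
  ultimately have "?T \<in> M" unfolding wperm_diag[OF g w(1), symmetric] by (intro M_closed(3))
  moreover have "op_dist UNIV ?T (rho_chi_e (bisection_fn g \<phi>)) \<le> e"
  proof -
    have d: "cmod (w t + (-1) * ?v t) \<le> e" if "t \<in> dom g" for t
      using w(2)[OF that] by (simp add: norm_minus_commute)
    \<comment> \<open>Additivity of \<open>mat_op\<close> asks for a bound on each summand; the
      weights from \<open>\<phi>\<close> are within \<open>e\<close> of \<open>w\<close> on
      \<open>dom g\<close>, hence bounded by \<open>C + e\<close> there.\<close>
    have C': "cmod ((-1) * ?v t) \<le> C + e" if "t \<in> dom g" for t
      using w(2)[OF that] C(2)[of t] norm_triangle_ineq2[of "?v t" "w t"] by (simp add: norm_minus_commute)
    have "(\<lambda>\<xi> a. ?T \<xi> a + (-1) * mat_op UNIV (wperm g ?v) \<xi> a) =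
        mat_op UNIV (\<lambda>s t. wperm g w s t + wperm g (\<lambda>t. (-1) * ?v t) s t)"
    proof -
      have "(\<lambda>s t. (-1) * wperm g ?v s t) = wperm g (\<lambda>t. (-1) * ?v t)" by (auto simp: wperm_def fun_eq_iff)
      then have "(\<lambda>\<xi> a. (-1) * mat_op UNIV (wperm g ?v) \<xi> a) = mat_op UNIV (wperm g (\<lambda>t. (-1) * ?v t))"
        using mat_op_scale[of UNIV "-1" "wperm g ?v"] by simp
      then have s: "(-1) * mat_op UNIV (wperm g ?v) \<xi> a = mat_op UNIV (wperm g (\<lambda>t. (-1) * ?v t)) \<xi> a" for \<xi> a
        by (rule fun_cong[OF fun_cong])
      have "mat_op UNIV (\<lambda>s t. wperm g w s t + wperm g (\<lambda>t. (-1) * ?v t) s t) =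
          (\<lambda>\<xi> a. ?T \<xi> a + mat_op UNIV (wperm g (\<lambda>t. (-1) * ?v t)) \<xi> a)"
        by (rule mat_op_add[OF sparse_wperm[OF g C] sparse_wperm[OF g, of "C + e"]]) (use C(1) e C' in auto)
      then show ?thesis unfolding s by simp
    qed
    also have "(\<lambda>s t. wperm g w s t + wperm g (\<lambda>t. (-1) * ?v t) s t) = wperm g (\<lambda>t. w t + (-1) * ?v t)"
      by (auto simp: wperm_def fun_eq_iff)
    finally have eq: "(\<lambda>\<xi> a. ?T \<xi> a + (-1) * mat_op UNIV (wperm g ?v) \<xi> a) = mat_op UNIV (wperm g (\<lambda>t. w t + (-1) * ?v t))" .
    have "op_norm UNIV (mat_op UNIV (wperm g (\<lambda>t. w t + (-1) * ?v t))) \<le> real 1 * e"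
      by (rule sparse_bounded(2)[OF sparse_wperm[OF g]]) (use d e in auto)
    then show ?thesis unfolding op_dist_eq rho_bisection_fn[OF g] eq by simp
  qed
  ultimately show "\<exists>T\<in>M. op_dist UNIV T (rho_chi_e (bisection_fn g \<phi>)) \<le> e" by blast
qed

lemma rho_in_M: "f \<in> bisection_span \<Longrightarrow> rho_chi_e f \<in> M"
proof (induction rule: bisection_span.induct)
  case (bisection_fn g \<phi>)
  then show ?case by (rule rho_bisection_fn_in_M)
next
  case (add f f')
  show ?case using M_closed(1)[OF add.IH] unfolding rho_add[OF add.hyps] .
qed

end

section \<open>The isometric representation and the isomorphism\<close>

lemma Cc_alg_simps:
  "sa_carrier (Cc_alg GS) = bisection_span" "sa_add (Cc_alg GS) f f' = (\<lambda>\<gamma>. f \<gamma> + f' \<gamma>)"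
  "sa_scale (Cc_alg GS) c f = (\<lambda>\<gamma>. c * f \<gamma>)" "sa_mult (Cc_alg GS) = convolution GS"
  "sa_star (Cc_alg GS) = gstar GS" "sa_norm (Cc_alg GS) = reduced_norm GS"
  by (simp_all add: Cc_alg_def Cc_GS_eq)

lemma isometric_rep_rho:
  assumes reg: "cstar_regular TYPE('a::left_cancellative_monoid)"
  shows "isometric_rep (Cc_alg (GS :: 'a germ set top_groupoid)) UNIV rho_chi_e"
proof
  show "sa_carrier (Cc_alg (GS :: 'a germ set top_groupoid)) \<noteq> {}" unfolding Cc_alg_simps using zero_bisection_span by blast
next
  fix x y :: "'a germ set \<Rightarrow> complex" assume "x \<in> sa_carrier (Cc_alg GS)" "y \<in> sa_carrier (Cc_alg GS)"
  then have xy: "x \<in> bisection_span" "y \<in> bisection_span" by (simp_all add: Cc_alg_simps)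
  show "sa_add (Cc_alg GS) x y \<in> sa_carrier (Cc_alg GS)" unfolding Cc_alg_simps by (rule bisection_span.add[OF xy])
  show "sa_mult (Cc_alg GS) x y \<in> sa_carrier (Cc_alg GS)" unfolding Cc_alg_simps by (rule bisection_span_convolution[OF xy])
  show "rho_chi_e (sa_add (Cc_alg GS) x y) = (\<lambda>\<xi> a. rho_chi_e x \<xi> a + rho_chi_e y \<xi> a)"
    unfolding Cc_alg_simps by (rule rho_add[OF xy])
  show "rho_chi_e (sa_mult (Cc_alg GS) x y) = rho_chi_e x \<circ> rho_chi_e y"
    unfolding Cc_alg_simps by (rule rho_convolution[OF xy])
  \<comment> \<open>The distance is the norm of a difference, which is again in the span, so the
    equality of norms applies to it.\<close>
  have s: "(\<lambda>\<gamma>. (-1) * y \<gamma>) \<in> bisection_span" by (rule bisection_span_scale[OF xy(2)])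
  have "sa_dist (Cc_alg GS) x y = op_norm UNIV (rho_chi_e (\<lambda>\<gamma>. x \<gamma> + (-1) * y \<gamma>))"
    unfolding sa_dist_def Cc_alg_simps by (rule reduced_norm_eq[OF reg bisection_span.add[OF xy(1) s]])
  then show "sa_dist (Cc_alg GS) x y = op_dist UNIV (rho_chi_e x) (rho_chi_e y)"
    unfolding rho_add[OF xy(1) s] rho_scale op_dist_eq .
next
  fix x :: "'a germ set \<Rightarrow> complex" assume "x \<in> sa_carrier (Cc_alg GS)"
  then have x: "x \<in> bisection_span" by (simp add: Cc_alg_simps)
  show "sa_scale (Cc_alg GS) c x \<in> sa_carrier (Cc_alg GS)" for c unfolding Cc_alg_simps by (rule bisection_span_scale[OF x])
  show "sa_star (Cc_alg GS) x \<in> sa_carrier (Cc_alg GS)" unfolding Cc_alg_simps by (rule bisection_span_gstar[OF x])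
  show "rho_chi_e (sa_scale (Cc_alg GS) c x) = (\<lambda>\<xi> a. c * rho_chi_e x \<xi> a)" for c
    unfolding Cc_alg_simps by (rule rho_scale)
  show "adjoint_pair UNIV (rho_chi_e x) (rho_chi_e (sa_star (Cc_alg GS) x))"
    unfolding Cc_alg_simps by (rule rho_gstar[OF x])
qed

theorem proposition2p12:
  assumes "cstar_regular TYPE('a::left_cancellative_monoid)"
  shows "star_isomorphism (reduced_cstar (GS :: 'a germ set top_groupoid))
           (reduced_monoid_cstar :: 'a op star_alg) rho_chi_e_ext"
proof -
  interpret isometric_rep "Cc_alg (GS :: 'a germ set top_groupoid)" UNIV rho_chi_e
    by (rule isometric_rep_rho[OF assms])
  show ?thesis
    unfolding reduced_cstar_def reduced_monoid_cstar_def rho_chi_e_ext_def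
  proof (rule star_isomorphism_completion)
    show "range lambda_op \<subseteq> rho_chi_e ` sa_carrier (Cc_alg (GS :: 'a germ set top_groupoid))"
    proof
      fix T :: "'a op" assume "T \<in> range lambda_op"
      then obtain s where "T = rho_chi_e (bisection_fn (ltrans s) (\<lambda>\<omega>. 1))" using lambda_op_eq by blast
      moreover have "bisection_fn (ltrans s) (\<lambda>\<omega>. 1) \<in> bisection_span" by (rule bisection_span.bisection_fn[OF left_hull.ltrans]) simp
      ultimately show "T \<in> rho_chi_e ` sa_carrier (Cc_alg GS)" unfolding Cc_alg_simps by blast
    qed
    show "rho_chi_e ` sa_carrier (Cc_alg (GS :: 'a germ set top_groupoid)) \<subseteq> M"
      if "closed_star_subalgebra (op_alg UNIV) M" "range lambda_op \<subseteq> M" for M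
      unfolding Cc_alg_simps using rho_in_M[OF that] by blast
  qed
qed

end
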